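(* Let $M,K\ge1$ be integers and let $\nu_1,\ldots,\nu_M\ge0$ and $\tilde\nu_1,\ldots,\tilde\nu_K\ge 0$ be fixed integers with $\tilde\nu_K=0$ (and $\nu_0=\tilde\nu_0=0$). Let $K_n(x,y)$ be the correlation kernel of the squared singular values of the product of $M$ Ginibre matrices and the inverse of a product of $K$ Ginibre matrices given by the double contour integral in the context. Let $x_0\in(0,+\infty)$ and let $\varphi\in\left(0,\frac{\pi}{M+1}\right)$ be the unique number with $$x_0=\frac{\left(\sin\left(\frac{M+1}{K+1}\varphi+\frac{K}{K+1}\pi\right)\right)^{M+1}}{(\sin\varphi)^{K+1}\left(\sin\left(\frac{M-K}{K+1}\varphi+\frac{K}{K+1}\pi\right)\right)^{M-K}}.$$ Set $$\rho(\varphi)=\frac{1}{\pi x_0}\,\frac{\sin\left(\frac{M+1}{K+1}\varphi+\frac{K}{K+1}\pi\right)}{\sin\left(\frac{M-K}{K+1}\varphi+\frac{K}{K+1}\pi\right)}\,\sin\varphi.$$ Then $$\lim_{n\to\infty}\frac{e^{-\pi\xi\cot\varphi}}{e^{-\pi\eta\cot\varphi}}\,\frac{n^{M-K-1}}{\rho(\varphi)}\,K_n\left(n^{M-K}\left(x_0+\frac{\xi}{n\rho(\varphi)}\right),\,n^{M-K}\left(x_0+\frac{\eta}{n\rho(\varphi)}\right)\right)=K_{\sin}(\xi,\eta)$$ uniformly for $\xi$ and $\eta$ in any compact subset of $\mathbb{R}$, where $K_{\sin}(x,y)=\frac{\sin\pi(x-y)}{\pi(x-y)}$ (equal to $1$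 when $x=y$).
   Context: Setting: $Y_{M,K}=X_M\cdots X_1(\tilde X_K\cdots\tilde X_1)^{-1}$, where $X_j$ ($j=1,\ldots,M$) and $\tilde X_k$ ($k=1,\ldots,K$) are independent complex Ginibre matrices (i.i.d. standard complex Gaussian entries) of sizes $(n+\nu_j)\times(n+\nu_{j-1})$ and $(n+\tilde\nu_k)\times(n+\tilde\nu_{k-1})$, with $\nu_0=\tilde\nu_0=\tilde\nu_K=0$ and $\nu_j,\tilde\nu_k\ge0$. The squared singular values of $Y_{M,K}$ form a determinantal point process on $(0,\infty)$ with correlation kernel, for $x,y>0$, $$K_n(x,y)=\frac{1}{(2\pi i)^2}\int_{-1/2-i\infty}^{-1/2+i\infty}ds\oint_\Sigma dt\,\prod_{j=0}^M\frac{\Gamma(s+\nu_j+1)}{\Gamma(t+\nu_j+1)}\,\prod_{k=1}^K\frac{\Gamma(n-s+\tilde\nu_k)}{\Gamma(n-t+\tilde\nu_k)}\,\frac{\Gamma(t-n+1)}{\Gamma(s-n+1)}\,\frac{x^ty^{-s-1}}{s-t},$$ where $\Sigma$ is a closed contour going around $0,1,\ldots,n-1$ once in the positive direction with $\operatorname{Re}t>-1/2$ for $t\in\Sigma$. This formula is taken as the definition of $K_n$. The displayed parametrization $\varphi\mapsto x_0$ is a one-to-one map from $(0,\pi/(M+1))$ onto $(0,+\infty)$. For $\xi,\eta$ in a fixed compact set the arguments of $K_n$ are positive for all large $n$. *)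

theory Defs
  imports "HOL-Complex_Analysis.Complex_Analysis"
begin

text \<open>
  Closed contours encircling $0, 1, \ldots, n-1$ once in the positive direction inside the open
  half-plane to the right of the line of integration for \<open>s\<close>. The contour is not required to be
  simple; only its winding numbers about the poles $0, \ldots, n-1$ matter for the kernel.
\<close>

definition encircling_contour :: "nat \<Rightarrow> (real \<Rightarrow> complex) \<Rightarrow> bool" where
  "encircling_contour n \<gamma> \<longleftrightarrow>
     valid_path \<gamma> \<and> pathfinish \<gamma> = pathstart \<gamma> \<and>
     (\<forall>t\<in>path_image \<gamma>. Re t > - 1 / 2) \<and>
     (\<forall>k<n. of_nat k \<notin> path_image \<gamma> \<and> winding_number \<gamma> (of_nat k) = 1)"

lemma encircling_contour_circlepath:
  assumes "n \<ge> 1"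
  shows "encircling_contour n (circlepath (of_real ((real n - 1) / 2)) (real n / 2 - 1 / 4))"
proof -
  let ?c = "complex_of_real ((real n - 1) / 2)" and ?r = "real n / 2 - 1 / 4"
  have r: "?r > 0" using assms by simp
  have inside: "norm (complex_of_nat k - ?c) < ?r" if "k < n" for k
  proof -
    have "norm (complex_of_nat k - ?c) = \<bar>real k - (real n - 1) / 2\<bar>"
      by (metis norm_of_real of_real_diff of_real_of_nat_eq)
    moreover have "real k \<le> real n - 1" using that by linarith
    ultimately show ?thesis using that by (simp add: abs_if field_simps)
  qed
  have right: "Re t > - 1 / 2" if "t \<in> sphere ?c ?r" for t
  proof -
    have "norm (?c - t) = ?r" using that by (simp add: dist_norm)
    moreover have "\<bar>Re (?c - t)\<bar> \<le> norm (?c - t)" by (rule abs_Re_le_cmod)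
    ultimately have "Re (?c - t) \<le> ?r" by linarith
    then show ?thesis by (simp add: field_simps)
  qed
  have "of_nat k \<notin> path_image (circlepath ?c ?r)" if "k < n" for k
    using inside[OF that] r by (simp add: dist_norm norm_minus_commute del: of_real_divide of_real_diff)
  moreover have "winding_number (circlepath ?c ?r) (of_nat k) = 1" if "k < n" for k
    using inside[OF that] by (rule winding_number_circlepath)
  moreover have "\<forall>t\<in>path_image (circlepath ?c ?r). Re t > - 1 / 2"
    unfolding path_image_circlepath abs_of_pos[OF r] using right by blast
  ultimately show ?thesis
    unfolding encircling_contour_def by simp
qed

text \<open>
  The integrand of the double contour integral. Reciprocals of \<open>Gamma\<close> are entire, as in the usual
  convention, because \<open>Gamma\<close> is \<open>0\<close> at its poles and division by \<open>0\<close> yields \<open>0\<close>; so the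
  zeros of the factors $1/\Gamma(n-t+\tilde\nu_k)$ at $t = n+\tilde\nu_k, n+\tilde\nu_k+1, \ldots$
  come out correctly.
\<close>

definition kernel_integrand ::
  "nat \<Rightarrow> nat \<Rightarrow> (nat \<Rightarrow> nat) \<Rightarrow> (nat \<Rightarrow> nat) \<Rightarrow> nat \<Rightarrow> real \<Rightarrow> real \<Rightarrow> complex \<Rightarrow> complex \<Rightarrow> complex"
where
  "kernel_integrand M K \<nu> \<nu>' n x y s t =
     (\<Prod>j=0..M. Gamma (s + of_nat (\<nu> j) + 1) / Gamma (t + of_nat (\<nu> j) + 1)) *
     (\<Prod>k=1..K. Gamma (of_nat n - s + of_nat (\<nu>' k)) / Gamma (of_nat n - t + of_nat (\<nu>' k))) *
     (Gamma (t - of_nat n + 1) / Gamma (s - of_nat n + 1)) *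
     (of_real x powr t * of_real y powr (- s - 1) / (s - t))"

text \<open>
  The line integral over $\mathrm{Re}\, s = -1/2$ is written with $s = -1/2 + iu$, $ds = i\,du$. The
  integral over \<open>u\<close> converges absolutely when $M + K \ge 1$. The kernel does not depend on the choice
  of \<open>\<gamma>\<close> among the contours satisfying \<open>encircling_contour n\<close>; for $x, y > 0$ its values are real,
  but the type is \<open>complex\<close>.
\<close>

definition correlation_kernel ::
  "nat \<Rightarrow> nat \<Rightarrow> (nat \<Rightarrow> nat) \<Rightarrow> (nat \<Rightarrow> nat) \<Rightarrow> nat \<Rightarrow> (real \<Rightarrow> complex) \<Rightarrow> real \<Rightarrow> real \<Rightarrow> complex"
where
  "correlation_kernel M K \<nu> \<nu>' n \<gamma> x y =
     1 / (2 * of_real pi * \<i>)\<^sup>2 *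
     (\<i> * (LINT u|lborel. contour_integral \<gamma> (kernel_integrand M K \<nu> \<nu>' n x y (Complex (- 1 / 2) u))))"

definition bulk_point :: "nat \<Rightarrow> nat \<Rightarrow> real \<Rightarrow> real" where
  "bulk_point M K \<phi> =
     sin ((real M + 1) / (real K + 1) * \<phi> + real K / (real K + 1) * pi) ^ (M + 1) /
     (sin \<phi> ^ (K + 1) *
      sin ((real M - real K) / (real K + 1) * \<phi> + real K / (real K + 1) * pi) powi (int M - int K))"

definition bulk_density :: "nat \<Rightarrow> nat \<Rightarrow> real \<Rightarrow> real" where
  "bulk_density M K \<phi> =
     1 / (pi * bulk_point M K \<phi>) *
     (sin ((real M + 1) / (real K + 1) * \<phi> + real K / (real K + 1) * pi) /
      sin ((real M - real K) / (real K + 1) * \<phi> + real K / (real K + 1) * pi)) *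
     sin \<phi>"

definition sine_kernel :: "real \<Rightarrow> real \<Rightarrow> real" where
  "sine_kernel x y = (if x = y then 1 else sin (pi * (x - y)) / (pi * (x - y)))"

end

theory Submission
  imports Defs "HOL-Real_Asymp.Real_Asymp" "HOL-Probability.Sinc_Integral"
begin

text \<open>
  After cancelling the common factor at $\nu_0 = 0$, the double integral has the form
  $\frac{1}{(2\pi i)^2}\int ds\oint dt\,\frac{G_n(s)}{G_n(t)}\frac{x^t y^{-s-1}}{s-t}$ with $G_n$ a product of Gamma functions
  and the polynomial with zeros $0, \ldots, n-1$. On the scale $s = nz$ the modulus of $G_n$ behaves like $e^{nH(z)}$, and
  $H$ has one critical point $z_0 = a + ib$ in the upper half-plane, with argument $\varphi$ and $b = \pi x_0 \rho$.

  Along the vertical line through $z_0$ the phase $H$ is largest at $z_0, \bar z_0$, and on the rectangle with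
  horizontal sides through $z_0, \bar z_0$ and vertical sides just outside $[0,1]$ it is smallest there. Moving the
  $s$-integral to this line and the $t$-integral to this rectangle costs the residue at $t = s$ for
  $|\mathrm{Im}\, z| < b$; it integrates to
  $\frac{1}{2\pi}\int_{-nb}^{nb} x^{s} y^{-s-1}\,du$, $s = na + iu$, an exact sinc function which converges to the sine kernel. In what is
  left, the ratio $|G_n(s)/G_n(t)|$ is bounded and tends to $0$ off the two saddle points.
\<close>

section \<open>Two-sided Stirling bounds in a half-plane\<close>

text \<open>The phase is never expanded at the saddle points. The remaining double integral only has
  to tend to 0, and the Gamma products enter it as a quotient of values at s and t, so two-sided
  bounds up to constant factors suffice. They must however be uniform up to the sides of the
  rectangle, which stay at distance 1/2 from the extreme nodes while z comes within O(1/n) of 0 and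
  1. Hence Stirling's formula takes the form of global bounds with power weights, and the sides need
  an argument of their own; there M, K >= 1 enters, as p, q >= 2. The zeros of the node polynomial
  are isolated in the factor sin(pi t), which is harmless at half-integral Re t and at large |Im t|.
  Uniformity in \<xi> and \<eta> comes from |Re t| <= n: the points x and y are seen only through
  |ln x - (l + (M-K) ln n)| <= R/n, so replacing them by their common leading value costs no more
  than a factor e^R.\<close>

lemma Ln_taylor2:
  fixes w :: complex
  assumes "norm w \<le> 1/2"
  shows "norm (Ln (1 + w) - (w - w^2/2)) \<le> 8 * norm w ^ 3"
proof -
  define f :: "nat \<Rightarrow> complex \<Rightarrow> complex" where
    "f = (\<lambda>i u. if i = 0 then Ln (1 + u) else if i = 1 then inverse (1 + u)
               else if i = 2 then - inverse ((1 + u)^2) else 2 * inverse ((1 + u)^3))"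
  let ?S = "cball 0 (1/2) :: complex set"
  have re: "Re (1 + u) \<ge> 1/2" if "u \<in> ?S" for u
    using that abs_Re_le_cmod[of u] by auto
  have nz: "1 + u \<noteq> 0" "1 + u \<notin> \<real>\<^sub>\<le>\<^sub>0" if "u \<in> ?S" for u
    using re[OF that] by (auto simp: complex_nonpos_Reals_iff complex_eq_iff)
  have l: "((\<lambda>u. 1 + u) has_field_derivative 1) (at u within ?S)" for u
    by (auto intro!: derivative_eq_intros)
  have d0: "(f 0 has_field_derivative f (Suc 0) u) (at u within ?S)" if u: "u \<in> ?S" for u
    using DERIV_chain2[OF has_field_derivative_Ln[OF nz(2)[OF u]] l] by (simp add: f_def)
  have d1: "(f 1 has_field_derivative f (Suc 1) u) (at u within ?S)" if u: "u \<in> ?S" for u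
    using DERIV_inverse_fun[OF l nz(1)[OF u]] by (simp add: f_def power2_eq_square)
  have d2: "(f 2 has_field_derivative f (Suc 2) u) (at u within ?S)" if u: "u \<in> ?S" for u
  proof -
    have "((\<lambda>u. (1 + u)^2) has_field_derivative 2 * (1 + u)) (at u within ?S)"
      using DERIV_power[OF l, of 2 u] by simp
    from DERIV_minus[OF DERIV_inverse_fun[OF this]] nz(1)[OF u]
    have "((\<lambda>u. - inverse ((1 + u)^2)) has_field_derivative
        2 * (1 + u) * inverse (((1 + u)^2)^Suc(Suc 0))) (at u within ?S)" by simp
    moreover have "2 * (1 + u) * inverse (((1 + u)^2)^Suc(Suc 0)) = 2 * inverse ((1 + u) ^ 3)"
      using nz(1)[OF u] by (simp add: divide_simps) (simp add: power2_eq_square power3_eq_cube power4_eq_xxxx algebra_simps)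
    ultimately show ?thesis by (simp add: f_def)
  qed
  have d: "(f i has_field_derivative f (Suc i) u) (at u within ?S)" if "u \<in> ?S" "i \<le> 2" for u i
  proof -
    have "i = 0 \<or> i = 1 \<or> i = 2" using that(2) by auto
    then show ?thesis using d0[OF that(1)] d1[OF that(1)] d2[OF that(1)] by auto
  qed
  \<comment> \<open>On this disc Re (1 + u) >= 1/2, so the third derivative 2/(1+u)^3 is at most 16;
    the remainder in \<open>complex_Taylor\<close> carries 1/2!, which gives the 8.\<close>
  have B: "norm (f (Suc 2) u) \<le> 16" if u: "u \<in> ?S" for u
  proof -
    have "norm (1 + u) \<ge> 1/2" using re[OF u] complex_Re_le_cmod[of "1+u"] by linarith
    then have "norm (1 + u) ^ 3 \<ge> (1/2)^3" by (intro power_mono) auto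
    then have "inverse (norm (1 + u) ^ 3) \<le> inverse ((1/2)^3)" by (intro le_imp_inverse_le) auto
    moreover have "norm (f (Suc 2) u) = 2 * inverse (norm (1 + u) ^ 3)"
      by (simp add: f_def norm_mult norm_inverse norm_power)
    ultimately show ?thesis by (simp add: power3_eq_cube)
  qed
  have "norm (f 0 w - (\<Sum>i\<le>2. f i 0 * (w - 0) ^ i / fact i)) \<le> 16 * norm (w - 0) ^ Suc 2 / fact 2"
    by (rule complex_Taylor[where f = f and S = ?S and n = 2 and B = 16 and w = 0 and z = w])
       (use assms d B in auto)
  then show ?thesis
    by (simp add: f_def numeral_2_eq_2 power3_eq_cube algebra_simps)
qed

text \<open>The constant $\frac12\ln 2\pi$ of Stirling's formula is left out: all estimates below need the Gamma
  function only up to constant factors.\<close>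

definition lstirling :: "complex \<Rightarrow> complex" where
  "lstirling z = (z - 1/2) * Ln z - z"

text \<open>With w = 1/z the main terms cancel exactly: (z + 1/2)(w - w^2/2) = 1 - w^2/4. So
  \<open>lstirling\<close> obeys the functional equation of ln Gamma up to an error of order |z|^-2,
  which can be summed over integer shifts; 11 covers 8 * 5/4 + 1/4.\<close>

lemma lstirling_step:
  fixes z :: complex
  assumes "Re z \<ge> 2"
  shows "norm (lstirling (z + 1) - lstirling z - Ln z) \<le> 11 / (norm z)^2"
proof -
  define w where "w = 1 / z"
  have z: "z \<noteq> 0" "norm z \<ge> 2" using assms complex_Re_le_cmod[of z] by auto
  have w: "norm w \<le> 1/2" using z by (simp add: w_def norm_divide divide_simps)
  have "Ln (z + 1) = Ln z + Ln (1 + w)"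
  proof -
    have "Re (1 + w) > 0" using w abs_Re_le_cmod[of w] by auto
    then have "Ln (z * (1 + w)) = Ln z + Ln (1 + w)"
      using assms Re_Ln_pos_lt_imp[of z] Re_Ln_pos_lt_imp[of "1+w"]
      by (intro Ln_times_simple) (auto simp: abs_less_iff complex_eq_iff)
    moreover have "z * (1 + w) = z + 1" using z by (simp add: w_def field_simps)
    ultimately show ?thesis by simp
  qed
  then have "lstirling (z + 1) - lstirling z - Ln z = (z + 1/2) * Ln (1 + w) - 1"
    by (simp add: lstirling_def algebra_simps)
  also have "\<dots> = (z + 1/2) * (Ln (1 + w) - (w - w^2/2)) - w^2/4"
    using z by (simp add: w_def field_simps power2_eq_square)
  finally have "norm (lstirling (z + 1) - lstirling z - Ln z)
      \<le> norm (z + 1/2) * norm (Ln (1 + w) - (w - w^2/2)) + norm w^2/4"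
    by (metis norm_triangle_ineq4 norm_mult norm_divide norm_power norm_numeral)
  also have "\<dots> \<le> (5/4 * norm z) * (8 * norm w ^ 3) + norm w^2/4"
    using norm_triangle_ineq[of z "1/2"] z w
    by (intro add_mono mult_mono Ln_taylor2) (auto simp: norm_divide)
  also have "\<dots> \<le> 11 / (norm z)^2"
    using z by (simp add: w_def norm_divide field_simps power2_eq_square power3_eq_cube)
  finally show ?thesis .
qed

definition re_zlnz :: "real \<Rightarrow> real \<Rightarrow> real" where
  "re_zlnz x v = x * ln (x\<^sup>2 + v\<^sup>2) / 2 - v * arctan (v / x)"

lemma Re_mult_Ln:
  assumes "Re z > 0"
  shows "Re (z * Ln z) = re_zlnz (Re z) (Im z)"
proof -
  have z: "z \<noteq> 0" using assms by auto
  have "Im (Ln z) = arctan (Im z / Re z)"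
    using arg_conv_arctan[OF assms] Arg_eq_Im_Ln[OF z] by simp
  moreover have "Re (Ln z) = ln ((Re z)\<^sup>2 + (Im z)\<^sup>2) / 2"
    using z by (simp add: cmod_def ln_sqrt sum_power2_gt_zero_iff complex_eq_iff)
  ultimately show ?thesis by (simp add: re_zlnz_def)
qed

lemma Re_lstirling:
  assumes "Re z > 0"
  shows "Re (lstirling z) = re_zlnz (Re z) (Im z) - ln (norm z) / 2 - Re z"
proof -
  have z: "z \<noteq> 0" using assms by auto
  have "lstirling z = z * Ln z - Ln z / 2 - z" by (simp add: lstirling_def algebra_simps)
  then show ?thesis using Re_mult_Ln[OF assms] z by simp
qed

text \<open>The law Gamma(z+m+1) / m! ~ m^z for fixed z, checked for the model
  \<open>lstirling\<close> in place of ln Gamma.\<close>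

lemma stirling_limit:
  fixes z :: complex
  assumes "Re z > 0"
  shows "(\<lambda>m. Re (lstirling (z + of_nat m + 1)) - Re (lstirling (of_nat m + 1)) - Re z * ln (real m)) \<longlonglongrightarrow> 0"
proof -
  define x y where "x = Re z" and "y = Im z"
  \<comment> \<open>The limit is x, in unsimplified form: the two logarithms differ by about
    x/(m+1).\<close>
  have 1: "(\<lambda>m. (x + real m + 1/2) * (ln ((x + real m + 1)^2 + y^2) / 2 - ln (real m + 1))) \<longlonglongrightarrow> (x * 2 + 2) / 2 - 1"
    by real_asymp
  have 2: "(\<lambda>m. x * (ln (real m + 1) - ln (real m))) \<longlonglongrightarrow> 0"
    by real_asymp
  have "(\<lambda>m. y / (x + real m + 1)) \<longlonglongrightarrow> 0" by real_asymp
  then have 3: "(\<lambda>m. y * arctan (y / (x + real m + 1))) \<longlonglongrightarrow> y * arctan 0"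
    by (intro tendsto_intros)
  have "(\<lambda>m. (x + real m + 1/2) * (ln ((x + real m + 1)^2 + y^2) / 2 - ln (real m + 1))
      + x * (ln (real m + 1) - ln (real m)) - y * arctan (y / (x + real m + 1)) - x)
      \<longlonglongrightarrow> ((x * 2 + 2) / 2 - 1) + 0 - y * arctan 0 - x"
    by (intro tendsto_diff tendsto_add 1 2 3 tendsto_const)
  moreover have "(x + real m + 1/2) * (ln ((x + real m + 1)^2 + y^2) / 2 - ln (real m + 1))
      + x * (ln (real m + 1) - ln (real m)) - y * arctan (y / (x + real m + 1)) - x
     = Re (lstirling (z + of_nat m + 1)) - Re (lstirling (of_nat m + 1)) - Re z * ln (real m)" for m
  proof -
    have p: "Re (z + of_nat m + 1) > 0" "Re (of_nat m + 1) > 0" using assms by auto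
    have "(x + real m + 1)\<^sup>2 + y\<^sup>2 > 0" using assms by (intro add_pos_nonneg) (auto simp: x_def)
    then have n1: "ln (norm (z + of_nat m + 1)) = ln ((x + real m + 1)\<^sup>2 + y\<^sup>2) / 2"
      by (simp add: cmod_def ln_sqrt x_def y_def)
    have n2: "norm (of_nat m + 1 :: complex) = real m + 1"
      by (metis norm_of_nat of_nat_1 of_nat_add)
    have n3: "ln ((1 + real m)\<^sup>2) = 2 * ln (1 + real m)" by (simp add: ln_realpow)
    show ?thesis
      unfolding Re_lstirling[OF p(1)] Re_lstirling[OF p(2)] n1 n2
      by (simp add: re_zlnz_def x_def y_def n3 algebra_simps) (simp add: n3 field_simps)
  qed
  moreover have "((x * 2 + 2) / 2 - 1) + 0 - y * arctan 0 - x = 0" by (simp add: field_simps)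
  ultimately show ?thesis by simp
qed

text \<open>By Stirling's formula this quotient tends to sqrt(2 pi); only positive upper and lower
  bounds are derived here.\<close>

definition stirling_quot :: "complex \<Rightarrow> real" where
  "stirling_quot z = norm (Gamma z) / exp (Re (lstirling z))"

lemma Re_pos_not_nonpos_Ints: "Re z > 0 \<Longrightarrow> z \<notin> \<int>\<^sub>\<le>\<^sub>0"
  by (auto elim!: nonpos_Ints_cases)

lemma stirling_quot_pos: "Re z > 0 \<Longrightarrow> stirling_quot z > 0"
  unfolding stirling_quot_def by (simp add: Gamma_eq_zero_iff Re_pos_not_nonpos_Ints)

text \<open>One step to the right multiplies the quotient by exp(-d) with |d| <= 11/(k+2)^2 <= 11
  (1/(k+1) - 1/(k+2)). These bounds telescope, so any number of steps costs at most a factor e^11,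
  uniformly in z.\<close>

lemma stirling_quot_shift:
  assumes "Re z \<ge> 2"
  shows "stirling_quot (z + of_nat k) \<le> stirling_quot z * exp (11 * (1 - 1 / (real k + 1)))
       \<and> stirling_quot z \<le> stirling_quot (z + of_nat k) * exp (11 * (1 - 1 / (real k + 1)))"
proof (induction k)
  case 0
  then show ?case by simp
next
  case (Suc k)
  define w where "w = z + of_nat k"
  define d where "d = Re (lstirling (w + 1) - lstirling w - Ln w)"
  have w: "Re w \<ge> 2 + real k" using assms by (simp add: w_def)
  then have w0: "w \<noteq> 0" "w \<notin> \<int>\<^sub>\<le>\<^sub>0" using Re_pos_not_nonpos_Ints[of w] by auto
  have "\<bar>d\<bar> \<le> 11 / (norm w)^2"
    using lstirling_step[of w] w abs_Re_le_cmod[of "lstirling (w + 1) - lstirling w - Ln w"]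
    by (simp add: d_def)
  also have "\<dots> \<le> 11 / (2 + real k)^2"
    using w complex_Re_le_cmod[of w] by (intro divide_left_mono power_mono) (auto intro!: mult_pos_pos zero_less_power)
  also have "\<dots> \<le> 11 * (1 / (real k + 1) - 1 / (real (Suc k) + 1))"
  proof -
    have "11 / (2 + real k)^2 \<le> 11 / ((real k + 1) * (real k + 2))"
      by (intro divide_left_mono mult_pos_pos zero_less_power) (auto simp: power2_eq_square algebra_simps)
    also have "\<dots> = 11 * (1 / (real k + 1) - 1 / (real (Suc k) + 1))"
      by (simp add: field_simps)
    finally show ?thesis .
  qed
  finally have d: "\<bar>d\<bar> \<le> 11 * (1 / (real k + 1) - 1 / (real (Suc k) + 1))" .
  have "exp (Re (Ln w)) = norm w" using w0(1) by (metis exp_Ln norm_exp_eq_Re)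
  then have "exp (Re (lstirling (w + 1))) = exp (Re (lstirling w)) * norm w * exp d"
    using w0(1) by (simp add: d_def exp_diff)
  moreover have "Gamma (w + 1) = w * Gamma w" using w0 by (simp add: Gamma_plus1)
  ultimately have q: "stirling_quot (w + 1) = stirling_quot w * exp (- d)"
    using w0 by (simp add: stirling_quot_def norm_mult exp_minus field_simps)
  have pos: "stirling_quot w > 0" "stirling_quot z > 0" using w assms by (auto intro!: stirling_quot_pos)
  let ?e = "\<lambda>k. exp (11 * (1 - 1 / (real k + 1)))"
  have ee: "?e k * exp (11 * (1 / (real k + 1) - 1 / (real (Suc k) + 1))) = ?e (Suc k)"
    by (simp add: algebra_simps flip: exp_add)
  have sing_wt: "z + of_nat (Suc k) = w + 1" by (simp add: w_def)
  have "stirling_quot (w + 1) \<le> (stirling_quot z * ?e k) * exp (11 * (1 / (real k + 1) - 1 / (real (Suc k) + 1)))"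
    unfolding q using Suc d pos by (intro mult_mono) (auto simp: w_def)
  moreover have "stirling_quot z \<le> stirling_quot (w + 1) * ?e (Suc k)"
  proof -
    have "stirling_quot z \<le> stirling_quot w * ?e k" using Suc by (simp add: w_def)
    also have "\<dots> = stirling_quot (w + 1) * (exp d * ?e k)" by (simp add: q flip: exp_add)
    also have "\<dots> \<le> stirling_quot (w + 1) * (exp (11 * (1 / (real k + 1) - 1 / (real (Suc k) + 1))) * ?e k)"
      using d pos by (intro mult_left_mono mult_right_mono) (auto simp: q)
    finally show ?thesis using ee by (simp add: mult_ac)
  qed
  ultimately show ?case unfolding sing_wt using ee by (simp add: mult_ac)
qed

text \<open>Euler's limit m! m^z / (z)_(m+1) -> Gamma(z) and \<open>stirling_limit\<close> say the
  same about Gamma and about its model, so the quotient far to the right of z agrees asymptotically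
  with the one on the positive integers.\<close>

lemma stirling_quot_limit:
  assumes "Re z > 0"
  shows "(\<lambda>m. stirling_quot (z + of_nat m + 1) / stirling_quot (of_nat m + 1)) \<longlonglongrightarrow> 1"
proof -
  have nz: "z \<notin> \<int>\<^sub>\<le>\<^sub>0" "Gamma z \<noteq> 0"
    using Re_pos_not_nonpos_Ints[OF assms] by (auto simp: Gamma_eq_zero_iff)
  have "(\<lambda>m. norm (Gamma z) / norm (Gamma_series z m)) \<longlonglongrightarrow> norm (Gamma z) / norm (Gamma z)"
    using nz by (intro tendsto_intros Gamma_series_LIMSEQ) auto
  then have 1: "(\<lambda>m. norm (Gamma z) / norm (Gamma_series z m)) \<longlonglongrightarrow> 1" using nz by simp
  have 2: "(\<lambda>m. exp (- (Re (lstirling (z + of_nat m + 1)) - Re (lstirling (of_nat m + 1)) - Re z * ln (real m)))) \<longlonglongrightarrow> exp (- 0)"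
    by (intro tendsto_intros stirling_limit assms)
  have "(\<lambda>m. norm (Gamma z) / norm (Gamma_series z m) *
     exp (- (Re (lstirling (z + of_nat m + 1)) - Re (lstirling (of_nat m + 1)) - Re z * ln (real m)))) \<longlonglongrightarrow> 1"
    using tendsto_mult[OF 1 2] by simp
  moreover have "stirling_quot (z + of_nat m + 1) / stirling_quot (of_nat m + 1) = norm (Gamma z) / norm (Gamma_series z m) *
     exp (- (Re (lstirling (z + of_nat m + 1)) - Re (lstirling (of_nat m + 1)) - Re z * ln (real m)))" for m
  proof -
    have "Gamma (z + of_nat (m + 1)) = pochhammer z (m + 1) * Gamma z"
      using pochhammer_Gamma[OF nz(1), of "m + 1"] nz by (simp add: field_simps)
    then have g: "norm (Gamma (z + of_nat m + 1)) = norm (pochhammer z (m + 1)) * norm (Gamma z)"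
      by (simp add: norm_mult add_ac)
    have "Gamma (of_nat m + 1 :: complex) = fact m"
      using Gamma_fact[of m, where 'a = complex] by (simp add: add_ac)
    then have f: "norm (Gamma (of_nat m + 1 :: complex)) = fact m" by simp
    show ?thesis
      unfolding stirling_quot_def g f Gamma_series_def
      by (simp add: norm_mult norm_divide exp_diff exp_minus exp_add field_simps)
  qed
  ultimately show ?thesis by simp
qed

text \<open>Every z is linked to the point 2: shift z far to the right, compare with a positive
  integer there at the price of a factor 2, and shift back to 2. Each shift costs e^11, so the
  constants do not depend on z although m does.\<close>

lemma stirling_quot_bounded:
  obtains c C where "0 < c" "0 < C" "\<And>z. Re z \<ge> 2 \<Longrightarrow> c \<le> stirling_quot z \<and> stirling_quot z \<le> C"
proof -
  have e: "exp (11 * (1 - 1 / (real k + 1))) \<le> exp (11 :: real)" for k by simp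
  have shift: "stirling_quot (z + of_nat k) \<le> stirling_quot z * exp 11 \<and> stirling_quot z \<le> stirling_quot (z + of_nat k) * exp 11"
    if "Re z \<ge> 2" for z k
  proof -
    have "stirling_quot z > 0" "stirling_quot (z + of_nat k) > 0" using that by (auto intro!: stirling_quot_pos)
    then have "stirling_quot z * exp (11 * (1 - 1 / (real k + 1))) \<le> stirling_quot z * exp 11"
      "stirling_quot (z + of_nat k) * exp (11 * (1 - 1 / (real k + 1))) \<le> stirling_quot (z + of_nat k) * exp 11"
      using e[of k] by (intro mult_left_mono; simp)+
    then show ?thesis using stirling_quot_shift[OF that, of k] by linarith
  qed
  have c2: "stirling_quot 2 > 0" by (rule stirling_quot_pos) simp
  have "stirling_quot 2 / (2 * exp 22) \<le> stirling_quot z \<and> stirling_quot z \<le> 2 * exp 22 * stirling_quot 2" if z: "Re z \<ge> 2" for z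
  proof -
    have "\<forall>\<^sub>F m in sequentially. dist (stirling_quot (z + of_nat m + 1) / stirling_quot (of_nat m + 1)) 1 < 1/2"
      using z by (intro tendstoD stirling_quot_limit) auto
    then have "\<forall>\<^sub>F m in sequentially. dist (stirling_quot (z + of_nat m + 1) / stirling_quot (of_nat m + 1)) 1 < 1/2 \<and> m \<ge> 1"
      using eventually_ge_at_top by (rule eventually_conj)
    then obtain m where m: "dist (stirling_quot (z + of_nat m + 1) / stirling_quot (of_nat m + 1)) 1 < 1/2" "m \<ge> 1"
      by (auto dest!: eventually_happens)
    define u v where "u = stirling_quot (z + of_nat m + 1)" and "v = stirling_quot (of_nat m + 1)"
    have uv: "u > 0" "v > 0" unfolding u_def v_def using z by (auto intro!: stirling_quot_pos)
    have "\<bar>u / v - 1\<bar> < 1/2" using m(1) by (simp add: dist_real_def u_def v_def)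
    then have "u / v \<le> 2" "1/2 \<le> u / v" by linarith+
    then have r: "u \<le> 2 * v" "v \<le> 2 * u" using uv by (auto simp: field_simps)
    have s1: "u \<le> stirling_quot z * exp 11" "stirling_quot z \<le> u * exp 11"
      using shift[OF z, of "m + 1"] by (auto simp: u_def add_ac)
    \<comment> \<open>The integer m + 1 is reached from 2 in k = m - 1 steps, which is why m >= 1
      was demanded.\<close>
    obtain k where k: "m = Suc k" using m(2) by (cases m) auto
    have k2: "(2 :: complex) + of_nat k = of_nat m + 1" by (simp add: k)
    have s2: "v \<le> stirling_quot 2 * exp 11" "stirling_quot 2 \<le> v * exp 11"
      using shift[of 2 k] unfolding k2 by (auto simp: v_def)
    have e22: "exp (22::real) = exp 11 * exp 11" by (simp flip: exp_add)
    have "u \<le> 2 * (stirling_quot 2 * exp 11)" using r(1) s2(1) by linarith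
    then have 1: "u * exp 11 \<le> (2 * (stirling_quot 2 * exp 11)) * exp 11" by (intro mult_right_mono) auto
    have "v \<le> 2 * (stirling_quot z * exp 11)" using r(2) s1(1) by linarith
    then have 2: "v * exp 11 \<le> (2 * (stirling_quot z * exp 11)) * exp 11" by (intro mult_right_mono) auto
    have "stirling_quot z \<le> 2 * exp 22 * stirling_quot 2" using order_trans[OF s1(2) 1] unfolding e22 by (simp only: mult_ac)
    moreover have "stirling_quot 2 \<le> stirling_quot z * (2 * exp 22)" using order_trans[OF s2(2) 2] unfolding e22 by (simp only: mult_ac)
    ultimately show ?thesis by (simp add: divide_le_eq)
  qed
  then show ?thesis using c2 that[of "stirling_quot 2 / (2 * exp 22)" "2 * exp 22 * stirling_quot 2"] by auto
qed

section \<open>The phase function\<close>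

lemma re_zlnz_minus [simp]: "re_zlnz x (- v) = re_zlnz x v"
  by (simp add: re_zlnz_def arctan_minus)

lemma re_zlnz_scale:
  assumes "N > 0" "x > 0"
  shows "re_zlnz (N * x) (N * v) = N * re_zlnz x v + N * x * ln N"
proof -
  have "(N * x)\<^sup>2 + (N * v)\<^sup>2 = N\<^sup>2 * (x\<^sup>2 + v\<^sup>2)" by (simp add: power2_eq_square algebra_simps)
  moreover have "x\<^sup>2 + v\<^sup>2 > 0" using assms by (intro add_pos_nonneg) auto
  ultimately have "ln ((N * x)\<^sup>2 + (N * v)\<^sup>2) = 2 * ln N + ln (x\<^sup>2 + v\<^sup>2)"
    using assms by (simp add: ln_mult ln_realpow)
  then show ?thesis using assms by (simp add: re_zlnz_def field_simps)
qed

text \<open>The derivative of z Ln z is Ln z + 1; hence the real part has v-derivative minus the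
  argument and x-derivative 1 + ln |z|. All monotonicity of the phase comes from these two
  formulas.\<close>

lemma DERIV_re_zlnz_right:
  assumes "x > 0"
  shows "(re_zlnz x has_real_derivative - arctan (v / x)) (at v)"
proof -
  have p: "x\<^sup>2 + v\<^sup>2 > 0" using assms by (intro add_pos_nonneg) auto
  have q: "1 + (v / x)\<^sup>2 = (x\<^sup>2 + v\<^sup>2) / x\<^sup>2" using assms by (simp add: field_simps)
  have "((\<lambda>v. x\<^sup>2 + v\<^sup>2) has_real_derivative 2 * v) (at v)"
    by (auto intro!: derivative_eq_intros)
  from DERIV_chain2[OF DERIV_ln_divide[OF p] this]
  have 1: "((\<lambda>v. ln (x\<^sup>2 + v\<^sup>2)) has_real_derivative 2 * v / (x\<^sup>2 + v\<^sup>2)) (at v)" by simp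
  have 2: "((\<lambda>v. arctan (v / x)) has_real_derivative inverse (1 + (v / x)\<^sup>2) * (1 / x)) (at v)"
    by (intro DERIV_chain2[OF DERIV_arctan] DERIV_cdivide DERIV_ident)
  have "((\<lambda>v. x * ln (x\<^sup>2 + v\<^sup>2) / 2 - v * arctan (v / x)) has_real_derivative
      x * (2 * v / (x\<^sup>2 + v\<^sup>2)) / 2 - (1 * arctan (v / x) + inverse (1 + (v / x)\<^sup>2) * (1 / x) * v)) (at v)"
    by (intro DERIV_diff DERIV_cdivide DERIV_cmult DERIV_mult DERIV_ident 1 2)
  moreover have "x * (2 * v / (x\<^sup>2 + v\<^sup>2)) / 2 - (1 * arctan (v / x) + inverse (1 + (v / x)\<^sup>2) * (1 / x) * v)
      = - arctan (v / x)"
  proof -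
    have e1: "x * (2 * v / S) / 2 = x * v / S" for S by simp
    have e2: "inverse (S / x\<^sup>2) * (1 / x) * v = x * v / S" for S
      using assms by (simp add: power2_eq_square)
    show ?thesis unfolding q e1 e2 by simp
  qed
  ultimately show ?thesis unfolding re_zlnz_def by simp
qed

lemma DERIV_re_zlnz_left:
  assumes "x > 0"
  shows "((\<lambda>x. re_zlnz x v) has_real_derivative ln (x\<^sup>2 + v\<^sup>2) / 2 + 1) (at x)"
proof -
  have p: "x\<^sup>2 + v\<^sup>2 > 0" using assms by (intro add_pos_nonneg) auto
  have q: "1 + (v / x)\<^sup>2 = (x\<^sup>2 + v\<^sup>2) / x\<^sup>2" using assms by (simp add: field_simps)
  have "((\<lambda>x. x\<^sup>2 + v\<^sup>2) has_real_derivative 2 * x) (at x)"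
    by (auto intro!: derivative_eq_intros)
  from DERIV_chain2[OF DERIV_ln_divide[OF p] this]
  have 1: "((\<lambda>x. ln (x\<^sup>2 + v\<^sup>2)) has_real_derivative 2 * x / (x\<^sup>2 + v\<^sup>2)) (at x)" by simp
  have "((\<lambda>x. v * inverse x) has_real_derivative v * (- (inverse x ^ Suc (Suc 0)))) (at x)"
    using assms by (intro DERIV_cmult DERIV_inverse) auto
  then have "((\<lambda>x. v / x) has_real_derivative - v / x\<^sup>2) (at x)"
    by (simp add: divide_inverse power2_eq_square)
  from DERIV_chain2[OF DERIV_arctan this]
  have 2: "((\<lambda>x. arctan (v / x)) has_real_derivative inverse (1 + (v / x)\<^sup>2) * (- v / x\<^sup>2)) (at x)" .
  have "((\<lambda>x. x * ln (x\<^sup>2 + v\<^sup>2) / 2 - v * arctan (v / x)) has_real_derivative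
      (1 * ln (x\<^sup>2 + v\<^sup>2) + 2 * x / (x\<^sup>2 + v\<^sup>2) * x) / 2 - v * (inverse (1 + (v / x)\<^sup>2) * (- v / x\<^sup>2))) (at x)"
    by (intro DERIV_diff DERIV_cdivide DERIV_cmult DERIV_mult DERIV_ident 1 2)
  moreover have "(1 * ln (x\<^sup>2 + v\<^sup>2) + 2 * x / (x\<^sup>2 + v\<^sup>2) * x) / 2 - v * (inverse (1 + (v / x)\<^sup>2) * (- v / x\<^sup>2))
      = ln (x\<^sup>2 + v\<^sup>2) / 2 + 1"
  proof -
    have "(2 * x / (x\<^sup>2 + v\<^sup>2) * x) / 2 - v * (inverse (1 + (v / x)\<^sup>2) * (- v / x\<^sup>2)) = x\<^sup>2 / (x\<^sup>2 + v\<^sup>2) + v\<^sup>2 / (x\<^sup>2 + v\<^sup>2)"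
    proof -
      have e1: "(2 * x / S * x) / 2 = x\<^sup>2 / S" for S by (simp add: power2_eq_square)
      have e2: "v * (inverse (S / x\<^sup>2) * (- v / x\<^sup>2)) = - (v\<^sup>2 / S)" for S
        using assms by (simp add: power2_eq_square)
      show ?thesis unfolding q e1 e2 by simp
    qed
    also have "\<dots> = (x\<^sup>2 + v\<^sup>2) / (x\<^sup>2 + v\<^sup>2)" by (simp only: add_divide_distrib)
    also have "\<dots> = 1" using p by (simp del: sum_power2_eq_zero_iff)
    finally show ?thesis by (simp add: add_divide_distrib)
  qed
  ultimately show ?thesis unfolding re_zlnz_def by simp
qed

text \<open>With $p = M+1$, $q = K+1$, $l = \ln x_0$ and $z = x + iv$, Stirling's formula gives $n$ times this
  function as the leading exponent of the modulus of the product of Gamma functions at $nz$; the term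
  \<open>pi * \<bar>v\<bar>\<close> stems from $\sin \pi n z$.\<close>

definition phase :: "real \<Rightarrow> real \<Rightarrow> real \<Rightarrow> real \<Rightarrow> real \<Rightarrow> real" where
  "phase p q l x v = p * (re_zlnz x v - x) + q * (re_zlnz (1 - x) v - (1 - x)) + pi * \<bar>v\<bar> - x * l"

lemma phase_abs: "phase p q l x \<bar>v\<bar> = phase p q l x v"
  by (simp add: phase_def abs_if)

text \<open>The reflection z -> 1 - z exchanges p and q and changes the sign of l. It transfers
  statements about the left end of the interval to the right end.\<close>

lemma phase_swap: "phase p q l (1 - x) v = phase q p (- l) x v - l"
  by (simp add: phase_def algebra_simps)

lemma DERIV_phase_left:
  assumes "0 < x" "x < 1"
  shows "((\<lambda>x. phase p q l x v) has_real_derivative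
    p * ln (x\<^sup>2 + v\<^sup>2) / 2 - q * ln ((1 - x)\<^sup>2 + v\<^sup>2) / 2 - l) (at x)"
proof -
  have "((\<lambda>x. re_zlnz (1 - x) v) has_real_derivative (ln ((1 - x)\<^sup>2 + v\<^sup>2) / 2 + 1) * (- 1)) (at x)"
    using assms by (intro DERIV_chain2[OF DERIV_re_zlnz_left]) (auto intro!: derivative_eq_intros)
  then show ?thesis unfolding phase_def
    using DERIV_re_zlnz_left[OF assms(1), of v]
    by (auto intro!: derivative_eq_intros simp: field_simps)
qed

text \<open>The function is \<open>phase\<close> with v in place of |v|: differentiable at every v,
  and equal to the phase for v >= 0.\<close>

lemma DERIV_phase_right:
  assumes "0 < x" "x < 1"
  shows "((\<lambda>v. p * (re_zlnz x v - x) + q * (re_zlnz (1 - x) v - (1 - x)) + pi * v - x * l) has_real_derivative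
    pi - p * arctan (v / x) - q * arctan (v / (1 - x))) (at v)"
  using DERIV_re_zlnz_right[OF assms(1), of v] DERIV_re_zlnz_right[of "1 - x" v] assms
  by (auto intro!: derivative_eq_intros)

text \<open>The point $a + ib$ is the critical point of the phase in the upper half-plane: \<open>arg_eq\<close> and \<open>mod_eq\<close>
  say that the derivatives in the vertical and in the horizontal direction vanish there.\<close>

locale saddle =
  fixes p q l a b :: real
  assumes p2: "p \<ge> 2" and q2: "q \<ge> 2" and a0: "0 < a" and a1: "a < 1" and b0: "b > 0"
    and arg_eq: "p * arctan (b / a) + q * arctan (b / (1 - a)) = pi"
    and mod_eq: "l = p * ln (a\<^sup>2 + b\<^sup>2) / 2 - q * ln ((1 - a)\<^sup>2 + b\<^sup>2) / 2"
begin

lemma reflect: "saddle q p (- l) (1 - a) b"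
  using p2 q2 a0 a1 b0 arg_eq mod_eq by unfold_locales auto

text \<open>Minus the vertical derivative of the phase at height 2b. That derivative is strictly
  decreasing and vanishes at b, so beyond 2b the phase falls at least at this rate.\<close>

definition slope :: real where
  "slope = p * arctan (2 * b / a) + q * arctan (2 * b / (1 - a)) - pi"

lemma slope_pos: "slope > 0"
proof -
  have "arctan (2 * b / a) > arctan (b / a)" "arctan (2 * b / (1 - a)) > arctan (b / (1 - a))"
    using a0 a1 b0 by (auto simp: arctan_less_iff divide_strict_right_mono)
  then have "p * arctan (2 * b / a) > p * arctan (b / a)" "q * arctan (2 * b / (1 - a)) > q * arctan (b / (1 - a))"
    using p2 q2 by auto
  then show ?thesis using arg_eq by (simp add: slope_def)
qed

text \<open>For v >= 0 the phase is concave in v, because arctan increases, and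
  \<open>arg_eq\<close> puts the zero of the derivative at b; evenness in v does the rest.\<close>

lemma phase_vertical_max: "phase p q l a v \<le> phase p q l a b"
proof -
  let ?V = "\<lambda>v. p * (re_zlnz a v - a) + q * (re_zlnz (1 - a) v - (1 - a)) + pi * v - a * l"
  let ?D = "\<lambda>v. pi - p * arctan (v / a) - q * arctan (v / (1 - a))"
  have der: "(?V has_real_derivative ?D v) (at v)" for v
    by (rule DERIV_phase_right[OF a0 a1])
  have mono: "?D w \<le> ?D v" if "v \<le> w" for v w
  proof -
    have "arctan (v / a) \<le> arctan (w / a)" "arctan (v / (1 - a)) \<le> arctan (w / (1 - a))"
      using that a0 a1 by (auto simp: arctan_le_iff divide_right_mono)
    then show ?thesis using p2 q2 by (smt (verit) mult_left_mono)
  qed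
  have Db: "?D b = 0" using arg_eq by simp
  have "?V \<bar>v\<bar> \<le> ?V b"
  proof (cases "\<bar>v\<bar> \<le> b")
    case True
    show ?thesis using True
    proof (rule DERIV_nonneg_imp_nondecreasing)
      fix x assume "\<bar>v\<bar> \<le> x" "x \<le> b"
      then have "?D x \<ge> 0" using mono[of x b] Db by linarith
      then show "\<exists>y. (?V has_real_derivative y) (at x) \<and> 0 \<le> y" using der by blast
    qed
  next
    case False
    then have "b \<le> \<bar>v\<bar>" by simp
    then show ?thesis
    proof (rule DERIV_nonpos_imp_nonincreasing)
      fix x assume "b \<le> x" "x \<le> \<bar>v\<bar>"
      then have "?D x \<le> 0" using mono[of b x] Db by linarith
      then show "\<exists>y. (?V has_real_derivative y) (at x) \<and> y \<le> 0" using der by blast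
    qed
  qed
  then have "phase p q l a \<bar>v\<bar> \<le> phase p q l a b"
    using b0 by (simp add: phase_def)
  then show ?thesis by (simp only: phase_abs)
qed

text \<open>The linear decay makes the s-integral converge and absorbs the power weights. Up to
  height 2b the right-hand side is nonnegative, and from there on the derivative is at most
  -\<open>slope\<close>.\<close>

lemma phase_vertical_decay: "phase p q l a v - phase p q l a b \<le> slope * (2 * b - \<bar>v\<bar>)"
proof (cases "\<bar>v\<bar> \<le> 2 * b")
  case True
  then have "slope * (2 * b - \<bar>v\<bar>) \<ge> 0" using slope_pos by simp
  then show ?thesis using phase_vertical_max[of v] by linarith
next
  case False
  let ?V = "\<lambda>v. p * (re_zlnz a v - a) + q * (re_zlnz (1 - a) v - (1 - a)) + pi * v - a * l"
  let ?D = "\<lambda>v. pi - p * arctan (v / a) - q * arctan (v / (1 - a))"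
  have "2 * b \<le> \<bar>v\<bar>" using False by simp
  then have "?V \<bar>v\<bar> + slope * \<bar>v\<bar> \<le> ?V (2 * b) + slope * (2 * b)"
  proof (rule DERIV_nonpos_imp_nonincreasing)
    fix x assume x: "2 * b \<le> x" "x \<le> \<bar>v\<bar>"
    have der: "((\<lambda>x. ?V x + slope * x) has_real_derivative ?D x + slope) (at x)"
      using DERIV_add[OF DERIV_phase_right[OF a0 a1, of p q l x] DERIV_cmult_Id[of slope]] by simp
    have "arctan (2 * b / a) \<le> arctan (x / a)" "arctan (2 * b / (1 - a)) \<le> arctan (x / (1 - a))"
      using x a0 a1 by (auto simp: arctan_le_iff divide_right_mono)
    then have "p * arctan (2 * b / a) \<le> p * arctan (x / a)" "q * arctan (2 * b / (1 - a)) \<le> q * arctan (x / (1 - a))"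
      using p2 q2 by auto
    then have "?D x + slope \<le> 0" by (simp add: slope_def)
    then show "\<exists>y. ((\<lambda>x. ?V x + slope * x) has_real_derivative y) (at x) \<and> y \<le> 0" using der by blast
  qed
  moreover have "?V \<bar>v\<bar> = phase p q l a v" by (subst phase_abs[symmetric]) (simp add: phase_def)
  moreover have "?V (2 * b) = phase p q l a (2 * b)" using b0 by (simp add: phase_def)
  ultimately show ?thesis using phase_vertical_max[of "2 * b"] by (simp add: algebra_simps)
qed

text \<open>Along Im z = b the phase is strictly convex in x, and \<open>mod_eq\<close> puts the
  zero of its derivative at a. Together with concavity in the vertical direction this is the saddle
  shape.\<close>

lemma phase_horizontal_deriv_mono:
  assumes "0 < x" "x < y" "y < 1"
  shows "p * ln (x\<^sup>2 + b\<^sup>2) / 2 - q * ln ((1 - x)\<^sup>2 + b\<^sup>2) / 2 < p * ln (y\<^sup>2 + b\<^sup>2) / 2 - q * ln ((1 - y)\<^sup>2 + b\<^sup>2) / 2"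
proof -
  have pos: "x\<^sup>2 + b\<^sup>2 > 0" "(1 - y)\<^sup>2 + b\<^sup>2 > 0" using b0 by (auto intro!: add_nonneg_pos)
  have "x\<^sup>2 < y\<^sup>2" "(1 - y)\<^sup>2 < (1 - x)\<^sup>2" using assms by (auto intro!: power_strict_mono)
  then have "ln (x\<^sup>2 + b\<^sup>2) < ln (y\<^sup>2 + b\<^sup>2)" "ln ((1 - y)\<^sup>2 + b\<^sup>2) < ln ((1 - x)\<^sup>2 + b\<^sup>2)"
    using pos by (auto intro!: ln_less_cancel_iff[THEN iffD2])
  then have "p * ln (x\<^sup>2 + b\<^sup>2) < p * ln (y\<^sup>2 + b\<^sup>2)" "q * ln ((1 - y)\<^sup>2 + b\<^sup>2) < q * ln ((1 - x)\<^sup>2 + b\<^sup>2)"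
    using p2 q2 by auto
  then show ?thesis by linarith
qed

lemma phase_horizontal_left:
  assumes "0 < x" "x < y" "y \<le> a"
  shows "phase p q l x b > phase p q l y b"
proof (rule DERIV_neg_imp_decreasing_open[OF assms(2)])
  fix z assume z: "x < z" "z < y"
  have "p * ln (z\<^sup>2 + b\<^sup>2) / 2 - q * ln ((1 - z)\<^sup>2 + b\<^sup>2) / 2 - l < 0"
    using phase_horizontal_deriv_mono[of z a] z assms a1 mod_eq by simp
  moreover have "0 < z" "z < 1" using z assms a1 by auto
  ultimately show "\<exists>d. ((\<lambda>x. phase p q l x b) has_real_derivative d) (at z) \<and> d < 0"
    using DERIV_phase_left by blast
next
  show "continuous_on {x..y} (\<lambda>x. phase p q l x b)"
    using assms a1 by (intro continuous_at_imp_continuous_on ballI DERIV_isCont[OF DERIV_phase_left]) auto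
qed

text \<open>Since p >= 2, the vertical derivative is at most pi - 2 arctan(v/x), so going up from v
  to b raises the phase by no more than the integral of this nonnegative function over [0, b], which
  vanishes as x -> 0. So the phase on the side is nearly at least its value at the corner, which
  exceeds the one at a/2 by convexity. Half of the gap between a/2 and a pays for the integral, the
  other half is \<delta>.\<close>

lemma phase_side:
  obtains \<delta> e where "\<delta> > 0" "e > 0"
    "\<And>x v. 0 < x \<Longrightarrow> x < e \<Longrightarrow> \<bar>v\<bar> \<le> b \<Longrightarrow> phase p q l x v \<ge> phase p q l a b + \<delta>"
proof -
  define \<delta> where "\<delta> = (phase p q l (a/2) b - phase p q l a b) / 2"
  have \<delta>: "\<delta> > 0" using phase_horizontal_left[of "a/2" a] a0 by (simp add: \<delta>_def)
  \<comment> \<open>The integral of pi - 2 arctan(v/x) over v in [0, b].\<close>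
  let ?r = "\<lambda>x. pi * b + x * ln (x\<^sup>2 + b\<^sup>2) - 2 * b * arctan (b / x) - x * ln (x\<^sup>2)"
  have "(?r \<longlongrightarrow> 0) (at_right 0)"
    using b0 by real_asymp
  then have "\<forall>\<^sub>F x in at_right 0. ?r x < \<delta>" using \<delta> by (rule order_tendstoD)
  then obtain e0 where e0: "e0 > 0" "\<And>x. 0 < x \<Longrightarrow> x < e0 \<Longrightarrow> ?r x < \<delta>"
    unfolding eventually_at_right_field by auto
  define e where "e = min e0 (a/2)"
  have "phase p q l x v \<ge> phase p q l a b + \<delta>" if x: "0 < x" "x < e" and v: "\<bar>v\<bar> \<le> b" for x v
  proof -
    have x1: "x < 1" "x < a/2" "?r x < \<delta>" using x a1 e0 by (auto simp: e_def)
    let ?q = "\<lambda>v. pi * v + 2 * re_zlnz x v"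
    let ?V = "\<lambda>v. p * (re_zlnz x v - x) + q * (re_zlnz (1 - x) v - (1 - x)) + pi * v - x * l"
    have dq: "(?q has_real_derivative pi - 2 * arctan (v / x)) (at v)" for v
      using DERIV_re_zlnz_right[OF x(1), of v] by (auto intro!: derivative_eq_intros)
    have "?q 0 \<le> ?q \<bar>v\<bar>"
    proof (rule DERIV_nonneg_imp_nondecreasing[where f = ?q])
      fix u assume "0 \<le> u" "u \<le> \<bar>v\<bar>"
      have "pi - 2 * arctan (u / x) \<ge> 0" using arctan_ubound[of "u / x"] by simp
      then show "\<exists>y. (?q has_real_derivative y) (at u) \<and> 0 \<le> y" using dq by blast
    qed simp
    moreover have "?q \<bar>v\<bar> - ?V \<bar>v\<bar> \<le> ?q b - ?V b"
      using v
    proof (rule DERIV_nonneg_imp_nondecreasing[where f = "\<lambda>v. ?q v - ?V v"])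
      fix u assume u: "\<bar>v\<bar> \<le> u" "u \<le> b"
      have "arctan (u / x) \<ge> 0" "arctan (u / (1 - x)) \<ge> 0"
        using u x x1 by (auto simp: zero_le_arctan_iff)
      then have "2 * arctan (u / x) \<le> p * arctan (u / x)" "0 \<le> q * arctan (u / (1 - x))"
        using p2 q2 by (auto intro!: mult_right_mono mult_nonneg_nonneg)
      then have "(pi - 2 * arctan (u / x)) - (pi - p * arctan (u / x) - q * arctan (u / (1 - x))) \<ge> 0" by simp
      then show "\<exists>y. ((\<lambda>v. ?q v - ?V v) has_real_derivative y) (at u) \<and> 0 \<le> y"
        using DERIV_diff[OF dq DERIV_phase_right[OF x(1) x1(1), of p q l u]] by blast
    qed
    moreover have "?q b - ?q 0 = ?r x" using x by (simp add: re_zlnz_def algebra_simps)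
    moreover have "?V \<bar>v\<bar> = phase p q l x v" by (subst phase_abs[symmetric]) (simp add: phase_def)
    moreover have "?V b = phase p q l x b" using b0 by (simp add: phase_def)
    moreover have "phase p q l x b > phase p q l (a/2) b" using x x1 a0 by (intro phase_horizontal_left) auto
    moreover have "phase p q l (a/2) b = phase p q l a b + 2 * \<delta>" by (simp add: \<delta>_def field_simps)
    ultimately show ?thesis using x1(3) by linarith
  qed
  moreover have "e > 0" using e0 a0 by (simp add: e_def)
  ultimately show ?thesis using that \<delta> by blast
qed

lemma phase_horizontal_min:
  assumes "0 < x" "x < 1"
  shows "phase p q l a b \<le> phase p q l x b" and "x \<noteq> a \<Longrightarrow> phase p q l a b < phase p q l x b"
proof -
  have *: "phase p q l a b < phase p q l x b" if "x \<noteq> a"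
  proof (cases "x < a")
    case True
    then show ?thesis using phase_horizontal_left[of x a] assms by simp
  next
    case False
    then have "phase q p (- l) (1 - a) b < phase q p (- l) (1 - x) b"
      using saddle.phase_horizontal_left[OF reflect, of "1 - x" "1 - a"] assms that by simp
    then show ?thesis using phase_swap[of p q l "1 - x" b] phase_swap[of p q l "1 - a" b] by simp
  qed
  then show "x \<noteq> a \<Longrightarrow> phase p q l a b < phase p q l x b" by simp
  show "phase p q l a b \<le> phase p q l x b" using * by (cases "x = a") auto
qed

lemma phase_sides:
  obtains \<delta> e where "\<delta> > 0" "e > 0"
    "\<And>x v. 0 < x \<Longrightarrow> x < e \<Longrightarrow> \<bar>v\<bar> \<le> b \<Longrightarrow> phase p q l x v \<ge> phase p q l a b + \<delta>"
    "\<And>x v. 0 < x \<Longrightarrow> x < e \<Longrightarrow> \<bar>v\<bar> \<le> b \<Longrightarrow> phase p q l (1 - x) v \<ge> phase p q l a b + \<delta>"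
proof -
  obtain d1 e1 where 1: "d1 > 0" "e1 > 0"
    "\<And>x v. 0 < x \<Longrightarrow> x < e1 \<Longrightarrow> \<bar>v\<bar> \<le> b \<Longrightarrow> phase p q l x v \<ge> phase p q l a b + d1"
    using phase_side by blast
  obtain d2 e2 where 2: "d2 > 0" "e2 > 0"
    "\<And>x v. 0 < x \<Longrightarrow> x < e2 \<Longrightarrow> \<bar>v\<bar> \<le> b \<Longrightarrow> phase q p (-l) x v \<ge> phase q p (-l) (1 - a) b + d2"
    using saddle.phase_side[OF reflect] by blast
  have 3: "phase p q l (1 - x) v \<ge> phase p q l a b + d2" if "0 < x" "x < e2" "\<bar>v\<bar> \<le> b" for x v
    using 2(3)[OF that] phase_swap[of p q l x v] phase_swap[of p q l "1 - a" b] by simp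
  show ?thesis
    by (rule that[of "min d1 d2" "min e1 e2"]) (use 1 2(1,2) 3 in \<open>force+\<close>)
qed

end

section \<open>The size of the Gamma products\<close>

definition comparable :: "'a set \<Rightarrow> ('a \<Rightarrow> real) \<Rightarrow> ('a \<Rightarrow> real) \<Rightarrow> bool" where
  "comparable S f g \<longleftrightarrow> (\<exists>c>0. \<exists>C>0. \<forall>x\<in>S. 0 \<le> g x \<and> c * g x \<le> f x \<and> f x \<le> C * g x)"

lemma comparableI:
  assumes "c > 0" "C > 0" "\<And>x. x \<in> S \<Longrightarrow> 0 \<le> g x" "\<And>x. x \<in> S \<Longrightarrow> c * g x \<le> f x" "\<And>x. x \<in> S \<Longrightarrow> f x \<le> C * g x"
  shows "comparable S f g"
  unfolding comparable_def using assms by blast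

lemma comparable_refl: "(\<And>x. x \<in> S \<Longrightarrow> 0 \<le> f x) \<Longrightarrow> comparable S f f"
  by (rule comparableI[of 1 1]) auto

lemma comparable_cong:
  "comparable S f g \<Longrightarrow> (\<And>x. x \<in> S \<Longrightarrow> f x = f' x) \<Longrightarrow> (\<And>x. x \<in> S \<Longrightarrow> g x = g' x) \<Longrightarrow> comparable S f' g'"
  unfolding comparable_def by (metis (no_types, lifting))

lemma comparable_trans:
  assumes "comparable S f g" "comparable S g h"
  shows "comparable S f h"
proof -
  obtain c C where 1: "c > 0" "C > 0" "\<And>x. x \<in> S \<Longrightarrow> 0 \<le> g x \<and> c * g x \<le> f x \<and> f x \<le> C * g x"
    using assms(1) unfolding comparable_def by blast
  obtain c' C' where 2: "c' > 0" "C' > 0" "\<And>x. x \<in> S \<Longrightarrow> 0 \<le> h x \<and> c' * h x \<le> g x \<and> g x \<le> C' * h x"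
    using assms(2) unfolding comparable_def by blast
  show ?thesis
  proof (rule comparableI[of "c * c'" "C * C'"])
    fix x assume x: "x \<in> S"
    note 3 = 1(3)[OF x] 2(3)[OF x]
    show "0 \<le> h x" using 3 by auto
    have "c * (c' * h x) \<le> c * g x" using 3 1 by (intro mult_left_mono) auto
    then show "c * c' * h x \<le> f x" using 3 by (simp add: mult_ac)
    have "C * g x \<le> C * (C' * h x)" using 3 1 by (intro mult_left_mono) auto
    then show "f x \<le> C * C' * h x" using 3 by (simp add: mult_ac)
  qed (use 1 2 in auto)
qed

lemma comparable_mult:
  assumes "comparable S f g" "comparable S f' g'"
  shows "comparable S (\<lambda>x. f x * f' x) (\<lambda>x. g x * g' x)"
proof -
  obtain c C where 1: "c > 0" "C > 0" "\<And>x. x \<in> S \<Longrightarrow> 0 \<le> g x \<and> c * g x \<le> f x \<and> f x \<le> C * g x"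
    using assms(1) unfolding comparable_def by blast
  obtain c' C' where 2: "c' > 0" "C' > 0" "\<And>x. x \<in> S \<Longrightarrow> 0 \<le> g' x \<and> c' * g' x \<le> f' x \<and> f' x \<le> C' * g' x"
    using assms(2) unfolding comparable_def by blast
  show ?thesis
  proof (rule comparableI[of "c * c'" "C * C'"])
    fix x assume x: "x \<in> S"
    note 3 = 1(3)[OF x] 2(3)[OF x]
    have nn: "0 \<le> c * g x" "0 \<le> c' * g' x" using 1 2 3 by auto
    have ff: "0 \<le> f x" "0 \<le> f' x" using nn 3 by linarith+
    show "0 \<le> g x * g' x" using 3 by auto
    have "(c * g x) * (c' * g' x) \<le> f x * f' x" using 3 nn ff by (intro mult_mono) auto
    then show "c * c' * (g x * g' x) \<le> f x * f' x" by (simp add: mult_ac)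
    have "f x * f' x \<le> (C * g x) * (C' * g' x)" using 3 nn ff 1 2 by (intro mult_mono) auto
    then show "f x * f' x \<le> C * C' * (g x * g' x)" by (simp add: mult_ac)
  qed (use 1 2 in auto)
qed

lemma comparable_prod:
  assumes "finite I" "\<And>i. i \<in> I \<Longrightarrow> comparable S (f i) (g i)"
  shows "comparable S (\<lambda>x. \<Prod>i\<in>I. f i x) (\<lambda>x. \<Prod>i\<in>I. g i x)"
  using assms by (induction rule: finite_induct) (auto intro!: comparable_refl comparable_mult)

lemma comparable_inverse:
  assumes "comparable S f g" "\<And>x. x \<in> S \<Longrightarrow> g x > 0"
  shows "comparable S (\<lambda>x. inverse (f x)) (\<lambda>x. inverse (g x))"
proof -
  obtain c C where 1: "c > 0" "C > 0" "\<And>x. x \<in> S \<Longrightarrow> 0 \<le> g x \<and> c * g x \<le> f x \<and> f x \<le> C * g x"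
    using assms(1) unfolding comparable_def by blast
  show ?thesis
  proof (rule comparableI[of "inverse C" "inverse c"])
    fix x assume x: "x \<in> S"
    note 3 = 1(3)[OF x] assms(2)[OF x]
    have p: "c * g x > 0" using 1 3 by auto
    show "inverse C * inverse (g x) \<le> inverse (f x)"
      using 3 p le_imp_inverse_le[of "f x" "C * g x"] by (simp add: inverse_mult_distrib)
    show "inverse (f x) \<le> inverse c * inverse (g x)"
      using 3 p le_imp_inverse_le[of "c * g x" "f x"] by (simp add: inverse_mult_distrib)
    show "0 \<le> inverse (g x)" using 3 by auto
  qed (use 1 in auto)
qed

lemma comparable_compose:
  assumes "comparable T f g" "\<And>x. x \<in> S \<Longrightarrow> h x \<in> T"
  shows "comparable S (\<lambda>x. f (h x)) (\<lambda>x. g (h x))"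
  using assms unfolding comparable_def by (metis (no_types, lifting))

section \<open>Gamma functions and node polynomial up to constant factors\<close>

lemma norm_add_nat_comparable:
  "comparable {z. Re z \<ge> 1/2} (\<lambda>z. norm (z + of_nat i)) (\<lambda>z. norm (z + 2))"
proof (rule comparableI[of "1/5" "3 + real i"])
  fix z :: complex assume "z \<in> {z. Re z \<ge> 1/2}"
  then have z: "Re z \<ge> 1/2" by simp
  have 1: "norm (z + 2) \<ge> 1" using z complex_Re_le_cmod[of "z + 2"] by simp
  have 2: "norm (z + of_nat i) \<ge> 1/2" using z complex_Re_le_cmod[of "z + of_nat i"] by simp
  have "norm (z + of_nat i) \<le> norm (z + 2) + norm (of_nat i - 2 :: complex)"
    using norm_triangle_ineq[of "z + 2" "of_nat i - 2"] by simp
  also have "norm (of_nat i - 2 :: complex) \<le> real i + 2"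
    using norm_triangle_ineq4[of "of_nat i :: complex" 2] by simp
  also have "real i + 2 \<le> (real i + 2) * norm (z + 2)" using 1 by (simp add: mult_le_cancel_left1)
  finally show "norm (z + of_nat i) \<le> (3 + real i) * norm (z + 2)" by (simp add: algebra_simps)
  have "norm (z + 2) \<le> norm (z + of_nat i) + 2"
  proof -
    have "norm (z + 2) \<le> norm (z + of_nat i + 2)"
      using z by (simp add: cmod_def power2_eq_square) (intro mult_mono, auto)
    also have "\<dots> \<le> norm (z + of_nat i) + 2" using norm_triangle_ineq[of "z + of_nat i" 2] by simp
    finally show ?thesis .
  qed
  then show "1/5 * norm (z + 2) \<le> norm (z + of_nat i)" using 2 by simp
qed auto

lemma pochhammer_comparable:
  "comparable {z. Re z \<ge> 1/2} (\<lambda>z. norm (pochhammer z k)) (\<lambda>z. norm (z + 2) ^ k)"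
proof -
  have "comparable {z. Re z \<ge> 1/2} (\<lambda>z. \<Prod>i\<in>{0..<k}. norm (z + of_nat i)) (\<lambda>z. \<Prod>i\<in>{0..<k}. norm (z + 2))"
    by (intro comparable_prod norm_add_nat_comparable) auto
  then show ?thesis by (simp add: pochhammer_prod prod_norm)
qed

text \<open>Gamma(z+k) is Gamma(z+2) times the quotient of the Pochhammer symbols of order k and 2,
  and Re (z+2) >= 2 is the range of the Stirling bounds. The parameter k therefore affects only the
  power of |z+2|, where -5/2 is -2 from the division and -1/2 from Stirling.\<close>

lemma Gamma_comparable:
  "comparable {z. Re z \<ge> 1/2} (\<lambda>z. norm (Gamma (z + of_nat k)))
     (\<lambda>z. norm (z + 2) powr (real k - 5/2) * exp (re_zlnz (Re z + 2) (Im z) - (Re z + 2)))"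
proof -
  let ?S = "{z :: complex. Re z \<ge> 1/2}"
  obtain c C where "0 < c" "0 < C" "\<And>z. Re z \<ge> 2 \<Longrightarrow> c \<le> stirling_quot z \<and> stirling_quot z \<le> C"
    using stirling_quot_bounded by blast
  then have 1: "comparable ?S (\<lambda>z. stirling_quot (z + 2)) (\<lambda>_. 1)"
    by (intro comparableI[of c C]) auto
  have pos: "norm (z + 2) > 0" if "z \<in> ?S" for z
    using that complex_Re_le_cmod[of "z + 2"] by auto
  have 2: "comparable ?S (\<lambda>z. inverse (norm (pochhammer z 2))) (\<lambda>z. inverse (norm (z + 2) ^ 2))"
    using pos by (intro comparable_inverse pochhammer_comparable) auto
  have 3: "comparable ?S (\<lambda>z. norm (pochhammer z k) * inverse (norm (pochhammer z 2)) * stirling_quot (z + 2)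
        * exp (Re (lstirling (z + 2))))
     (\<lambda>z. norm (z + 2) ^ k * inverse (norm (z + 2) ^ 2) * 1 * exp (Re (lstirling (z + 2))))"
    by (intro comparable_mult 1 2 pochhammer_comparable comparable_refl) auto
  show ?thesis
  proof (rule comparable_cong[OF 3])
    fix z assume z: "z \<in> ?S"
    then have nz: "z \<notin> \<int>\<^sub>\<le>\<^sub>0" using Re_pos_not_nonpos_Ints[of z] by simp
    then have G: "Gamma z \<noteq> 0" by (simp add: Gamma_eq_zero_iff)
    have "pochhammer z 2 \<noteq> 0" using nz by (auto simp: pochhammer_eq_0_iff)
    moreover have "norm (Gamma (z + of_nat k)) = norm (pochhammer z k) * norm (Gamma z)" for k
      using pochhammer_Gamma[OF nz, of k] G by (simp add: norm_divide)
    from this[of k] this[of 2] have "norm (Gamma (z + of_nat k)) = norm (pochhammer z k) * norm (Gamma z)"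
      "norm (Gamma (z + 2)) = norm (pochhammer z 2) * norm (Gamma z)" by simp_all
    ultimately show "norm (pochhammer z k) * inverse (norm (pochhammer z 2)) * stirling_quot (z + 2) * exp (Re (lstirling (z + 2)))
      = norm (Gamma (z + of_nat k))"
      by (simp add: stirling_quot_def)
    have n: "norm (z + 2) > 0" using pos[OF z] .
    have "exp (Re (lstirling (z + 2))) = exp (re_zlnz (Re z + 2) (Im z) - (Re z + 2)) * norm (z + 2) powr (- (1/2))"
      using n z by (subst Re_lstirling) (auto simp: powr_def algebra_simps simp flip: exp_add)
    moreover have "norm (z + 2) ^ k * inverse (norm (z + 2) ^ 2) * norm (z + 2) powr (- (1/2)) = norm (z + 2) powr (real k - 5/2)"
    proof -
      have "real k - 5/2 = real k + (- real 2) + (- (1/2))" by simp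
      then show ?thesis using n by (simp only: powr_add powr_minus powr_realpow)
    qed
    ultimately show "norm (z + 2) ^ k * inverse (norm (z + 2) ^ 2) * 1 * exp (Re (lstirling (z + 2)))
      = norm (z + 2) powr (real k - 5/2) * exp (re_zlnz (Re z + 2) (Im z) - (Re z + 2))"
      by (simp add: mult_ac)
  qed
qed

text \<open>Since $\nu_0 = 0$, the factor $j = 0$ of the integrand combines with $\Gamma(t-n+1)$ to the node
  polynomial $t(t-1)\cdots(t-n+1)$, which carries all poles inside the contour.\<close>

definition gamprod :: "nat \<Rightarrow> nat \<Rightarrow> (nat \<Rightarrow> nat) \<Rightarrow> (nat \<Rightarrow> nat) \<Rightarrow> nat \<Rightarrow> complex \<Rightarrow> complex" where
  "gamprod M K \<nu> \<nu>' n t = (\<Prod>j=1..M. Gamma (t + of_nat (\<nu> j) + 1)) * (\<Prod>k=1..K. Gamma (of_nat n - t + of_nat (\<nu>' k)))"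

definition nodepoly :: "nat \<Rightarrow> complex \<Rightarrow> complex" where
  "nodepoly n t = (\<Prod>i<n. t - of_nat i)"

text \<open>The reflection formula trades the product over the nodes for two Gamma functions with
  arguments in the right half-plane and a sine, which then carries all the zeros.\<close>

lemma nodepoly_eq_Gamma:
  assumes "-1 < Re t" "Re t < real n"
  shows "norm (nodepoly n t) = norm (Gamma (t + 1)) * norm (Gamma (of_nat n - t)) * norm (sin (of_real pi * t)) / pi"
proof -
  have p: "norm (nodepoly n t) = norm (pochhammer (- t) n)"
    unfolding nodepoly_def pochhammer_prod prod_norm[symmetric]
    by (intro prod.cong) (auto simp: norm_minus_commute atLeast0LessThan)
  have n1: "t + 1 \<notin> \<int>\<^sub>\<le>\<^sub>0" "of_nat n - t \<notin> \<int>\<^sub>\<le>\<^sub>0"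
    using assms by (auto intro!: Re_pos_not_nonpos_Ints)
  have "rGamma (- t) = pochhammer (- t) n * rGamma (- t + of_nat n)" by (rule pochhammer_rGamma)
  moreover have "rGamma (- t) * rGamma (1 - (- t)) = sin (of_real pi * (- t)) / of_real pi"
    by (rule rGamma_reflection_complex)
  ultimately have "pochhammer (- t) n * rGamma (of_nat n - t) * rGamma (t + 1) = - sin (of_real pi * t) / of_real pi"
    by (simp add: add_ac)
  then have e: "norm (pochhammer (- t) n) * norm (rGamma (of_nat n - t)) * norm (rGamma (t + 1)) = norm (sin (of_real pi * t)) / pi"
    by (metis norm_divide norm_minus_cancel norm_mult norm_of_real abs_of_pos pi_gt_zero)
  have r: "norm (rGamma z) * norm (Gamma z) = 1" if "z \<notin> \<int>\<^sub>\<le>\<^sub>0" for z :: complex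
    using that by (simp add: rGamma_inverse_Gamma norm_inverse Gamma_eq_zero_iff)
  have "norm (pochhammer (- t) n) = norm (pochhammer (- t) n) * (norm (rGamma (of_nat n - t)) * norm (Gamma (of_nat n - t)))
      * (norm (rGamma (t + 1)) * norm (Gamma (t + 1)))" using n1 by (simp add: r)
  also have "\<dots> = (norm (pochhammer (- t) n) * norm (rGamma (of_nat n - t)) * norm (rGamma (t + 1))) *
      (norm (Gamma (of_nat n - t)) * norm (Gamma (t + 1)))" by (simp only: mult_ac)
  finally show ?thesis unfolding e p by (simp add: mult_ac)
qed

text \<open>The bounds on Re t are the vertical sides of the rectangle; inside, t + 1 and n - t both
  have real part at least 1/2, as the Gamma bounds require. Pairing t with n makes the constants
  uniform in n.\<close>

definition strip :: "(nat \<times> complex) set" where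
  "strip = {(n, t). n \<ge> 1 \<and> - 1/2 \<le> Re t \<and> Re t \<le> real n - 1/2}"

text \<open>The node polynomial contributes one more Gamma function in t and one more in n - t,
  hence the multiplicities M + 1 and K + 1; the shift by 2 in the Stirling bounds turns t + 1 into t
  + 3 and n - t into n - t + 2.\<close>

lemma amp_comparable_unscaled:
  fixes M K :: nat and \<nu> \<nu>' :: "nat \<Rightarrow> nat"
  defines "\<alpha> \<equiv> real (\<Sum>j=1..M. \<nu> j) - 5/2 * (real M + 1)" and "\<beta> \<equiv> real (\<Sum>k=1..K. \<nu>' k) - 5/2 * (real K + 1)"
  shows "comparable strip (\<lambda>(n, t). norm (gamprod M K \<nu> \<nu>' n t * nodepoly n t))
    (\<lambda>(n, t). norm (t + 3) powr \<alpha> * norm (of_nat n - t + 2) powr \<beta>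
      * exp ((real M + 1) * (re_zlnz (Re t + 3) (Im t) - (Re t + 3)) + (real K + 1) * (re_zlnz (real n - Re t + 2) (Im t) - (real n - Re t + 2)))
      * norm (sin (of_real pi * t)))"
proof -
  let ?E1 = "\<lambda>t. re_zlnz (Re t + 3) (Im t) - (Re t + 3)"
  let ?E2 = "\<lambda>n t. re_zlnz (real n - Re t + 2) (Im t) - (real n - Re t + 2)"
  have 1: "comparable strip (\<lambda>x. norm (Gamma (snd x + 1 + of_nat k))) (\<lambda>x. norm (snd x + 3) powr (real k - 5/2) * exp (?E1 (snd x)))" for k
    using comparable_compose[OF Gamma_comparable[of k], of strip "\<lambda>x. snd x + 1"]
    by (simp add: strip_def case_prod_unfold add_ac)
  have 2: "comparable strip (\<lambda>x. norm (Gamma (of_nat (fst x) - snd x + of_nat k)))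
     (\<lambda>x. norm (of_nat (fst x) - snd x + 2) powr (real k - 5/2) * exp (?E2 (fst x) (snd x)))" for k
    using comparable_compose[OF Gamma_comparable[of k], of strip "\<lambda>x. of_nat (fst x) - snd x"]
    by (simp add: strip_def case_prod_unfold)
  have "comparable strip (\<lambda>x. (\<Prod>j=1..M. norm (Gamma (snd x + 1 + of_nat (\<nu> j)))) * (\<Prod>k=1..K. norm (Gamma (of_nat (fst x) - snd x + of_nat (\<nu>' k))))
      * norm (Gamma (snd x + 1 + of_nat 0)) * norm (Gamma (of_nat (fst x) - snd x + of_nat 0)) * (norm (sin (of_real pi * snd x)) / pi))
    (\<lambda>x. (\<Prod>j=1..M. norm (snd x + 3) powr (real (\<nu> j) - 5/2) * exp (?E1 (snd x)))
      * (\<Prod>k=1..K. norm (of_nat (fst x) - snd x + 2) powr (real (\<nu>' k) - 5/2) * exp (?E2 (fst x) (snd x)))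
      * (norm (snd x + 3) powr (real 0 - 5/2) * exp (?E1 (snd x))) * (norm (of_nat (fst x) - snd x + 2) powr (real 0 - 5/2) * exp (?E2 (fst x) (snd x)))
      * norm (sin (of_real pi * snd x)))"
    by (intro comparable_mult comparable_prod 1 2 comparableI[of "1/pi" "1/pi"]) (auto)
  then show ?thesis
  proof (rule comparable_cong)
    fix x :: "nat \<times> complex" assume x: "x \<in> strip"
    obtain n t where nt: "x = (n, t)" by fastforce
    have t: "-1 < Re t" "Re t < real n" using x by (auto simp: strip_def nt)
    have "norm (gamprod M K \<nu> \<nu>' n t * nodepoly n t) =
      (\<Prod>j=1..M. norm (Gamma (t + 1 + of_nat (\<nu> j)))) * (\<Prod>k=1..K. norm (Gamma (of_nat n - t + of_nat (\<nu>' k))))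
      * norm (Gamma (t + 1 + of_nat 0)) * norm (Gamma (of_nat n - t + of_nat 0)) * (norm (sin (of_real pi * t)) / pi)"
      unfolding gamprod_def norm_mult nodepoly_eq_Gamma[OF t] prod_norm[symmetric] by (simp add: add_ac)
    then show "(\<Prod>j=1..M. norm (Gamma (snd x + 1 + of_nat (\<nu> j)))) * (\<Prod>k=1..K. norm (Gamma (of_nat (fst x) - snd x + of_nat (\<nu>' k))))
      * norm (Gamma (snd x + 1 + of_nat 0)) * norm (Gamma (of_nat (fst x) - snd x + of_nat 0)) * (norm (sin (of_real pi * snd x)) / pi) =
      (case x of (n, t) \<Rightarrow> norm (gamprod M K \<nu> \<nu>' n t * nodepoly n t))" by (simp add: nt)
    define P Q e1 e2 where "P = norm (t + 3)" and "Q = norm (of_nat n - t + 2)" and "e1 = ?E1 t" and "e2 = ?E2 n t"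
    have "Re (t + 3) > 0" "Re (of_nat n - t + 2) > 0" using t by auto
    then have "t + 3 \<noteq> 0" "of_nat n - t + 2 \<noteq> 0" by (metis less_irrefl zero_complex.simps(1))+
    then have PQ: "P > 0" "Q > 0" by (auto simp: P_def Q_def)
    have prodP: "(\<Prod>j=1..m. R powr (real (\<mu> j) - 5/2) * exp e) * (R powr (real 0 - 5/2) * exp e)
      = R powr (real (\<Sum>j=1..m. \<mu> j) - 5/2 * (real m + 1)) * exp ((real m + 1) * e)" if "R > 0" for R e m and \<mu> :: "nat \<Rightarrow> nat"
    proof (induction m)
      case 0
      then show ?case by simp
    next
      case (Suc m)
      have "(\<Prod>j=1..Suc m. R powr (real (\<mu> j) - 5/2) * exp e) * (R powr (real 0 - 5/2) * exp e)
        = ((\<Prod>j=1..m. R powr (real (\<mu> j) - 5/2) * exp e) * (R powr (real 0 - 5/2) * exp e)) * (R powr (real (\<mu> (Suc m)) - 5/2) * exp e)"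
        by (simp add: mult_ac)
      also have "\<dots> = (R powr (real (\<Sum>j=1..m. \<mu> j) - 5/2 * (real m + 1)) * R powr (real (\<mu> (Suc m)) - 5/2)) * (exp ((real m + 1) * e) * exp e)"
        unfolding Suc.IH by (simp only: mult_ac)
      also have "\<dots> = R powr (real (\<Sum>j=1..Suc m. \<mu> j) - 5/2 * (real (Suc m) + 1)) * exp ((real (Suc m) + 1) * e)"
      proof -
        have "real (\<Sum>j=1..m. \<mu> j) - 5/2 * (real m + 1) + (real (\<mu> (Suc m)) - 5/2) = real (\<Sum>j=1..Suc m. \<mu> j) - 5/2 * (real (Suc m) + 1)"
          by (simp add: field_simps)
        moreover have "(real m + 1) * e + e = (real (Suc m) + 1) * e" by (simp add: algebra_simps)
        ultimately show ?thesis by (metis exp_add powr_add)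
      qed
      finally show ?case .
    qed
    have "(\<Prod>j=1..M. P powr (real (\<nu> j) - 5/2) * exp e1) * (\<Prod>k=1..K. Q powr (real (\<nu>' k) - 5/2) * exp e2)
      * (P powr (real 0 - 5/2) * exp e1) * (Q powr (real 0 - 5/2) * exp e2) =
      ((\<Prod>j=1..M. P powr (real (\<nu> j) - 5/2) * exp e1) * (P powr (real 0 - 5/2) * exp e1)) *
      ((\<Prod>k=1..K. Q powr (real (\<nu>' k) - 5/2) * exp e2) * (Q powr (real 0 - 5/2) * exp e2))"
      by (simp only: mult_ac)
    also have "\<dots> = P powr \<alpha> * Q powr \<beta> * exp ((real M + 1) * e1 + (real K + 1) * e2)"
      unfolding prodP[OF PQ(1)] prodP[OF PQ(2)] \<alpha>_def \<beta>_def by (simp add: exp_add mult_ac)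
    finally show "(\<Prod>j=1..M. norm (snd x + 3) powr (real (\<nu> j) - 5/2) * exp (?E1 (snd x)))
      * (\<Prod>k=1..K. norm (of_nat (fst x) - snd x + 2) powr (real (\<nu>' k) - 5/2) * exp (?E2 (fst x) (snd x)))
      * (norm (snd x + 3) powr (real 0 - 5/2) * exp (?E1 (snd x))) * (norm (of_nat (fst x) - snd x + 2) powr (real 0 - 5/2) * exp (?E2 (fst x) (snd x)))
      * norm (sin (of_real pi * snd x)) =
      (case x of (n, t) \<Rightarrow> norm (t + 3) powr \<alpha> * norm (of_nat n - t + 2) powr \<beta>
      * exp ((real M + 1) * ?E1 t + (real K + 1) * ?E2 n t) * norm (sin (of_real pi * t)))"
      unfolding nt by (simp only: fst_conv snd_conv case_prod_conv P_def Q_def e1_def e2_def)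
  qed
qed

text \<open>Exact rescaling produces powers of n + 5, whereas the kernel's arguments carry powers of
  n. As |Re t| <= n and ln(n+5) - ln n <= 5/n, the exponents differ by at most 5|r|.\<close>

lemma powr_shift_comparable:
  "comparable strip (\<lambda>(n, t). exp (r * Re t * ln (real n + 5))) (\<lambda>(n, t). exp (r * Re t * ln (real n)))"
proof (rule comparableI[of "exp (- (5 * \<bar>r\<bar>))" "exp (5 * \<bar>r\<bar>)"])
  fix x :: "nat \<times> complex" assume x: "x \<in> strip"
  obtain n t where nt: "x = (n, t)" by fastforce
  have n: "real n \<ge> 1" and t: "\<bar>Re t\<bar> \<le> real n" using x by (auto simp: strip_def nt)
  have "ln (real n + 5) - ln (real n) = ln (1 + 5 / real n)"
  proof -
    have "1 + 5 / real n = (real n + 5) / real n" using n by (simp add: field_simps)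
    then show ?thesis using n by (simp add: ln_div)
  qed
  also have "\<dots> \<le> 5 / real n" using n by (intro ln_add_one_self_le_self) auto
  finally have d: "ln (real n + 5) - ln (real n) \<le> 5 / real n" .
  have d0: "ln (real n + 5) - ln (real n) \<ge> 0" using n by simp
  have "\<bar>r * Re t * ln (real n + 5) - r * Re t * ln (real n)\<bar> = \<bar>r\<bar> * (\<bar>Re t\<bar> * (ln (real n + 5) - ln (real n)))"
    using d0 by (simp add: abs_mult flip: right_diff_distrib)
  also have "\<dots> \<le> \<bar>r\<bar> * (real n * (5 / real n))"
    using d d0 t by (intro mult_left_mono mult_mono) auto
  also have "\<dots> = 5 * \<bar>r\<bar>" using n by simp
  finally have "\<bar>r * Re t * ln (real n + 5) - r * Re t * ln (real n)\<bar> \<le> 5 * \<bar>r\<bar>" .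
  then show "exp (- (5 * \<bar>r\<bar>)) * (case x of (n, t) \<Rightarrow> exp (r * Re t * ln (real n))) \<le> (case x of (n, t) \<Rightarrow> exp (r * Re t * ln (real n + 5)))"
    "(case x of (n, t) \<Rightarrow> exp (r * Re t * ln (real n + 5))) \<le> exp (5 * \<bar>r\<bar>) * (case x of (n, t) \<Rightarrow> exp (r * Re t * ln (real n)))"
    unfolding nt by (simp_all add: abs_le_iff flip: exp_add)
  show "0 \<le> (case x of (n, t) \<Rightarrow> exp (r * Re t * ln (real n)))" by (simp add: nt)
qed auto

text \<open>The shifts in $t + 3 = Nz$, $n - t + 2 = N(1-z)$ with $N = n+5$ keep both arguments in the half-plane of
  the Stirling bounds, while the rescaling to $z$ remains exact.\<close>

abbreviation "sx n t \<equiv> (Re t + 3) / (real n + 5)"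
abbreviation "sy n t \<equiv> Im t / (real n + 5)"

lemma amp_comparable:
  fixes M K :: nat and \<nu> \<nu>' :: "nat \<Rightarrow> nat" and l :: real
  obtains \<alpha> \<beta> :: real and D :: "nat \<Rightarrow> real"
  where "\<And>n. D n > 0"
    "comparable strip (\<lambda>(n, t). norm (gamprod M K \<nu> \<nu>' n t * nodepoly n t))
    (\<lambda>(n, t). D n * (norm ((t + 3) / complex_of_real (real n + 5)) powr \<alpha> * norm (1 - (t + 3) / complex_of_real (real n + 5)) powr \<beta>)
      * exp ((real n + 5) * phase (real M + 1) (real K + 1) l (sx n t) (sy n t))
      * exp (Re t * l + (real M - real K) * Re t * ln (real n))
      * (norm (sin (of_real pi * t)) * exp (- pi * \<bar>Im t\<bar>)))"
proof -
  define \<alpha> \<beta> where "\<alpha> = real (\<Sum>j=1..M. \<nu> j) - 5/2 * (real M + 1)" and "\<beta> = real (\<Sum>k=1..K. \<nu>' k) - 5/2 * (real K + 1)"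
  \<comment> \<open>Everything that does not depend on t, including what the shift in Re t = N x - 3
    leaves behind. It cancels in the quotient of the values at s and t, so only its positivity will
    matter.\<close>
  define D where "D n = (real n + 5) powr \<alpha> * (real n + 5) powr \<beta> * exp ((real K + 1) * (real n + 5) * ln (real n + 5)
     + 3 * l + 3 * (real M - real K) * ln (real n + 5))" for n :: nat
  let ?p = "real M + 1" and ?q = "real K + 1" and ?N = "\<lambda>n. real n + 5"
  let ?F = "\<lambda>n t. D n * (norm ((t + 3) / complex_of_real (?N n)) powr \<alpha> * norm (1 - (t + 3) / complex_of_real (?N n)) powr \<beta>)
      * exp (?N n * phase ?p ?q l ((Re t + 3) / ?N n) (Im t / ?N n))
      * exp (Re t * l) * (norm (sin (of_real pi * t)) * exp (- pi * \<bar>Im t\<bar>))"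
  have D: "D n > 0" for n by (simp add: D_def)
  have eq: "norm (t + 3) powr \<alpha> * norm (of_nat n - t + 2) powr \<beta>
      * exp (?p * (re_zlnz (Re t + 3) (Im t) - (Re t + 3)) + ?q * (re_zlnz (real n - Re t + 2) (Im t) - (real n - Re t + 2)))
      * norm (sin (of_real pi * t)) = ?F n t * exp ((real M - real K) * Re t * ln (?N n))" if "(n, t) \<in> strip" for n :: nat and t :: complex
  proof -
    define N x v where "N = ?N n" and "x = (Re t + 3) / N" and "v = Im t / N"
    have N: "N > 0" by (simp add: N_def)
    have x1: "Re t + 3 = N * x" "Im t = N * v" using N by (simp_all add: x_def v_def)
    then have t: "Re t = N * x - 3" by simp
    have x: "Re t + 3 = N * x" "real n - Re t + 2 = N * (1 - x)" "Im t = N * v"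
      using x1 by (simp_all add: algebra_simps) (simp add: N_def)
    have x01: "x > 0" "1 - x > 0" using that N unfolding strip_def x_def by (auto simp: field_simps) (simp add: N_def)
    have n1: "norm (t + 3) = N * norm ((t + 3) / complex_of_real (?N n))"
    proof -
      have "norm ((t + 3) / complex_of_real N) = norm (t + 3) / N" using N by (simp add: norm_divide)
      then show ?thesis using N by (simp add: N_def)
    qed
    have "of_nat n - t + 2 = complex_of_real N * (1 - (t + 3) / complex_of_real (?N n))"
    proof -
      have "complex_of_real N * (1 - (t + 3) / complex_of_real N) = complex_of_real N - (t + 3)"
        using N by (simp add: field_simps)
      then show ?thesis by (simp add: N_def)
    qed
    then have n2: "norm (of_nat n - t + 2) = N * norm (1 - (t + 3) / complex_of_real (?N n))"
      using N by (simp add: norm_mult)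
    have e: "?p * (re_zlnz (Re t + 3) (Im t) - (Re t + 3)) + ?q * (re_zlnz (real n - Re t + 2) (Im t) - (real n - Re t + 2))
      = (?q * N * ln N + 3 * l + 3 * (real M - real K) * ln N) + N * phase ?p ?q l x v + Re t * l + (- pi * \<bar>Im t\<bar>)
        + (real M - real K) * Re t * ln N"
    proof -
      have a: "\<bar>Im t\<bar> = N * \<bar>v\<bar>" using N by (simp add: x abs_mult)
      show ?thesis unfolding x(1,2) a unfolding x(3) re_zlnz_scale[OF N x01(1)] re_zlnz_scale[OF N x01(2)] phase_def t
        by (simp add: algebra_simps)
    qed
    show ?thesis
      unfolding e exp_add unfolding n1 n2 using N
      by (simp add: D_def powr_mult exp_add x_def v_def N_def mult_ac)
  qed
  have "comparable strip (\<lambda>(n, t). norm (gamprod M K \<nu> \<nu>' n t * nodepoly n t)) (\<lambda>(n, t). ?F n t * exp ((real M - real K) * Re t * ln (?N n)))"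
    using amp_comparable_unscaled[of M K \<nu> \<nu>'] unfolding \<alpha>_def[symmetric] \<beta>_def[symmetric]
    by (rule comparable_cong) (use eq in auto)
  moreover have "comparable strip (\<lambda>(n, t). ?F n t * exp ((real M - real K) * Re t * ln (?N n)))
     (\<lambda>(n, t). ?F n t * exp ((real M - real K) * Re t * ln (real n)))"
  proof -
    have "comparable strip (\<lambda>x. (case x of (n, t) \<Rightarrow> ?F n t) * (case x of (n, t) \<Rightarrow> exp ((real M - real K) * Re t * ln (?N n))))
     (\<lambda>x. (case x of (n, t) \<Rightarrow> ?F n t) * (case x of (n, t) \<Rightarrow> exp ((real M - real K) * Re t * ln (real n))))"
      using D by (intro comparable_mult powr_shift_comparable comparable_refl) (auto intro!: mult_nonneg_nonneg simp: less_imp_le)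
    then show ?thesis by (rule comparable_cong) auto
  qed
  ultimately have "comparable strip (\<lambda>(n, t). norm (gamprod M K \<nu> \<nu>' n t * nodepoly n t)) (\<lambda>(n, t). ?F n t * exp ((real M - real K) * Re t * ln (real n)))"
    by (rule comparable_trans)
  then have "comparable strip (\<lambda>(n, t). norm (gamprod M K \<nu> \<nu>' n t * nodepoly n t))
    (\<lambda>(n, t). D n * (norm ((t + 3) / complex_of_real (real n + 5)) powr \<alpha> * norm (1 - (t + 3) / complex_of_real (real n + 5)) powr \<beta>)
      * exp ((real n + 5) * phase (real M + 1) (real K + 1) l (sx n t) (sy n t))
      * exp (Re t * l + (real M - real K) * Re t * ln (real n))
      * (norm (sin (of_real pi * t)) * exp (- pi * \<bar>Im t\<bar>)))"
    by (rule comparable_cong) (auto simp: exp_add)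
  then show ?thesis using that D by blast
qed

section \<open>The kernel as a line integral\<close>

text \<open>Built from \<open>rGamma\<close> so that it is entire, which lets the residue theorem be
  applied in the whole plane.\<close>

definition rgamprod :: "nat \<Rightarrow> nat \<Rightarrow> (nat \<Rightarrow> nat) \<Rightarrow> (nat \<Rightarrow> nat) \<Rightarrow> nat \<Rightarrow> complex \<Rightarrow> complex" where
  "rgamprod M K \<nu> \<nu>' n t = (\<Prod>j=1..M. rGamma (t + of_nat (\<nu> j) + 1)) * (\<Prod>k=1..K. rGamma (of_nat n - t + of_nat (\<nu>' k)))"

lemma rgamprod_eq_inverse: "rgamprod M K \<nu> \<nu>' n t = inverse (gamprod M K \<nu> \<nu>' n t)"
  by (simp add: rgamprod_def gamprod_def rGamma_inverse_Gamma prod_inversef[symmetric] o_def inverse_mult_distrib)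

lemma Gamma_nz: "Re z > 0 \<Longrightarrow> Gamma z \<noteq> 0"
  by (simp add: Gamma_eq_zero_iff Re_pos_not_nonpos_Ints)

lemma gamprod_nz:
  assumes "-1 < Re t" "Re t < real n"
  shows "gamprod M K \<nu> \<nu>' n t \<noteq> 0"
proof -
  have "Gamma (t + of_nat (\<nu> j) + 1) \<noteq> 0" "Gamma (of_nat n - t + of_nat (\<nu>' k)) \<noteq> 0" for j k
    by (intro Gamma_nz; use assms in simp)+
  then show ?thesis by (simp add: gamprod_def)
qed

lemma holomorphic_rgamprod: "rgamprod M K \<nu> \<nu>' n holomorphic_on S"
  unfolding rgamprod_def by (intro holomorphic_intros)

lemma holomorphic_gamprod: "gamprod M K \<nu> \<nu>' n holomorphic_on {s. -1 < Re s \<and> Re s < real n}"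
  unfolding gamprod_def by (intro holomorphic_intros Re_pos_not_nonpos_Ints) auto

lemma holomorphic_nodepoly: "nodepoly n holomorphic_on S"
  unfolding nodepoly_def by (intro holomorphic_intros)

lemma nodepoly_eq_0_iff: "nodepoly n t = 0 \<longleftrightarrow> t \<in> of_nat ` {..<n}"
  by (auto simp: nodepoly_def)

lemma nodepoly_shift:
  assumes "t - of_nat n + 1 \<notin> \<int>\<^sub>\<le>\<^sub>0"
  shows "Gamma (t + 1) = nodepoly n t * Gamma (t - of_nat n + 1)"
proof -
  have "nodepoly n t = pochhammer (t - of_nat n + 1) n"
    unfolding nodepoly_def pochhammer_prod atLeast0LessThan
    by (rule prod.reindex_bij_witness[of _ "\<lambda>i. n - 1 - i" "\<lambda>i. n - 1 - i"]) (auto simp: of_nat_diff)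
  then show ?thesis
    using pochhammer_Gamma[OF assms, of n] assms by (simp add: Gamma_eq_zero_iff)
qed

text \<open>Agrees with \<open>powr\<close> for x > 0, and is entire in t without a side condition
  on x.\<close>

definition cpow :: "real \<Rightarrow> complex \<Rightarrow> complex" where
  "cpow x t = exp (t * of_real (ln x))"

lemma cpow_powr: "x > 0 \<Longrightarrow> of_real x powr t = cpow x t"
  by (simp add: cpow_def powr_def Ln_of_real)

lemma norm_cpow: "norm (cpow x t) = exp (Re t * ln x)"
  by (simp add: cpow_def)

lemma holomorphic_cpow [holomorphic_intros]: "f holomorphic_on S \<Longrightarrow> (\<lambda>t. cpow x (f t)) holomorphic_on S"
  unfolding cpow_def by (intro holomorphic_intros)

lemma kernel_integrand_eq:
  assumes "\<nu> 0 = 0" "x > 0" "y > 0" "Re s = - 1/2" "Re t > - 1/2" "t \<notin> of_nat ` {..<n}"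
  shows "kernel_integrand M K \<nu> \<nu>' n x y s t =
    gamprod M K \<nu> \<nu>' n s * nodepoly n s * cpow y (- s - 1) * (rgamprod M K \<nu> \<nu>' n t * cpow x t / (nodepoly n t * (s - t)))"
proof -
  \<comment> \<open>The real part of s - n + 1 is half-integral, so a parity argument excludes the
    poles of Gamma.\<close>
  have s: "s - of_nat n + 1 \<notin> \<int>\<^sub>\<le>\<^sub>0"
  proof
    assume "s - of_nat n + 1 \<in> \<int>\<^sub>\<le>\<^sub>0"
    then obtain k where k: "s - of_nat n + 1 = of_int k" by (auto elim!: nonpos_Ints_cases)
    then have "Re s - real n + 1 = real_of_int k" by (metis Re_complex_of_real minus_complex.simps(1) of_real_of_int_eq of_real_of_nat_eq one_complex.simps(1) plus_complex.simps(1))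
    then have "real_of_int (2 * k + 2 * int n - 2) = real_of_int (- 1)" using assms(4) by simp
    then have "2 * k + 2 * int n - 2 = - 1" by (simp only: of_int_eq_iff)
    then show False by presburger
  qed
  \<comment> \<open>To the right of Re t = -1/2 the poles of Gamma(t - n + 1) are exactly the nodes
    0, ..., n-1.\<close>
  have t: "t - of_nat n + 1 \<notin> \<int>\<^sub>\<le>\<^sub>0"
  proof
    assume "t - of_nat n + 1 \<in> \<int>\<^sub>\<le>\<^sub>0"
    then obtain m where "t - of_nat n + 1 = - of_nat m" by (auto elim!: nonpos_Ints_cases')
    then have m: "t = of_int (int n - 1 - int m)" by (simp add: algebra_simps)
    then have "real_of_int (int n - 1 - int m) > - 1/2" using assms(5) by simp
    then have "int n - 1 - int m \<ge> 0" by linarith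
    then have "t = of_nat (n - 1 - m)" "n - 1 - m < n"
      using m by (auto simp: of_nat_diff)
    then show False using assms(6) by blast
  qed
  have G: "Gamma (s - of_nat n + 1) \<noteq> 0" "Gamma (t - of_nat n + 1) \<noteq> 0" using s t by (auto simp: Gamma_eq_zero_iff)
  have e1: "(\<Prod>j=0..M. Gamma (s + of_nat (\<nu> j) + 1) / Gamma (t + of_nat (\<nu> j) + 1))
     = (Gamma (s + 1) / Gamma (t + 1)) * (\<Prod>j=1..M. Gamma (s + of_nat (\<nu> j) + 1) / Gamma (t + of_nat (\<nu> j) + 1))"
    by (subst prod.atLeast_Suc_atMost) (auto simp: assms(1))
  have "kernel_integrand M K \<nu> \<nu>' n x y s t =
    (Gamma (s + 1) / Gamma (s - of_nat n + 1)) * (Gamma (t - of_nat n + 1) / Gamma (t + 1))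
    * (gamprod M K \<nu> \<nu>' n s / gamprod M K \<nu> \<nu>' n t) * (cpow x t * cpow y (- s - 1) / (s - t))"
    unfolding kernel_integrand_def e1 unfolding gamprod_def cpow_powr[OF assms(2)] cpow_powr[OF assms(3)] prod_dividef
    by (simp add: mult_ac)
  also have "Gamma (s + 1) / Gamma (s - of_nat n + 1) = nodepoly n s"
    using nodepoly_shift[OF s] G by simp
  also have "Gamma (t - of_nat n + 1) / Gamma (t + 1) = inverse (nodepoly n t)"
    using nodepoly_shift[OF t] G by (simp add: divide_simps)
  finally show ?thesis by (simp add: rgamprod_eq_inverse divide_inverse mult_ac inverse_mult_distrib)
qed

text \<open>The residues of the $t$-integral add up to the polynomial in $s$ that interpolates $x^t$ divided by the
  Gamma products at the nodes $0, \ldots, n-1$. It has no poles, so the line of integration in $s$ can be moved across the nodes.\<close>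

definition lagrange :: "nat \<Rightarrow> nat \<Rightarrow> (nat \<Rightarrow> nat) \<Rightarrow> (nat \<Rightarrow> nat) \<Rightarrow> nat \<Rightarrow> real \<Rightarrow> complex \<Rightarrow> complex" where
  "lagrange M K \<nu> \<nu>' n x s = (\<Sum>k<n. rgamprod M K \<nu> \<nu>' n (of_nat k) * cpow x (of_nat k) *
      (\<Prod>i\<in>{..<n}-{k}. (s - of_nat i) / (of_nat k - of_nat i)))"

text \<open>Residue theorem with simple poles at the nodes and at s. Multiplied by the node
  polynomial in s, the residues at the nodes become the Lagrange basis, and the pole at s is
  weighted by its winding number. The weight is kept general because it is 0 for the given contour
  and an indicator function of Im s for the rectangle.\<close>

lemma contour_integral_lagrange:
  assumes "valid_path g" "pathfinish g = pathstart g"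
    and "\<And>k. k < n \<Longrightarrow> of_nat k \<notin> path_image g" "s \<notin> path_image g"
    and wn: "\<And>k. k < n \<Longrightarrow> winding_number g (of_nat k) = 1"
    and s: "s \<notin> of_nat ` {..<n}"
  shows "nodepoly n s * contour_integral g (\<lambda>t. rgamprod M K \<nu> \<nu>' n t * cpow x t / (nodepoly n t * (s - t)))
    = 2 * pi * \<i> * (lagrange M K \<nu> \<nu>' n x s - winding_number g s * (rgamprod M K \<nu> \<nu>' n s * cpow x s))"
proof -
  let ?r = "rgamprod M K \<nu> \<nu>' n"
  define f where "f t = ?r t * cpow x t" for t
  define F where "F t = f t / (nodepoly n t * (s - t))" for t
  define Q where "Q k t = (\<Prod>i\<in>{..<n}-{k}. t - of_nat i :: complex)" for k t
  let ?pts = "insert s (of_nat ` {..<n})"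
  have fh: "f holomorphic_on S" for S unfolding f_def by (intro holomorphic_intros holomorphic_rgamprod)
  have nps: "nodepoly n s \<noteq> 0" using s by (simp add: nodepoly_eq_0_iff)
  have "contour_integral g F = 2 * pi * \<i> * (\<Sum>p\<in>?pts. winding_number g p * residue F p)"
  proof (rule Residue_theorem)
    show "F holomorphic_on UNIV - ?pts"
      unfolding F_def by (intro holomorphic_intros fh holomorphic_nodepoly) (auto simp: nodepoly_eq_0_iff)
  qed (use assms in auto)
  then have ci: "contour_integral g F = 2 * pi * \<i> * (\<Sum>p\<in>?pts. winding_number g p * residue F p)" .
  have rs: "residue F s = - f s / nodepoly n s"
  proof -
    have "F = (\<lambda>t. (- f t / nodepoly n t) / (t - s))"
      unfolding F_def by (rule ext) (simp add: divide_simps, auto simp: algebra_simps)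
    moreover have "residue (\<lambda>t. (- f t / nodepoly n t) / (t - s)) s = - f s / nodepoly n s"
      by (rule residue_simple[of "- (of_nat ` {..<n})"])
         (use s in \<open>auto intro!: holomorphic_intros fh holomorphic_nodepoly finite_imp_closed simp: nodepoly_eq_0_iff\<close>)
    ultimately show ?thesis by simp
  qed
  have rk: "residue F (of_nat k) = f (of_nat k) / (Q k (of_nat k) * (s - of_nat k))" if k: "k < n" for k
  proof -
    have np: "nodepoly n t = (t - of_nat k) * Q k t" for t
      unfolding nodepoly_def Q_def using k by (subst prod.remove[of _ k]) auto
    have "F = (\<lambda>t. (f t / (Q k t * (s - t))) / (t - of_nat k))"
      unfolding F_def by (rule ext) (simp add: np mult_ac)
    moreover have "residue (\<lambda>t. (f t / (Q k t * (s - t))) / (t - of_nat k)) (of_nat k) = f (of_nat k) / (Q k (of_nat k) * (s - of_nat k))"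
    proof (rule residue_simple[of "- (insert s (of_nat ` ({..<n} - {k})))"])
      show "open (- insert s (of_nat ` ({..<n} - {k})))" by (intro open_Compl finite_imp_closed) auto
      show "of_nat k \<in> - insert s (of_nat ` ({..<n} - {k}))" using s k by auto
      show "(\<lambda>t. f t / (Q k t * (s - t))) holomorphic_on - insert s (of_nat ` ({..<n} - {k}))"
        unfolding Q_def by (intro holomorphic_intros fh) auto
    qed
    ultimately show ?thesis by simp
  qed
  have sm: "(\<Sum>p\<in>?pts. winding_number g p * residue F p)
     = winding_number g s * residue F s + (\<Sum>k<n. winding_number g (of_nat k) * residue F (of_nat k))"
    using s by (subst sum.insert) (auto simp: sum.reindex inj_on_def)
  have sm2: "(\<Sum>k<n. winding_number g (of_nat k) * residue F (of_nat k)) = (\<Sum>k<n. f (of_nat k) / (Q k (of_nat k) * (s - of_nat k)))"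
    by (intro sum.cong refl) (simp add: wn rk)
  have "nodepoly n s * contour_integral g F = 2 * pi * \<i> *
     (nodepoly n s * (winding_number g s * (- f s / nodepoly n s)) + (\<Sum>k<n. nodepoly n s * (f (of_nat k) / (Q k (of_nat k) * (s - of_nat k)))))"
    unfolding ci sm sm2 rs sum_distrib_left[symmetric] by (simp only: distrib_left mult_ac)
  also have "nodepoly n s * (winding_number g s * (- f s / nodepoly n s)) = - (winding_number g s * f s)"
    using nps by simp
  also have "(\<Sum>k<n. nodepoly n s * (f (of_nat k) / (Q k (of_nat k) * (s - of_nat k)))) = lagrange M K \<nu> \<nu>' n x s"
    unfolding lagrange_def
  proof (intro sum.cong refl)
    fix k assume "k \<in> {..<n}"
    then have k: "k < n" by simp
    have np: "nodepoly n s = (s - of_nat k) * Q k s"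
      unfolding nodepoly_def Q_def using k by (subst prod.remove[of _ k]) auto
    have "s - of_nat k \<noteq> 0" using s k by auto
    then show "nodepoly n s * (f (of_nat k) / (Q k (of_nat k) * (s - of_nat k))) = ?r (of_nat k) * cpow x (of_nat k) *
      (\<Prod>i\<in>{..<n}-{k}. (s - of_nat i) / (of_nat k - of_nat i))"
      unfolding np f_def prod_dividef Q_def by simp
  qed
  finally show ?thesis by (simp add: F_def f_def)
qed

definition line_integrand where
  "line_integrand M K \<nu> \<nu>' n x y s = gamprod M K \<nu> \<nu>' n s * cpow y (- s - 1) * lagrange M K \<nu> \<nu>' n x s"

text \<open>The contour lies in a convex half-plane that does not contain s, so s has winding number
  0 and only the node residues remain. Since \<gamma> has disappeared from the right-hand side, the
  kernel does not depend on the contour.\<close>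

lemma correlation_kernel_eq:
  assumes "\<nu> 0 = 0" "x > 0" "y > 0" "encircling_contour n \<gamma>"
  shows "correlation_kernel M K \<nu> \<nu>' n \<gamma> x y = 1 / (2 * of_real pi) * (LINT u|lborel. line_integrand M K \<nu> \<nu>' n x y (Complex (- 1/2) u))"
proof -
  have g: "valid_path \<gamma>" "pathfinish \<gamma> = pathstart \<gamma>" "\<And>t. t \<in> path_image \<gamma> \<Longrightarrow> Re t > - 1/2"
    "\<And>k. k < n \<Longrightarrow> of_nat k \<notin> path_image \<gamma>" "\<And>k. k < n \<Longrightarrow> winding_number \<gamma> (of_nat k) = 1"
    using assms(4) by (auto simp: encircling_contour_def)
  have "contour_integral \<gamma> (kernel_integrand M K \<nu> \<nu>' n x y (Complex (- 1/2) u)) = 2 * pi * \<i> * line_integrand M K \<nu> \<nu>' n x y (Complex (- 1/2) u)" for u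
  proof -
    define s where "s = Complex (- 1/2) u"
    let ?F = "\<lambda>t. rgamprod M K \<nu> \<nu>' n t * cpow x t / (nodepoly n t * (s - t))"
    let ?c = "gamprod M K \<nu> \<nu>' n s * nodepoly n s * cpow y (- s - 1)"
    have s: "Re s = - 1/2" by (simp add: s_def)
    have sn: "s \<notin> of_nat ` {..<n}" using s by auto
    have sg: "s \<notin> path_image \<gamma>" using g(3) s by fastforce
    have "contour_integral \<gamma> (kernel_integrand M K \<nu> \<nu>' n x y s) = contour_integral \<gamma> (\<lambda>t. ?c * ?F t)"
      by (intro contour_integral_eq kernel_integrand_eq) (use assms s g in auto)
    also have "\<dots> = ?c * contour_integral \<gamma> ?F"
    proof (intro contour_integral_lmul contour_integrable_holomorphic_simple)
      show "?F holomorphic_on - (insert s (of_nat ` {..<n}))"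
        by (intro holomorphic_intros holomorphic_rgamprod holomorphic_nodepoly) (auto simp: nodepoly_eq_0_iff)
      show "open (- insert s (of_nat ` {..<n}))" by (intro open_Compl finite_imp_closed) auto
    qed (use g sg in auto)
    also have "\<dots> = gamprod M K \<nu> \<nu>' n s * cpow y (- s - 1) * (nodepoly n s * contour_integral \<gamma> ?F)" by simp
    also have "nodepoly n s * contour_integral \<gamma> ?F = 2 * pi * \<i> * (lagrange M K \<nu> \<nu>' n x s - winding_number \<gamma> s * (rgamprod M K \<nu> \<nu>' n s * cpow x s))"
      by (rule contour_integral_lagrange) (use g sg sn in auto)
    also have "winding_number \<gamma> s = 0"
    proof (rule winding_number_zero_outside)
      show "convex {t. Re t > - 1/2}" using convex_halfspace_Re_gt by simp
    qed (use g s valid_path_imp_path in auto)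
    finally show ?thesis by (simp add: line_integrand_def s_def)
  qed
  then have "correlation_kernel M K \<nu> \<nu>' n \<gamma> x y = 1 / (2 * of_real pi * \<i>)\<^sup>2 * (\<i> * (LINT u|lborel. 2 * pi * \<i> * line_integrand M K \<nu> \<nu>' n x y (Complex (- 1/2) u)))"
    by (simp add: correlation_kernel_def)
  also have "\<dots> = 1 / (2 * of_real pi * \<i>)\<^sup>2 * (\<i> * (2 * pi * \<i> * (LINT u|lborel. line_integrand M K \<nu> \<nu>' n x y (Complex (- 1/2) u))))"
    by (subst integral_mult_right_zero) simp
  also have "\<dots> = 1 / (2 * of_real pi) * (LINT u|lborel. line_integrand M K \<nu> \<nu>' n x y (Complex (- 1/2) u))"
    by (simp add: power2_eq_square)
  finally show ?thesis .
qed

section \<open>Moving a vertical line of integration\<close>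

lemma integrable_inverse_square: "integrable lborel (\<lambda>u::real. B / (1 + u\<^sup>2))"
proof -
  have "integrable lborel (\<lambda>x::real. inverse (1 + x^2))"
    using integrable_inverse_1_plus_square by (simp add: set_integrable_def)
  then show ?thesis by (simp add: divide_inverse)
qed

lemma line_integrable:
  fixes f :: "complex \<Rightarrow> complex"
  assumes "f holomorphic_on {s. A < Re s \<and> Re s < A'}" "A < c" "c < A'"
    and "\<And>u. norm (f (Complex c u)) \<le> B / (1 + u\<^sup>2)"
  shows "integrable lborel (\<lambda>u. f (Complex c u))"
proof (rule Bochner_Integration.integrable_bound[OF integrable_inverse_square[of B]])
  have "continuous_on UNIV (\<lambda>u. f (Complex c u))"
    by (rule continuous_on_compose2[OF holomorphic_on_imp_continuous_on[OF assms(1)]])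
       (use assms in \<open>auto simp: Complex_eq intro!: continuous_intros\<close>)
  then show "(\<lambda>u. f (Complex c u)) \<in> borel_measurable lborel"
    by (simp add: borel_measurable_continuous_onI)
  show "AE u in lborel. norm (f (Complex c u)) \<le> norm (B / (1 + u\<^sup>2))"
    by (intro AE_I2 order_trans[OF assms(4)]) (metis abs_ge_self real_norm_def)
qed

text \<open>A primitive on the convex strip does the work of Cauchy's theorem: the truncated
  integrals are differences of the primitive at heights T and -T, and moving horizontally at height
  T changes it by at most B (c2 - c1) / (1 + T^2).\<close>

lemma line_shift:
  fixes f :: "complex \<Rightarrow> complex"
  assumes h: "f holomorphic_on {s. A < Re s \<and> Re s < A'}" and c: "A < c1" "c1 \<le> c2" "c2 < A'"
    and bd: "\<And>s. c1 \<le> Re s \<Longrightarrow> Re s \<le> c2 \<Longrightarrow> norm (f s) \<le> B / (1 + (Im s)\<^sup>2)"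
  shows "(LINT u|lborel. f (Complex c1 u)) = (LINT u|lborel. f (Complex c2 u))"
proof -
  let ?S = "{s. A < Re s \<and> Re s < A'}"
  have S: "?S = {s. A < Re s} \<inter> {s. Re s < A'}" by auto
  have cS: "convex ?S" unfolding S by (intro convex_Int convex_halfspace_Re_gt convex_halfspace_Re_lt)
  have oS: "open ?S" unfolding S by (intro open_Int open_halfspace_Re_gt open_halfspace_Re_lt)
  obtain F where F: "\<And>s. s \<in> ?S \<Longrightarrow> (F has_field_derivative f s) (at s within ?S)"
    using holomorphic_convex_primitive'[OF cS oS h] by blast
  have F': "(F has_field_derivative f s) (at s)" if "s \<in> ?S" for s
    using F[OF that] at_within_open[OF that oS] by simp
  have B0: "B \<ge> 0" using bd[of "Complex c1 0"] c by (auto intro: order_trans[OF norm_ge_zero])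
  have seg: "norm (F (Complex c2 u) - F (Complex c1 u)) \<le> B / (1 + u\<^sup>2) * (c2 - c1)" for u
  proof -
    let ?L = "{s. c1 \<le> Re s} \<inter> {s. Re s \<le> c2} \<inter> {s. Im s = u}"
    have "norm (F (Complex c2 u) - F (Complex c1 u)) \<le> B / (1 + u\<^sup>2) * norm (Complex c2 u - Complex c1 u)"
    proof (rule field_differentiable_bound[of ?L F f])
      show "convex ?L" by (intro convex_Int convex_halfspace_Re_ge convex_halfspace_Re_le) (auto simp: convex_def algebra_simps simp flip: distrib_right)
      fix s assume s: "s \<in> ?L"
      show "(F has_field_derivative f s) (at s within ?L)"
        using s c by (intro has_field_derivative_at_within[OF F']) auto
      show "norm (f s) \<le> B / (1 + u\<^sup>2)" using bd[of s] s by auto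
    qed (use c in auto)
    then show ?thesis using c by (simp add: cmod_def)
  qed
  define I where "I c T = (LINT u|lborel. indicator {- T..T} u *\<^sub>R f (Complex c u))" for c T
  have I: "I c T = - \<i> * (F (Complex c T) - F (Complex c (- T)))" if "c1 \<le> c" "c \<le> c2" "T \<ge> 0" for c T
  proof -
    have cont: "continuous_on {- T..T} (\<lambda>u. f (Complex c u))"
      by (rule continuous_on_compose2[OF holomorphic_on_imp_continuous_on[OF h]])
         (use c that in \<open>auto simp: Complex_eq intro!: continuous_intros\<close>)
    have "((\<lambda>u. - \<i> * F (Complex c u)) has_vector_derivative f (Complex c u)) (at u within {- T..T})" for u
    proof -
      have "((\<lambda>u. Complex c u) has_vector_derivative \<i>) (at u)"
        unfolding Complex_eq by (auto intro!: derivative_eq_intros)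
      then have "((F \<circ> (\<lambda>u. Complex c u)) has_vector_derivative \<i> * f (Complex c u)) (at u)"
        by (rule field_vector_diff_chain_at) (rule F', use c that in auto)
      then have "((\<lambda>u. - \<i> * (F \<circ> (\<lambda>u. Complex c u)) u) has_vector_derivative - \<i> * (\<i> * f (Complex c u))) (at u)"
        by (rule has_vector_derivative_mult_right)
      then show ?thesis by (simp add: o_def has_vector_derivative_at_within)
    qed
    then have i1: "((\<lambda>u. f (Complex c u)) has_integral (- \<i> * F (Complex c T) - (- \<i> * F (Complex c (- T))))) {- T..T}"
      using that by (intro fundamental_theorem_of_calculus) auto
    have "set_integrable lborel {- T..T} (\<lambda>u. f (Complex c u))"
      unfolding set_integrable_def by (rule borel_integrable_compact) (use cont in auto)
    then have i2: "((\<lambda>u. f (Complex c u)) has_integral I c T) {- T..T}"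
      using set_borel_integral_eq_integral[of "{-T..T}" "\<lambda>u. f (Complex c u)"]
      by (simp add: I_def set_lebesgue_integral_def has_integral_integrable_integral)
    show ?thesis using has_integral_unique[OF i2 i1] by (simp add: algebra_simps)
  qed
  have lim: "(\<lambda>n. I c (real n)) \<longlonglongrightarrow> (LINT u|lborel. f (Complex c u))" if "c1 \<le> c" "c \<le> c2" for c
    unfolding I_def
  proof (rule integral_dominated_convergence)
    have int: "integrable lborel (\<lambda>u. f (Complex c u))"
    proof (rule line_integrable[OF h, where B = B])
      show "norm (f (Complex c u)) \<le> B / (1 + u\<^sup>2)" for u
        using bd[of "Complex c u"] that by simp
    qed (use c that in auto)
    then show "integrable lborel (\<lambda>u. norm (f (Complex c u)))" by simp
    show m: "(\<lambda>u. f (Complex c u)) \<in> borel_measurable lborel" using int by simp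
    show "(\<lambda>u. indicator {- real n..real n} u *\<^sub>R f (Complex c u)) \<in> borel_measurable lborel" for n
      using m by measurable
    show "AE u in lborel. norm (indicator {- real n..real n} u *\<^sub>R f (Complex c u)) \<le> norm (f (Complex c u))" for n
      by (auto simp: indicator_def)
    show "AE u in lborel. (\<lambda>n. indicator {- real n..real n} u *\<^sub>R f (Complex c u)) \<longlonglongrightarrow> f (Complex c u)"
    proof (rule AE_I2)
      fix u :: real
      obtain m where m: "\<bar>u\<bar> \<le> real m" using real_arch_simple by blast
      have "\<forall>\<^sub>F n in sequentially. f (Complex c u) = indicator {- real n..real n} u *\<^sub>R f (Complex c u)"
        using eventually_ge_at_top[of m]
      proof eventually_elim
        case (elim n)
        then have "\<bar>u\<bar> \<le> real n" using m by (meson of_nat_mono order_trans)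
        then show ?case by (auto simp: indicator_def)
      qed
      then show "(\<lambda>n. indicator {- real n..real n} u *\<^sub>R f (Complex c u)) \<longlonglongrightarrow> f (Complex c u)"
        by (rule Lim_transform_eventually[OF tendsto_const])
    qed
  qed
  have d: "norm (I c2 (real n) - I c1 (real n)) \<le> 2 * (B / (1 + (real n)\<^sup>2) * (c2 - c1))" for n
  proof -
    have "I c2 (real n) - I c1 (real n) = - \<i> * ((F (Complex c2 n) - F (Complex c1 n)) - (F (Complex c2 (- real n)) - F (Complex c1 (- real n))))"
      using c by (simp add: I algebra_simps)
    then have "norm (I c2 (real n) - I c1 (real n)) = norm ((F (Complex c2 n) - F (Complex c1 n)) - (F (Complex c2 (- real n)) - F (Complex c1 (- real n))))"
      by (simp add: norm_mult)
    also have "\<dots> \<le> norm (F (Complex c2 n) - F (Complex c1 n)) + norm (F (Complex c2 (- real n)) - F (Complex c1 (- real n)))"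
      by (rule norm_triangle_ineq4)
    also have "\<dots> \<le> 2 * (B / (1 + (real n)\<^sup>2) * (c2 - c1))"
      using seg[of "real n"] seg[of "- real n"] by simp
    finally show ?thesis .
  qed
  have "(\<lambda>n. 2 * (B / (1 + (real n)\<^sup>2) * (c2 - c1))) \<longlonglongrightarrow> 0" by real_asymp
  then have "(\<lambda>n. I c2 (real n) - I c1 (real n)) \<longlonglongrightarrow> 0"
    by (rule Lim_null_comparison[rotated]) (use d in auto)
  moreover have "(\<lambda>n. I c2 (real n) - I c1 (real n)) \<longlonglongrightarrow> (LINT u|lborel. f (Complex c2 u)) - (LINT u|lborel. f (Complex c1 u))"
    using c by (intro tendsto_diff lim) auto
  ultimately show ?thesis using LIMSEQ_unique by fastforce
qed

section \<open>Decay along vertical lines for fixed n\<close>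

lemma norm_Gamma_le:
  assumes "Re z > 0"
  shows "norm (Gamma z) \<le> Gamma (Re z)"
proof (rule LIMSEQ_le)
  show "(\<lambda>n. norm (Gamma_series z n)) \<longlonglongrightarrow> norm (Gamma z)"
    by (intro tendsto_norm Gamma_series_LIMSEQ)
  show "Gamma_series (Re z) \<longlonglongrightarrow> Gamma (Re z)" by (rule Gamma_series_LIMSEQ)
  have "norm (Gamma_series z n) \<le> Gamma_series (Re z) n" for n
  proof -
    have "0 < pochhammer (Re z) (n + 1)" using assms by (intro pochhammer_pos)
    \<comment> \<open>Only the denominator of Euler's sequence distinguishes z from Re z, apart from
      a phase, and its factors satisfy |z + i| >= Re z + i.\<close>
    moreover have "pochhammer (Re z) (n + 1) \<le> norm (pochhammer z (n + 1))"
      unfolding pochhammer_prod prod_norm[symmetric]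
    proof (intro prod_mono conjI)
      fix i
      show "0 \<le> Re z + real i" using assms by simp
      show "Re z + of_nat i \<le> norm (z + of_nat i)" using complex_Re_le_cmod[of "z + of_nat i"] by simp
    qed
    ultimately show ?thesis
      unfolding Gamma_series_def norm_divide norm_mult
      by (intro frac_le) auto
  qed
  then show "\<exists>N. \<forall>n\<ge>N. norm (Gamma_series z n) \<le> Gamma_series (Re z) n" by blast
qed

lemma norm_pochhammer_ge:
  assumes "Re z \<ge> 1/2"
  shows "norm (pochhammer z m) \<ge> ((1 + \<bar>Im z\<bar>) / 4) ^ m"
proof -
  have "((1 + \<bar>Im z\<bar>) / 4) ^ m = (\<Prod>i\<in>{0..<m}. (1 + \<bar>Im z\<bar>) / 4)" by simp
  also have "\<dots> \<le> (\<Prod>i\<in>{0..<m}. norm (z + of_nat i))"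
  proof (intro prod_mono conjI)
    fix i
    have "norm (z + of_nat i) \<ge> 1/2" "norm (z + of_nat i) \<ge> \<bar>Im z\<bar>"
      using complex_Re_le_cmod[of "z + of_nat i"] abs_Im_le_cmod[of "z + of_nat i"] assms by auto
    then show "(1 + \<bar>Im z\<bar>) / 4 \<le> norm (z + of_nat i)" by simp
  qed auto
  also have "\<dots> = norm (pochhammer z m)" by (simp add: pochhammer_prod prod_norm)
  finally show ?thesis .
qed

text \<open>Decay of order m in a closed vertical strip, put as a bound on a product so that orders
  add under multiplication.\<close>

definition decays :: "real \<Rightarrow> real \<Rightarrow> nat \<Rightarrow> (complex \<Rightarrow> complex) \<Rightarrow> bool" where
  "decays a b m f \<longleftrightarrow> (\<exists>B\<ge>0. \<forall>s. a \<le> Re s \<and> Re s \<le> b \<longrightarrow> norm (f s) * (1 + \<bar>Im s\<bar>) ^ m \<le> B)"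

lemma decays_mult:
  assumes "decays a b m f" "decays a b k g"
  shows "decays a b (m + k) (\<lambda>s. f s * g s)"
proof -
  obtain B1 where 1: "B1 \<ge> 0" "\<And>s. a \<le> Re s \<Longrightarrow> Re s \<le> b \<Longrightarrow> norm (f s) * (1 + \<bar>Im s\<bar>) ^ m \<le> B1"
    using assms(1) unfolding decays_def by blast
  obtain B2 where 2: "B2 \<ge> 0" "\<And>s. a \<le> Re s \<Longrightarrow> Re s \<le> b \<Longrightarrow> norm (g s) * (1 + \<bar>Im s\<bar>) ^ k \<le> B2"
    using assms(2) unfolding decays_def by blast
  have "norm (f s * g s) * (1 + \<bar>Im s\<bar>) ^ (m + k) \<le> B1 * B2" if "a \<le> Re s" "Re s \<le> b" for s
  proof -
    have "(norm (f s) * (1 + \<bar>Im s\<bar>) ^ m) * (norm (g s) * (1 + \<bar>Im s\<bar>) ^ k) \<le> B1 * B2"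
      using 1 2 that by (intro mult_mono) auto
    then show ?thesis by (simp add: norm_mult power_add mult_ac)
  qed
  then show ?thesis unfolding decays_def using 1 2 by (intro exI[of _ "B1 * B2"]) auto
qed

lemma decays_prod:
  assumes "finite I" "\<And>i. i \<in> I \<Longrightarrow> decays a b 0 (f i)"
  shows "decays a b 0 (\<lambda>s. \<Prod>i\<in>I. f i s)"
  using assms
proof (induction rule: finite_induct)
  case empty
  show ?case unfolding decays_def by (auto intro!: exI[of _ 1])
next
  case (insert i I)
  then show ?case using decays_mult[of a b 0 "f i" 0 "\<lambda>s. \<Prod>i\<in>I. f i s"] by simp
qed

text \<open>In Gamma(z) = Gamma(z+m) / (z)_m the numerator is dominated by the real Gamma function
  on a compact interval and the denominator grows like |Im z|^m. Every order m is obtained without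
  Stirling's formula.\<close>

lemma decays_Gamma: "decays (1/2) R m Gamma"
proof -
  have "compact ((Gamma :: real \<Rightarrow> real) ` {1/2 + real m..R + real m})"
    by (intro compact_continuous_image continuous_on_Gamma continuous_on_id) (auto elim!: nonpos_Ints_cases)
  then obtain G where G: "\<And>x. x \<in> {1/2 + real m..R + real m} \<Longrightarrow> \<bar>Gamma x\<bar> \<le> G"
    unfolding bounded_iff by (metis compact_imp_bounded bounded_iff image_eqI real_norm_def)
  have "norm (Gamma z) * (1 + \<bar>Im z\<bar>) ^ m \<le> max 0 G * 4 ^ m" if z: "1/2 \<le> Re z" "Re z \<le> R" for z
  proof -
    have nz: "z \<notin> \<int>\<^sub>\<le>\<^sub>0" using z by (intro Re_pos_not_nonpos_Ints) auto
    have "norm (Gamma (z + of_nat m)) = norm (pochhammer z m) * norm (Gamma z)"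
      using pochhammer_Gamma[OF nz, of m] nz by (simp add: norm_divide Gamma_eq_zero_iff)
    moreover have "norm (Gamma (z + of_nat m)) \<le> Gamma (Re z + real m)"
      using norm_Gamma_le[of "z + of_nat m"] z by simp
    moreover have "Gamma (Re z + real m) \<le> max 0 G" using G[of "Re z + real m"] z by auto
    ultimately have "norm (pochhammer z m) * norm (Gamma z) \<le> max 0 G" by linarith
    moreover have "((1 + \<bar>Im z\<bar>) / 4) ^ m * norm (Gamma z) \<le> norm (pochhammer z m) * norm (Gamma z)"
      using norm_pochhammer_ge[OF z(1)] by (intro mult_right_mono) auto
    ultimately have "((1 + \<bar>Im z\<bar>) / 4) ^ m * norm (Gamma z) \<le> max 0 G" by linarith
    then show ?thesis by (simp add: power_divide field_simps)
  qed
  then show ?thesis unfolding decays_def by (intro exI[of _ "max 0 G * 4 ^ m"]) auto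
qed

text \<open>The factor j = 1, present because M >= 1, supplies all of the decay; the others are
  merely bounded.\<close>

lemma decays_gamprod:
  assumes "M \<ge> 1"
  shows "decays (- 1/2) (real n - 1/2) m (gamprod M K \<nu> \<nu>' n)"
proof -
  let ?a = "- 1/2 :: real" and ?b = "real n - 1/2"
  have 1: "decays ?a ?b k (\<lambda>s. Gamma (s + of_nat (\<nu> j) + 1))" for j k
  proof -
    obtain B where "B \<ge> 0" "\<And>s. 1/2 \<le> Re s \<Longrightarrow> Re s \<le> real n + real (\<nu> j) + 1 \<Longrightarrow> norm (Gamma s) * (1 + \<bar>Im s\<bar>) ^ k \<le> B"
      using decays_Gamma[of "real n + real (\<nu> j) + 1" k] unfolding decays_def by blast
    from this(1) this(2)[of "s + of_nat (\<nu> j) + 1" for s] show ?thesis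
      unfolding decays_def by (intro exI[of _ B]) auto
  qed
  have 2: "decays ?a ?b k (\<lambda>s. Gamma (of_nat n - s + of_nat (\<nu>' j)))" for j k
  proof -
    obtain B where "B \<ge> 0" "\<And>s. 1/2 \<le> Re s \<Longrightarrow> Re s \<le> real n + real (\<nu>' j) + 1 \<Longrightarrow> norm (Gamma s) * (1 + \<bar>Im s\<bar>) ^ k \<le> B"
      using decays_Gamma[of "real n + real (\<nu>' j) + 1" k] unfolding decays_def by blast
    from this(1) this(2)[of "of_nat n - s + of_nat (\<nu>' j)" for s] show ?thesis
      unfolding decays_def by (intro exI[of _ B]) auto
  qed
  have "decays ?a ?b (m + 0 + 0) (\<lambda>s. Gamma (s + of_nat (\<nu> 1) + 1) * (\<Prod>j=2..M. Gamma (s + of_nat (\<nu> j) + 1))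
     * (\<Prod>k=1..K. Gamma (of_nat n - s + of_nat (\<nu>' k))))"
    by (intro decays_mult decays_prod 1 2) auto
  moreover have "(\<Prod>j=1..M. Gamma (s + of_nat (\<nu> j) + 1)) = Gamma (s + of_nat (\<nu> 1) + 1) * (\<Prod>j=2..M. Gamma (s + of_nat (\<nu> j) + 1))" for s :: complex
    using assms by (subst prod.atLeast_Suc_atMost) (auto simp: numeral_2_eq_2)
  ultimately show ?thesis unfolding gamprod_def[abs_def] by simp
qed

text \<open>A polynomial in s of degree below n; the denominators have modulus at least 1 because
  the nodes are distinct integers.\<close>

lemma norm_lagrange_le:
  obtains B where "B \<ge> 0" "\<And>s. - 1/2 \<le> Re s \<Longrightarrow> Re s \<le> real n - 1/2 \<Longrightarrow> norm (lagrange M K \<nu> \<nu>' n x s) \<le> B * (1 + \<bar>Im s\<bar>) ^ n"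
proof -
  let ?c = "\<lambda>k. norm (rgamprod M K \<nu> \<nu>' n (of_nat k) * cpow x (of_nat k))"
  let ?R = "2 * real n + 2"
  have "norm (lagrange M K \<nu> \<nu>' n x s) \<le> (\<Sum>k<n. ?c k * ?R ^ n) * (1 + \<bar>Im s\<bar>) ^ n"
    if s: "- 1/2 \<le> Re s" "Re s \<le> real n - 1/2" for s
  proof -
    have "norm (\<Prod>i\<in>{..<n}-{k}. (s - of_nat i) / (of_nat k - of_nat i)) \<le> (?R * (1 + \<bar>Im s\<bar>)) ^ n" for k
    proof -
      have "norm (\<Prod>i\<in>{..<n}-{k}. (s - of_nat i) / (of_nat k - of_nat i)) = (\<Prod>i\<in>{..<n}-{k}. norm ((s - of_nat i) / (of_nat k - of_nat i)))"
        by (simp add: prod_norm)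
      also have "\<dots> \<le> (\<Prod>i\<in>{..<n}-{k}. ?R * (1 + \<bar>Im s\<bar>))"
      proof (intro prod_mono conjI)
        fix i assume i: "i \<in> {..<n} - {k}"
        have "norm (of_nat k - of_nat i :: complex) = \<bar>real k - real i\<bar>"
          by (metis norm_of_real of_real_diff of_real_of_nat_eq)
        moreover have "\<bar>real k - real i\<bar> \<ge> 1" using i by (cases "i < k") auto
        ultimately have "norm ((s - of_nat i) / (of_nat k - of_nat i)) \<le> norm (s - of_nat i)"
          by (simp add: norm_divide divide_le_eq mult_le_cancel_left1) 
        also have "\<dots> \<le> \<bar>Re s - real i\<bar> + \<bar>Im s\<bar>" using cmod_le[of "s - of_nat i"] by simp
        also have "\<dots> \<le> ?R + ?R * \<bar>Im s\<bar>"
          using s i by (intro add_mono) (auto simp: mult_le_cancel_right1)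
        finally show "norm ((s - of_nat i) / (of_nat k - of_nat i)) \<le> ?R * (1 + \<bar>Im s\<bar>)" by (simp add: algebra_simps)
      qed auto
      also have "\<dots> = (?R * (1 + \<bar>Im s\<bar>)) ^ card ({..<n}-{k})" by simp
      also have "\<dots> \<le> (?R * (1 + \<bar>Im s\<bar>)) ^ n"
      proof (intro power_increasing)
        show "card ({..<n}-{k}) \<le> n" by (metis card_Diff1_le card_lessThan finite_lessThan)
        have "1 * 1 \<le> ?R * (1 + \<bar>Im s\<bar>)" by (intro mult_mono) auto
        then show "1 \<le> ?R * (1 + \<bar>Im s\<bar>)" by simp
      qed
      finally show ?thesis .
    qed
    then have "norm (lagrange M K \<nu> \<nu>' n x s) \<le> (\<Sum>k<n. ?c k * (?R * (1 + \<bar>Im s\<bar>)) ^ n)"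
      unfolding lagrange_def
      by (intro order_trans[OF norm_sum] sum_mono) (simp add: norm_mult mult_left_mono)
    then show ?thesis by (simp only: power_mult_distrib sum_distrib_right mult.assoc)
  qed
  moreover have "(\<Sum>k<n. ?c k * ?R ^ n) \<ge> 0" by (intro sum_nonneg) auto
  ultimately show ?thesis using that by blast
qed

lemma line_integrand_bound:
  assumes "M \<ge> 1"
  obtains B where "\<And>s. - 1/2 \<le> Re s \<Longrightarrow> Re s \<le> real n - 1/2 \<Longrightarrow> norm (line_integrand M K \<nu> \<nu>' n x y s) \<le> B / (1 + (Im s)\<^sup>2)"
proof -
  \<comment> \<open>Order n + 2: n pays for the interpolation polynomial and 2 is left for
    integrability.\<close>
  obtain B1 where 1: "B1 \<ge> 0" "\<And>s. - 1/2 \<le> Re s \<Longrightarrow> Re s \<le> real n - 1/2 \<Longrightarrow> norm (gamprod M K \<nu> \<nu>' n s) * (1 + \<bar>Im s\<bar>) ^ (n + 2) \<le> B1"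
    using decays_gamprod[OF assms, of n "n + 2" K \<nu> \<nu>'] unfolding decays_def by blast
  obtain B2 where 2: "B2 \<ge> 0" "\<And>s. - 1/2 \<le> Re s \<Longrightarrow> Re s \<le> real n - 1/2 \<Longrightarrow> norm (lagrange M K \<nu> \<nu>' n x s) \<le> B2 * (1 + \<bar>Im s\<bar>) ^ n"
    using norm_lagrange_le[of n M K \<nu> \<nu>' x] by blast
  define B3 where "B3 = exp ((real n + 1) * \<bar>ln y\<bar>)"
  have "norm (line_integrand M K \<nu> \<nu>' n x y s) \<le> B1 * B3 * B2 / (1 + (Im s)\<^sup>2)" if s: "- 1/2 \<le> Re s" "Re s \<le> real n - 1/2" for s
  proof -
    define w where "w = 1 + \<bar>Im s\<bar>"
    have w: "w \<ge> 1" by (simp add: w_def)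
    have "(- Re s - 1) * ln y \<le> \<bar>- Re s - 1\<bar> * \<bar>ln y\<bar>" by (metis abs_ge_self abs_mult)
    also have "\<dots> \<le> (real n + 1) * \<bar>ln y\<bar>" using s by (intro mult_right_mono) auto
    finally have 3: "norm (cpow y (- s - 1)) \<le> B3" by (simp add: norm_cpow B3_def)
    have "norm (line_integrand M K \<nu> \<nu>' n x y s) * w ^ (n + 2) = (norm (gamprod M K \<nu> \<nu>' n s) * w ^ (n + 2)) * norm (cpow y (- s - 1)) * norm (lagrange M K \<nu> \<nu>' n x s)"
      by (simp add: line_integrand_def norm_mult)
    also have "\<dots> \<le> B1 * B3 * (B2 * w ^ n)"
      using 1(1) 1(2)[of s] 2(1) 2(2)[of s] 3 s w by (intro mult_mono) (auto simp: w_def B3_def simp del: power_Suc)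
    finally have "(norm (line_integrand M K \<nu> \<nu>' n x y s) * w\<^sup>2) * w ^ n \<le> (B1 * B3 * B2) * w ^ n"
      by (simp only: power_add mult_ac)
    then have "norm (line_integrand M K \<nu> \<nu>' n x y s) * w\<^sup>2 \<le> B1 * B3 * B2"
      using w by (simp add: mult_le_cancel_right)
    moreover have "1 + (Im s)\<^sup>2 \<le> w\<^sup>2" by (simp add: w_def power2_eq_square algebra_simps)
    then have "norm (line_integrand M K \<nu> \<nu>' n x y s) * (1 + (Im s)\<^sup>2) \<le> norm (line_integrand M K \<nu> \<nu>' n x y s) * w\<^sup>2"
      by (intro mult_left_mono) auto
    ultimately have "norm (line_integrand M K \<nu> \<nu>' n x y s) * (1 + (Im s)\<^sup>2) \<le> B1 * B3 * B2" by linarith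
    then show ?thesis by (simp add: pos_le_divide_eq add_pos_nonneg)
  qed
  then show ?thesis using that by blast
qed

lemma holomorphic_line_integrand: "line_integrand M K \<nu> \<nu>' n x y holomorphic_on {s. -1 < Re s \<and> Re s < real n}"
  unfolding line_integrand_def[abs_def] lagrange_def
  by (intro holomorphic_intros holomorphic_gamprod) auto

text \<open>For $s$ inside the rectangle the interpolation error differs from the contour integral by the residue at
  $t = s$. This residue alone produces the sine kernel; \<open>E\<close> is the remaining double integral.\<close>

definition rect :: "nat \<Rightarrow> real \<Rightarrow> real \<Rightarrow> complex" where
  "rect n B = rectpath (Complex (- 1/2) (- B)) (Complex (real n - 1/2) B)"

text \<open>On the new line the interpolation polynomial is expressed by the rectangle integral plus
  the residue at s, in which the Gamma products cancel and only x^s y^(-s-1) is left for |u| < B.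
  \<open>E\<close> is defined as a difference of integrable functions, so its integrability costs
  nothing; its formula may fail at u = 0, where the line can hit a node, and at |u| = B, where s
  lies on the rectangle.\<close>

lemma kernel_split:
  assumes "M \<ge> 1" "n \<ge> 1" "\<nu> 0 = 0" "x > 0" "y > 0" "encircling_contour n \<gamma>"
    and c: "- 1/2 < c" "c < real n - 1/2" and B: "B > 0"
  obtains E where "integrable lborel E"
    "correlation_kernel M K \<nu> \<nu>' n \<gamma> x y = 1 / (2 * of_real pi) *
       ((LINT u|lborel. indicator {- B..B} u *\<^sub>R (cpow x (Complex c u) * cpow y (- Complex c u - 1))) + (LINT u|lborel. E u))"
    "\<And>u. u \<noteq> 0 \<Longrightarrow> \<bar>u\<bar> \<noteq> B \<Longrightarrow> E u = gamprod M K \<nu> \<nu>' n (Complex c u) * nodepoly n (Complex c u) * cpow y (- Complex c u - 1) / (2 * pi * \<i>)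
       * contour_integral (rect n B) (\<lambda>t. rgamprod M K \<nu> \<nu>' n t * cpow x t / (nodepoly n t * (Complex c u - t)))"
proof -
  let ?L = "line_integrand M K \<nu> \<nu>' n x y"
  obtain C where C: "\<And>s. - 1/2 \<le> Re s \<Longrightarrow> Re s \<le> real n - 1/2 \<Longrightarrow> norm (?L s) \<le> C / (1 + (Im s)\<^sup>2)"
    using line_integrand_bound[OF assms(1), of n K \<nu> \<nu>' x y] by blast
  define m where "m u = cpow x (Complex c u) * cpow y (- Complex c u - 1)" for u
  define E where "E u = ?L (Complex c u) - indicator {- B..B} u *\<^sub>R m u" for u
  have shift: "(LINT u|lborel. ?L (Complex (- 1/2) u)) = (LINT u|lborel. ?L (Complex c u))"
    by (rule line_shift[OF holomorphic_line_integrand, where B = C]) (use c assms C in auto)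
  have iL: "integrable lborel (\<lambda>u. ?L (Complex c u))"
  proof (rule line_integrable[OF holomorphic_line_integrand, where B = C])
    show "norm (?L (Complex c u)) \<le> C / (1 + u\<^sup>2)" for u using C[of "Complex c u"] c by simp
  qed (use c in auto)
  have "continuous_on {- B..B} m"
    unfolding m_def cpow_def Complex_eq by (intro continuous_intros)
  then have im: "integrable lborel (\<lambda>u. indicator {- B..B} u *\<^sub>R m u)"
    by (intro borel_integrable_compact) auto
  have iE: "integrable lborel E" unfolding E_def by (intro Bochner_Integration.integrable_diff iL im)
  have "(LINT u|lborel. E u) = (LINT u|lborel. ?L (Complex c u)) - (LINT u|lborel. indicator {- B..B} u *\<^sub>R m u)"
    unfolding E_def by (rule Bochner_Integration.integral_diff[OF iL im])
  then have "correlation_kernel M K \<nu> \<nu>' n \<gamma> x y = 1 / (2 * of_real pi) *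
       ((LINT u|lborel. indicator {- B..B} u *\<^sub>R m u) + (LINT u|lborel. E u))"
    using correlation_kernel_eq[where M = M and K = K and \<nu> = \<nu> and \<nu>' = \<nu>', OF assms(3-6)] shift by simp
  moreover have "E u = gamprod M K \<nu> \<nu>' n (Complex c u) * nodepoly n (Complex c u) * cpow y (- Complex c u - 1) / (2 * pi * \<i>)
       * contour_integral (rect n B) (\<lambda>t. rgamprod M K \<nu> \<nu>' n t * cpow x t / (nodepoly n t * (Complex c u - t)))"
    if u: "u \<noteq> 0" "\<bar>u\<bar> \<noteq> B" for u
  proof -
    define s where "s = Complex c u"
    let ?a1 = "Complex (- 1/2) (- B)" and ?a3 = "Complex (real n - 1/2) B"
    have pi: "path_image (rect n B) = cbox ?a1 ?a3 - box ?a1 ?a3"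
      unfolding rect_def using assms B by (intro path_image_rectpath_cbox_minus_box) auto
    have inb: "of_nat k \<in> box ?a1 ?a3" if "k < n" for k
      using that B by (auto simp: in_box_complex_iff)
    have sn: "s \<notin> of_nat ` {..<n}" using u by (auto simp: s_def complex_eq_iff)
    have sp: "s \<notin> path_image (rect n B)"
      unfolding pi using u c by (auto simp: in_box_complex_iff in_cbox_complex_iff s_def)
    have w: "winding_number (rect n B) s = indicator {- B..B} u"
    proof (cases "\<bar>u\<bar> < B")
      case True
      then have "s \<in> box ?a1 ?a3" using c by (auto simp: in_box_complex_iff s_def)
      then have "winding_number (rect n B) s = 1" unfolding rect_def by (rule winding_number_rectpath)
      then show ?thesis using True by (auto simp: indicator_def)
    next
      case False
      then have "s \<notin> cbox ?a1 ?a3" using u by (auto simp: in_cbox_complex_iff s_def)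
      then have "winding_number (rect n B) s = 0" unfolding rect_def using assms B
        by (intro winding_number_rectpath_outside) auto
      then show ?thesis using False u by (auto simp: indicator_def)
    qed
    have main: "nodepoly n s * contour_integral (rect n B) (\<lambda>t. rgamprod M K \<nu> \<nu>' n t * cpow x t / (nodepoly n t * (s - t)))
      = 2 * pi * \<i> * (lagrange M K \<nu> \<nu>' n x s - winding_number (rect n B) s * (rgamprod M K \<nu> \<nu>' n s * cpow x s))"
    proof (rule contour_integral_lagrange)
      show "of_nat k \<notin> path_image (rect n B)" if "k < n" for k using inb[OF that] pi by auto
      show "winding_number (rect n B) (of_nat k) = 1" if "k < n" for k
        unfolding rect_def using inb[OF that] by (rule winding_number_rectpath)
    qed (use sn sp in \<open>auto simp: rect_def\<close>)
    have g: "gamprod M K \<nu> \<nu>' n s * rgamprod M K \<nu> \<nu>' n s = 1"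
      using gamprod_nz[of s n M K \<nu> \<nu>'] c by (simp add: rgamprod_eq_inverse s_def)
    have "gamprod M K \<nu> \<nu>' n s * nodepoly n s * cpow y (- s - 1) / (2 * pi * \<i>)
       * contour_integral (rect n B) (\<lambda>t. rgamprod M K \<nu> \<nu>' n t * cpow x t / (nodepoly n t * (s - t)))
      = gamprod M K \<nu> \<nu>' n s * cpow y (- s - 1) / (2 * pi * \<i>) *
        (nodepoly n s * contour_integral (rect n B) (\<lambda>t. rgamprod M K \<nu> \<nu>' n t * cpow x t / (nodepoly n t * (s - t))))"
      by simp
    also have "\<dots> = gamprod M K \<nu> \<nu>' n s * cpow y (- s - 1) * (lagrange M K \<nu> \<nu>' n x s - indicator {- B..B} u * (rgamprod M K \<nu> \<nu>' n s * cpow x s))"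
    proof -
      have q: "p / z * (z * r) = p * r" if "z \<noteq> 0" for p r z :: complex using that by simp
      show ?thesis unfolding main w by (rule q) simp
    qed
    also have "\<dots> = line_integrand M K \<nu> \<nu>' n x y s - (gamprod M K \<nu> \<nu>' n s * rgamprod M K \<nu> \<nu>' n s) * (indicator {- B..B} u * (cpow x s * cpow y (- s - 1)))"
      by (simp add: line_integrand_def algebra_simps)
    also have "\<dots> = E u" unfolding g by (simp add: E_def m_def s_def indicator_def)
    finally show ?thesis by (simp add: s_def)
  qed
  ultimately show ?thesis using that iE unfolding m_def by blast
qed

section \<open>Integrals over the rectangle\<close>

lemma contour_integral_horizontal_le:
  assumes "a < b" "continuous_on {a..b} (\<lambda>x. F (Complex x v))"
    and "(g has_integral J) {a..b}" "\<And>x. x \<in> {a..b} \<Longrightarrow> x \<noteq> c \<Longrightarrow> norm (F (Complex x v)) \<le> g x"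
  shows "norm (contour_integral (linepath (Complex a v) (Complex b v)) F) \<le> J"
proof -
  define f where "f x = F (Complex x v)" for x
  have e: "contour_integral (linepath (Complex a v) (Complex b v)) F = integral {a..b} f"
  proof (rule contour_integral_unique)
    have "((\<lambda>\<tau>. (b - a) *\<^sub>R f (a + \<tau> * (b - a))) has_integral integral {a + 0 * (b - a)..a + 1 * (b - a)} f) {0..1}"
    proof (rule has_integral_substitution[where c = a and d = b])
      show "(\<lambda>\<tau>. a + \<tau> * (b - a)) ` {0..1} \<subseteq> {a..b}"
      proof safe
        fix \<tau> :: real assume "\<tau> \<in> {0..1}"
        then have "0 \<le> \<tau> * (b - a)" "\<tau> * (b - a) \<le> 1 * (b - a)" using assms(1) by (auto intro!: mult_right_mono)
        then show "a + \<tau> * (b - a) \<in> {a..b}" by auto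
      qed
      show "continuous_on {a..b} f" unfolding f_def by (rule assms(2))
      show "((\<lambda>\<tau>. a + \<tau> * (b - a)) has_field_derivative (b - a)) (at x within {0..1})" for x
        by (auto intro!: derivative_eq_intros)
    qed (use assms in auto)
    moreover have "(b - a) *\<^sub>R f (a + \<tau> * (b - a)) = F (linepath (Complex a v) (Complex b v) \<tau>) * (Complex b v - Complex a v)" for \<tau>
    proof -
      have "linepath (Complex a v) (Complex b v) \<tau> = Complex (a + \<tau> * (b - a)) v"
        by (simp add: linepath_def complex_eq_iff algebra_simps)
      moreover have "Complex b v - Complex a v = of_real (b - a)" by (simp add: complex_eq_iff)
      ultimately show ?thesis by (simp add: f_def scaleR_conv_of_real mult_ac)
    qed
    ultimately show "(F has_contour_integral integral {a..b} f) (linepath (Complex a v) (Complex b v))"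
      by (simp add: has_contour_integral_linepath)
  qed
  \<comment> \<open>The majorant need not hold at c. In the application it has the form 1 / sqrt |x
    - a| with the default value 0 at the singularity; changing it at one point leaves its integral
    unchanged.\<close>
  define g' where "g' x = (if x = c then norm (f c) else g x)" for x
  have g': "(g' has_integral J) {a..b}"
    by (rule has_integral_spike_finite[OF _ _ assms(3), of "{c}"]) (auto simp: g'_def)
  have "norm (integral {a..b} f) \<le> integral {a..b} g'"
  proof (rule integral_norm_bound_integral)
    show "f integrable_on {a..b}" unfolding f_def by (rule integrable_continuous_real[OF assms(2)])
    show "g' integrable_on {a..b}" using g' by blast
    show "norm (f x) \<le> g' x" if "x \<in> {a..b}" for x using assms(4)[OF that] by (auto simp: g'_def f_def)
  qed
  then show ?thesis using e g' by (simp add: integral_unique)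
qed

text \<open>The saddle points lie on the horizontal edges, which therefore get integrable majorants;
  for the two sides of length 2B a uniform bound is enough.\<close>

lemma contour_integral_rect_le:
  assumes "n \<ge> 1" "B > 0" "continuous_on (path_image (rect n B)) F"
    and "(g1 has_integral J1) {- 1/2..real n - 1/2}" "\<And>x. - 1/2 \<le> x \<Longrightarrow> x \<le> real n - 1/2 \<Longrightarrow> x \<noteq> c \<Longrightarrow> norm (F (Complex x B)) \<le> g1 x"
    and "(g2 has_integral J2) {- 1/2..real n - 1/2}" "\<And>x. - 1/2 \<le> x \<Longrightarrow> x \<le> real n - 1/2 \<Longrightarrow> x \<noteq> c \<Longrightarrow> norm (F (Complex x (- B))) \<le> g2 x"
    and "L \<ge> 0" "\<And>v. \<bar>v\<bar> \<le> B \<Longrightarrow> norm (F (Complex (- 1/2) v)) \<le> L" "\<And>v. \<bar>v\<bar> \<le> B \<Longrightarrow> norm (F (Complex (real n - 1/2) v)) \<le> L"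
  shows "norm (contour_integral (rect n B) F) \<le> J1 + J2 + 4 * B * L"
proof -
  define a1 a2 a3 a4 where "a1 = Complex (- 1/2) (- B)" and "a2 = Complex (real n - 1/2) (- B)"
    and "a3 = Complex (real n - 1/2) B" and "a4 = Complex (- 1/2) B"
  have rect: "rect n B = linepath a1 a2 +++ linepath a2 a3 +++ linepath a3 a4 +++ linepath a4 a1"
    by (simp add: rect_def rectpath_def Let_def a1_def a2_def a3_def a4_def)
  have "path_image (rect n B) = closed_segment a1 a2 \<union> (closed_segment a2 a3 \<union> (closed_segment a3 a4 \<union> closed_segment a4 a1))"
    unfolding rect by (simp add: path_image_join)
  then have cont: "continuous_on (closed_segment a1 a2) F" "continuous_on (closed_segment a2 a3) F"
    "continuous_on (closed_segment a3 a4) F" "continuous_on (closed_segment a4 a1) F"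
    using assms(3) by (auto elim!: continuous_on_subset)
  note ci = cont[THEN contour_integrable_continuous_linepath]
  have eq: "contour_integral (rect n B) F = contour_integral (linepath a1 a2) F + (contour_integral (linepath a2 a3) F
     + (contour_integral (linepath a3 a4) F + contour_integral (linepath a4 a1) F))"
    unfolding rect using ci by (simp add: contour_integral_join contour_integrable_joinI)
  have hseg: "closed_segment (Complex a v) (Complex b v) = (\<lambda>x. Complex x v) ` {a..b}" if "a \<le> b" for a b v
  proof -
    have "closed_segment (Complex a v) (Complex b v) = {z. Im z = v \<and> Re z \<in> {a..b}}"
      using closed_segment_same_Im[of "Complex a v" "Complex b v"] that by (simp add: closed_segment_eq_real_ivl)
    also have "\<dots> = (\<lambda>x. Complex x v) ` {a..b}"
    proof safe
      fix z assume "v = Im z" "Re z \<in> {a..b}"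
      then show "z \<in> (\<lambda>x. Complex x (Im z)) ` {a..b}" by (intro image_eqI[of _ _ "Re z"]) auto
    qed auto
    finally show ?thesis .
  qed
  have ch: "continuous_on {- 1/2..real n - 1/2} (\<lambda>x. F (Complex x v))" if "v = B \<or> v = - B" for v
  proof -
    have "continuous_on (closed_segment (Complex (- 1/2) v) (Complex (real n - 1/2) v)) F"
      using that cont(1,3) by (auto simp: a1_def a2_def a3_def a4_def closed_segment_commute)
    then show ?thesis
    proof (rule continuous_on_compose2)
      show "continuous_on {- 1/2..real n - 1/2} (\<lambda>x. Complex x v)"
        unfolding Complex_eq by (intro continuous_intros)
      show "(\<lambda>x. Complex x v) ` {- 1/2..real n - 1/2} \<subseteq> closed_segment (Complex (- 1/2) v) (Complex (real n - 1/2) v)"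
        using assms(1) by (subst hseg) auto
    qed
  qed
  have 1: "norm (contour_integral (linepath a1 a2) F) \<le> J2"
    unfolding a1_def a2_def by (rule contour_integral_horizontal_le[OF _ ch assms(6), of _ c]) (use assms in auto)
  have "contour_integral (linepath a3 a4) F = - contour_integral (linepath a4 a3) F"
    using contour_integral_reversepath[of "linepath a4 a3" F] by simp
  moreover have "norm (contour_integral (linepath a4 a3) F) \<le> J1"
    unfolding a3_def a4_def by (rule contour_integral_horizontal_le[OF _ ch assms(4), of _ c]) (use assms in auto)
  ultimately have 3: "norm (contour_integral (linepath a3 a4) F) \<le> J1" by simp
  have 2: "norm (contour_integral (linepath a2 a3) F) \<le> L * norm (a3 - a2)"
  proof (rule contour_integral_bound_linepath[OF ci(2) assms(8)])
    fix z assume "z \<in> closed_segment a2 a3"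
    then have "z = Complex (real n - 1/2) (Im z)" "\<bar>Im z\<bar> \<le> B"
      using closed_segment_same_Re[of a2 a3] assms(2) by (auto simp: a2_def a3_def complex_eq_iff closed_segment_eq_real_ivl)
    then show "norm (F z) \<le> L" using assms(10)[of "Im z"] by simp
  qed
  have 4: "norm (contour_integral (linepath a4 a1) F) \<le> L * norm (a1 - a4)"
  proof (rule contour_integral_bound_linepath[OF ci(4) assms(8)])
    fix z assume "z \<in> closed_segment a4 a1"
    then have "z = Complex (- 1/2) (Im z)" "\<bar>Im z\<bar> \<le> B"
      using closed_segment_same_Re[of a4 a1] assms(2) by (auto simp: a1_def a4_def complex_eq_iff closed_segment_eq_real_ivl)
    then show "norm (F z) \<le> L" using assms(9)[of "Im z"] by simp
  qed
  have "a3 - a2 = \<i> * of_real (2 * B)" "a1 - a4 = - (\<i> * of_real (2 * B))"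
    by (simp_all add: a1_def a2_def a3_def a4_def complex_eq_iff)
  then have "norm (a3 - a2) = 2 * B" "norm (a1 - a4) = 2 * B"
    using assms(2) by (simp_all add: norm_mult)
  then have "L * norm (a3 - a2) + L * norm (a1 - a4) = 4 * B * L" by simp
  moreover have "norm (contour_integral (rect n B) F) \<le> norm (contour_integral (linepath a1 a2) F) + (norm (contour_integral (linepath a2 a3) F)
     + (norm (contour_integral (linepath a3 a4) F) + norm (contour_integral (linepath a4 a1) F)))"
    unfolding eq by (intro norm_triangle_le add_mono order_refl)
  ultimately show ?thesis using 1 2 3 4 by linarith
qed

section \<open>Estimating the remaining double integral\<close>

text \<open>The factor |z|^\<alpha> |1-z|^\<beta> that Stirling's formula leaves in front of the
  exponential. The exponents can have either sign.\<close>

definition wt :: "real \<Rightarrow> real \<Rightarrow> real \<Rightarrow> real \<Rightarrow> real" where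
  "wt \<alpha> \<beta> x v = norm (Complex x v) powr \<alpha> * norm (Complex (1 - x) v) powr \<beta>"

lemma wt_minus [simp]: "wt \<alpha> \<beta> x (- v) = wt \<alpha> \<beta> x v"
  by (simp add: wt_def cmod_def)

lemma wt_swap: "wt \<alpha> \<beta> (1 - x) v = wt \<beta> \<alpha> x v"
  by (simp add: wt_def mult.commute)

text \<open>A power is monotone, so it is at most the larger of its end values; the sum avoids a
  case distinction on the sign of the exponent.\<close>

lemma powr_between:
  fixes r :: real
  assumes "0 < r0" "r0 \<le> r" "r \<le> r1"
  shows "r powr \<alpha> \<le> r0 powr \<alpha> + r1 powr \<alpha>"
proof (cases "\<alpha> \<ge> 0")
  case True
  then have "r powr \<alpha> \<le> r1 powr \<alpha>" using assms by (intro powr_mono2) auto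
  then show ?thesis by (meson add_increasing powr_ge_zero)
next
  case False
  then have "r powr \<alpha> \<le> r0 powr \<alpha>" using assms by (intro powr_mono2') auto
  then show ?thesis by (meson add_increasing2 powr_ge_zero)
qed

lemma exp_minus_abs_le: "exp (- \<bar>v\<bar>) \<le> 2 / (1 + v\<^sup>2)" for v :: real
proof -
  have "1 + v\<^sup>2 \<le> 2 * exp \<bar>v\<bar>"
    using exp_lower_Taylor_quadratic[of "\<bar>v\<bar>"] by (simp add: power2_eq_square)
  then show ?thesis by (simp add: exp_minus divide_simps add_pos_nonneg mult.commute)
qed

lemma norm_Complex_bounds:
  "\<bar>x\<bar> \<le> norm (Complex x v)" "\<bar>v\<bar> \<le> norm (Complex x v)" "norm (Complex x v) \<le> \<bar>x\<bar> + \<bar>v\<bar>"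
  using abs_Re_le_cmod[of "Complex x v"] abs_Im_le_cmod[of "Complex x v"] cmod_le[of "Complex x v"] by auto

lemma norm_Complex_powr_le:
  assumes "0 < x" "x \<le> 1"
  shows "norm (Complex x v) powr \<alpha> \<le> (x powr \<alpha> + 1) * exp (\<bar>\<alpha>\<bar> * \<bar>v\<bar>)"
proof -
  have "norm (Complex x v) \<le> 1 + \<bar>v\<bar>" using norm_Complex_bounds(3)[of x v] assms by simp
  also have "\<dots> \<le> exp \<bar>v\<bar>" by (rule exp_ge_add_one_self)
  finally have "norm (Complex x v) powr \<alpha> \<le> x powr \<alpha> + exp \<bar>v\<bar> powr \<alpha>"
    using norm_Complex_bounds(1)[of x v] assms by (intro powr_between) auto
  also have "exp \<bar>v\<bar> powr \<alpha> = exp (\<alpha> * \<bar>v\<bar>)" by (simp add: powr_def)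
  also have "\<dots> \<le> exp (\<bar>\<alpha>\<bar> * \<bar>v\<bar>)" by (simp add: mult_right_mono)
  also have "x powr \<alpha> \<le> x powr \<alpha> * exp (\<bar>\<alpha>\<bar> * \<bar>v\<bar>)" by (simp add: mult_le_cancel_left1)
  finally show ?thesis by (simp add: algebra_simps)
qed

context saddle
begin

text \<open>The weight grows at most like exp((|\<alpha>| + |\<beta>|) |v|). With m one larger and N
  >= \<open>N0\<close> = m / \<open>slope\<close>, the phase contributes a multiple of exp(-m |v|),
  so exp(-|v|) survives. Replacing N by \<open>N0\<close> is legitimate as the phase difference is
  never positive.\<close>

lemma vertical_bound:
  obtains C N0 where "C > 0" "N0 > 0"
    "\<And>N v. N \<ge> N0 \<Longrightarrow> wt \<alpha> \<beta> a v * exp (N * (phase p q l a v - phase p q l a b)) \<le> C / (1 + v\<^sup>2)"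
proof -
  define m where "m = \<bar>\<alpha>\<bar> + \<bar>\<beta>\<bar> + 1"
  define N0 where "N0 = m / slope"
  define C0 where "C0 = (a powr \<alpha> + 1) * ((1 - a) powr \<beta> + 1)"
  have m: "m > 0" and N0: "N0 > 0" using slope_pos by (auto simp: m_def N0_def)
  have C0: "C0 > 0" unfolding C0_def by (intro mult_pos_pos add_nonneg_pos) auto
  have "wt \<alpha> \<beta> a v * exp (N * (phase p q l a v - phase p q l a b)) \<le> (2 * C0 * exp (2 * b * m)) / (1 + v\<^sup>2)" if N: "N \<ge> N0" for N v
  proof -
    have "wt \<alpha> \<beta> a v \<le> ((a powr \<alpha> + 1) * exp (\<bar>\<alpha>\<bar> * \<bar>v\<bar>)) * (((1 - a) powr \<beta> + 1) * exp (\<bar>\<beta>\<bar> * \<bar>v\<bar>))"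
      unfolding wt_def using a0 a1 by (intro mult_mono norm_Complex_powr_le) auto
    also have "\<dots> = C0 * exp ((m - 1) * \<bar>v\<bar>)"
      by (simp add: C0_def m_def algebra_simps exp_add)
    finally have W: "wt \<alpha> \<beta> a v \<le> C0 * exp ((m - 1) * \<bar>v\<bar>)" .
    have "N * (phase p q l a v - phase p q l a b) \<le> N0 * (phase p q l a v - phase p q l a b)"
      using phase_vertical_max[of v] N by (intro mult_right_mono_neg) auto
    also have "\<dots> \<le> N0 * (slope * (2 * b - \<bar>v\<bar>))"
      using phase_vertical_decay[of v] N0 by (intro mult_left_mono) auto
    also have "\<dots> = m * (2 * b - \<bar>v\<bar>)" using slope_pos by (simp add: N0_def)
    finally have "wt \<alpha> \<beta> a v * exp (N * (phase p q l a v - phase p q l a b)) \<le> (C0 * exp ((m - 1) * \<bar>v\<bar>)) * exp (m * (2 * b - \<bar>v\<bar>))"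
      using W C0 by (intro mult_mono) auto
    also have "\<dots> = C0 * exp (2 * b * m) * exp (- \<bar>v\<bar>)"
    proof -
      have "(m - 1) * \<bar>v\<bar> + m * (2 * b - \<bar>v\<bar>) = 2 * b * m + (- \<bar>v\<bar>)" by (simp add: algebra_simps)
      then have "exp ((m - 1) * \<bar>v\<bar>) * exp (m * (2 * b - \<bar>v\<bar>)) = exp (2 * b * m) * exp (- \<bar>v\<bar>)" by (metis exp_add)
      then show ?thesis by simp
    qed
    also have "\<dots> \<le> C0 * exp (2 * b * m) * (2 / (1 + v\<^sup>2))"
      using C0 by (intro mult_left_mono exp_minus_abs_le) auto
    finally show ?thesis by (simp add: mult_ac)
  qed
  then show ?thesis using that[of "2 * C0 * exp (2 * b * m)" N0] C0 N0 by auto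
qed

text \<open>At height b both moduli stay between b and 1 + b.\<close>

lemma horizontal_weight:
  obtains C where "C > 0" "\<And>x. 0 < x \<Longrightarrow> x < 1 \<Longrightarrow> inverse (wt \<alpha> \<beta> x b) \<le> C"
proof -
  define C where "C = (b powr (- \<alpha>) + (1 + b) powr (- \<alpha>)) * (b powr (- \<beta>) + (1 + b) powr (- \<beta>))"
  have "inverse (wt \<alpha> \<beta> x b) \<le> C" if x: "0 < x" "x < 1" for x
  proof -
    have "norm (Complex x b) powr (- \<alpha>) \<le> b powr (- \<alpha>) + (1 + b) powr (- \<alpha>)"
      "norm (Complex (1 - x) b) powr (- \<beta>) \<le> b powr (- \<beta>) + (1 + b) powr (- \<beta>)"
      using x b0 norm_Complex_bounds[where x = x and v = b] norm_Complex_bounds[where x = "1 - x" and v = b] by (auto intro!: powr_between)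
    then have "norm (Complex x b) powr (- \<alpha>) * norm (Complex (1 - x) b) powr (- \<beta>) \<le> C"
      unfolding C_def using b0 by (intro mult_mono) (auto intro!: add_nonneg_nonneg)
    then show ?thesis by (simp add: wt_def powr_minus inverse_mult_distrib)
  qed
  moreover have "C > 0" unfolding C_def using b0 by (intro mult_pos_pos add_pos_pos) auto
  ultimately show ?thesis using that by blast
qed

text \<open>Near the corner 0 the inverse weight can blow up, but only like a power of x. With x of
  order 1/N this is a power of N, which the exponential gain on the sides defeats.\<close>

lemma side_weight:
  obtains C where "C > 0" "\<And>x v. 0 < x \<Longrightarrow> x \<le> 1/2 \<Longrightarrow> \<bar>v\<bar> \<le> b \<Longrightarrow> inverse (wt \<alpha> \<beta> x v) \<le> C * x powr (- \<bar>\<alpha>\<bar>)"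
proof -
  define C where "C = (1 + (1 + b) powr (- \<alpha>)) * ((1/2) powr (- \<beta>) + (1 + b) powr (- \<beta>))"
  have "inverse (wt \<alpha> \<beta> x v) \<le> C * x powr (- \<bar>\<alpha>\<bar>)" if x: "0 < x" "x \<le> 1/2" and v: "\<bar>v\<bar> \<le> b" for x v
  proof -
    have xp: "1 \<le> x powr (- \<bar>\<alpha>\<bar>)"
      using powr_mono'[of "- \<bar>\<alpha>\<bar>" 0 x] x by simp
    have "norm (Complex x v) powr (- \<alpha>) \<le> x powr (- \<alpha>) + (1 + b) powr (- \<alpha>)"
      using x v norm_Complex_bounds[where x = x and v = v] by (intro powr_between) auto
    also have "x powr (- \<alpha>) \<le> x powr (- \<bar>\<alpha>\<bar>)" using x by (intro powr_mono') auto
    also have "(1 + b) powr (- \<alpha>) \<le> (1 + b) powr (- \<alpha>) * x powr (- \<bar>\<alpha>\<bar>)" using xp b0 by (simp add: mult_le_cancel_left1)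
    finally have 1: "norm (Complex x v) powr (- \<alpha>) \<le> (1 + (1 + b) powr (- \<alpha>)) * x powr (- \<bar>\<alpha>\<bar>)" by (simp add: algebra_simps)
    have 2: "norm (Complex (1 - x) v) powr (- \<beta>) \<le> (1/2) powr (- \<beta>) + (1 + b) powr (- \<beta>)"
      using x v norm_Complex_bounds[where x = "1 - x" and v = v] by (intro powr_between) auto
    have "norm (Complex x v) powr (- \<alpha>) * norm (Complex (1 - x) v) powr (- \<beta>) \<le>
       ((1 + (1 + b) powr (- \<alpha>)) * x powr (- \<bar>\<alpha>\<bar>)) * ((1/2) powr (- \<beta>) + (1 + b) powr (- \<beta>))"
      using 1 2 by (intro mult_mono) (auto intro!: mult_nonneg_nonneg add_nonneg_nonneg)
    then show ?thesis by (simp add: wt_def powr_minus inverse_mult_distrib C_def mult_ac)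
  qed
  moreover have "C > 0" unfolding C_def using b0 by (intro mult_pos_pos add_pos_pos) auto
  ultimately show ?thesis using that by blast
qed

end

section \<open>Integrable square-root singularities\<close>

lemma integrable_inv_sqrt:
  fixes c r s :: real
  assumes "r \<le> s"
  shows "integrable lborel (\<lambda>x. indicator {r..s} x * (1 / sqrt \<bar>x - c\<bar>))"
proof -
  \<comment> \<open>The antiderivative 2 sgn(x-c) sqrt|x-c| is continuous across c, so the
    fundamental theorem applies with c as exceptional point.\<close>
  have "((\<lambda>x. 1 / sqrt \<bar>x - c\<bar>) has_integral (2 * sgn (s - c) * sqrt \<bar>s - c\<bar> - 2 * sgn (r - c) * sqrt \<bar>r - c\<bar>)) {r..s}"
  proof (rule fundamental_theorem_of_calculus_strong[of "{c}"])
    fix x assume x: "x \<in> {r..s} - {c}"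
    have "((\<lambda>x. 2 * sgn (x - c) * sqrt \<bar>x - c\<bar>) has_real_derivative 1 / sqrt \<bar>x - c\<bar>) (at x)"
    proof (cases "x > c")
      case True
      have "((\<lambda>x. x - c) has_real_derivative 1) (at x)"
        by (auto intro!: derivative_eq_intros)
      moreover have "(sqrt has_real_derivative inverse (sqrt (x - c)) / 2) (at (x - c))"
        using True by (intro DERIV_real_sqrt) simp
      ultimately have "((\<lambda>x. sqrt (x - c)) has_real_derivative inverse (sqrt (x - c)) / 2 * 1) (at x)"
        by (rule DERIV_chain2[rotated])
      then have "((\<lambda>x. 2 * sqrt (x - c)) has_real_derivative 2 * (inverse (sqrt (x - c)) / 2 * 1)) (at x)"
        by (rule DERIV_cmult)
      moreover have "2 * (inverse (sqrt (x - c)) / 2 * 1) = 1 / sqrt \<bar>x - c\<bar>"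
        using True by (simp add: inverse_eq_divide)
      ultimately have "((\<lambda>x. 2 * sqrt (x - c)) has_real_derivative 1 / sqrt \<bar>x - c\<bar>) (at x)"
        by (simp only:)
      moreover have "\<forall>\<^sub>F x in nhds x. 2 * sgn (x - c) * sqrt \<bar>x - c\<bar> = 2 * sqrt (x - c)"
        by (rule eventually_mono[OF eventually_nhds_in_open[of "{c<..}" x]]) (use True in auto)
      ultimately show ?thesis by (subst DERIV_cong_ev[OF refl _ refl]) auto
    next
      case False
      then have "x < c" using x by auto
      have "((\<lambda>x. c - x) has_real_derivative - 1) (at x)"
        by (auto intro!: derivative_eq_intros)
      moreover have "(sqrt has_real_derivative inverse (sqrt (c - x)) / 2) (at (c - x))"
        using \<open>x < c\<close> by (intro DERIV_real_sqrt) simp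
      ultimately have "((\<lambda>x. sqrt (c - x)) has_real_derivative inverse (sqrt (c - x)) / 2 * (- 1)) (at x)"
        by (rule DERIV_chain2[rotated])
      then have "((\<lambda>x. - 2 * sqrt (c - x)) has_real_derivative - 2 * (inverse (sqrt (c - x)) / 2 * (- 1))) (at x)"
        by (rule DERIV_cmult)
      moreover have "- 2 * (inverse (sqrt (c - x)) / 2 * (- 1)) = 1 / sqrt \<bar>x - c\<bar>"
        using \<open>x < c\<close> by (simp add: inverse_eq_divide)
      ultimately have "((\<lambda>x. - 2 * sqrt (c - x)) has_real_derivative 1 / sqrt \<bar>x - c\<bar>) (at x)"
        by (simp only:)
      moreover have "\<forall>\<^sub>F x in nhds x. 2 * sgn (x - c) * sqrt \<bar>x - c\<bar> = - 2 * sqrt (c - x)"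
        by (rule eventually_mono[OF eventually_nhds_in_open[of "{..<c}" x]]) (use \<open>x < c\<close> in auto)
      ultimately show ?thesis by (subst DERIV_cong_ev[OF refl _ refl]) auto
    qed
    then show "((\<lambda>x. 2 * sgn (x - c) * sqrt \<bar>x - c\<bar>) has_vector_derivative 1 / sqrt \<bar>x - c\<bar>) (at x)"
      by (simp add: has_real_derivative_iff_has_vector_derivative)
  next
    have e: "2 * sgn (x - c) * sqrt \<bar>x - c\<bar> = 2 * sqrt (max 0 (x - c)) - 2 * sqrt (max 0 (c - x))" for x
      by (auto simp: sgn_if)
    show "continuous_on {r..s} (\<lambda>x. 2 * sgn (x - c) * sqrt \<bar>x - c\<bar>)"
      unfolding e by (intro continuous_intros)
  qed (use assms in auto)
  then have "(\<lambda>x. 1 / sqrt \<bar>x - c\<bar>) integrable_on {r..s}" by blast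
  then have "(\<lambda>x. 1 / sqrt \<bar>x - c\<bar>) absolutely_integrable_on {r..s}"
    by (intro nonnegative_absolutely_integrable_1) auto
  then have "integrable lebesgue (\<lambda>x. indicator {r..s} x * (1 / sqrt \<bar>x - c\<bar>))"
    by (simp add: set_integrable_def)
  then show ?thesis by (subst (asm) integrable_completion) auto
qed

text \<open>The majorant of the s-integrand in the variable v = Im s / N: quadratic decay, a
  square-root singularity at each saddle height, and the term 1 for the sides of the
  rectangle.\<close>

definition sing_wt :: "real \<Rightarrow> real \<Rightarrow> real" where
  "sing_wt b v = 1 / (1 + v\<^sup>2) * (1 / sqrt \<bar>v - b\<bar> + 1 / sqrt \<bar>v + b\<bar> + 1)"

lemma sing_wt_nonneg: "sing_wt b v \<ge> 0"
  unfolding sing_wt_def by (intro mult_nonneg_nonneg add_nonneg_nonneg) auto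

lemma integrable_sing_wt: "integrable lborel (sing_wt b)"
proof -
  have 1: "integrable lborel (\<lambda>v. 1 / (1 + v\<^sup>2) * (1 / sqrt \<bar>v - c\<bar>))" for c :: real
  proof (rule Bochner_Integration.integrable_bound)
    \<comment> \<open>Within distance 1 of c the decay is dropped, farther away the square root
      is.\<close>
    show "integrable lborel (\<lambda>v. 1 / (1 + v\<^sup>2) + indicator {c - 1..c + 1} v * (1 / sqrt \<bar>v - c\<bar>))"
      by (intro Bochner_Integration.integrable_add integrable_inverse_square integrable_inv_sqrt) auto
    show "AE v in lborel. norm (1 / (1 + v\<^sup>2) * (1 / sqrt \<bar>v - c\<bar>)) \<le> norm (1 / (1 + v\<^sup>2) + indicator {c - 1..c + 1} v * (1 / sqrt \<bar>v - c\<bar>))"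
    proof (rule AE_I2)
      fix v :: real
      have v1: "0 \<le> 1 / (1 + v\<^sup>2)" "1 / (1 + v\<^sup>2) \<le> 1" by (simp_all add: pos_divide_le_eq add_pos_nonneg)
      have s0: "0 \<le> 1 / sqrt \<bar>v - c\<bar>" by simp
      have "1 / (1 + v\<^sup>2) * (1 / sqrt \<bar>v - c\<bar>) \<le> 1 / (1 + v\<^sup>2) + indicator {c - 1..c + 1} v * (1 / sqrt \<bar>v - c\<bar>)"
      proof (cases "v \<in> {c - 1..c + 1}")
        case True
        have "1 / (1 + v\<^sup>2) * (1 / sqrt \<bar>v - c\<bar>) \<le> 1 * (1 / sqrt \<bar>v - c\<bar>)"
          using v1 s0 by (intro mult_right_mono) auto
        also have "\<dots> = indicator {c - 1..c + 1} v * (1 / sqrt \<bar>v - c\<bar>)" using True by simp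
        finally show ?thesis using v1(1) by linarith
      next
        case False
        then have "1 \<le> sqrt \<bar>v - c\<bar>" by auto
        then have "1 / sqrt \<bar>v - c\<bar> \<le> 1" by simp
        then have "1 / (1 + v\<^sup>2) * (1 / sqrt \<bar>v - c\<bar>) \<le> 1 / (1 + v\<^sup>2) * 1"
          using v1 by (intro mult_left_mono) auto
        then show ?thesis using False by simp
      qed
      then show "norm (1 / (1 + v\<^sup>2) * (1 / sqrt \<bar>v - c\<bar>)) \<le> norm (1 / (1 + v\<^sup>2) + indicator {c - 1..c + 1} v * (1 / sqrt \<bar>v - c\<bar>))"
        using v1 s0 by simp
    qed
  qed simp
  have "integrable lborel (\<lambda>v. 1 / (1 + v\<^sup>2) * (1 / sqrt \<bar>v - b\<bar>) + 1 / (1 + v\<^sup>2) * (1 / sqrt \<bar>v - (- b)\<bar>) + 1 / (1 + v\<^sup>2))"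
    by (intro Bochner_Integration.integrable_add 1 integrable_inverse_square)
  then show ?thesis unfolding sing_wt_def[abs_def] by (simp add: distrib_left)
qed

context saddle
begin

text \<open>Majorant of the t-integrand on the horizontal edges as a function of x = Re z: an
  exponential that concentrates at a, times the square-root singularity there. Convergence of its
  integral to 0 is all that is needed, without a rate.\<close>

definition gauss_wt :: "real \<Rightarrow> real \<Rightarrow> real" where
  "gauss_wt N x = indicator {0<..<1} x * (exp (- N * (phase p q l x b - phase p q l a b)) * (1 / sqrt \<bar>x - a\<bar>))"

lemma gauss_wt_nonneg: "gauss_wt N x \<ge> 0"
  unfolding gauss_wt_def by auto

lemma gauss_wt_le:
  assumes "N \<ge> 0"
  shows "gauss_wt N x \<le> indicator {0..1} x * (1 / sqrt \<bar>x - a\<bar>)"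
proof (cases "0 < x \<and> x < 1")
  case True
  then have "exp (- N * (phase p q l x b - phase p q l a b)) \<le> 1"
    using phase_horizontal_min(1)[of x] assms by auto
  then have "exp (- N * (phase p q l x b - phase p q l a b)) * (1 / sqrt \<bar>x - a\<bar>) \<le> 1 * (1 / sqrt \<bar>x - a\<bar>)"
    by (intro mult_right_mono) auto
  then show ?thesis using True by (simp add: gauss_wt_def)
next
  case False
  then show ?thesis by (simp add: gauss_wt_def)
qed

lemma gauss_wt_measurable [measurable]: "gauss_wt N \<in> borel_measurable borel"
proof -
  have "(arctan :: real \<Rightarrow> real) \<in> borel_measurable borel"
    by (intro borel_measurable_continuous_onI continuous_intros)
  then have [measurable]: "(\<lambda>x. arctan (f x)) \<in> borel_measurable borel" if "f \<in> borel_measurable borel" for f :: "real \<Rightarrow> real"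
    using that by (rule measurable_compose[rotated])
  show ?thesis unfolding gauss_wt_def[abs_def] phase_def re_zlnz_def by measurable
qed

lemma gauss_wt_integrable:
  assumes "N \<ge> 0"
  shows "integrable lborel (gauss_wt N)"
proof (rule Bochner_Integration.integrable_bound[OF integrable_inv_sqrt[of 0 1 a]])
  show "AE x in lborel. norm (gauss_wt N x) \<le> norm (indicator {0..1} x * (1 / sqrt \<bar>x - a\<bar>))"
    using gauss_wt_le[OF assms] gauss_wt_nonneg[of N] by (auto intro!: AE_I2 order_trans[OF _ abs_ge_self])
qed auto

lemma gauss_wt_integral_tendsto: "(\<lambda>n. LINT x|lborel. gauss_wt (real n + 5) x) \<longlonglongrightarrow> 0"
proof -
  have "(\<lambda>n. LINT x|lborel. gauss_wt (real n + 5) x) \<longlonglongrightarrow> (LINT x::real|lborel. (0::real))"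
  proof (rule integral_dominated_convergence[where s = "\<lambda>n. gauss_wt (real n + 5)" and f = "\<lambda>_. 0"
        and w = "\<lambda>x. indicator {0..1} x * (1 / sqrt \<bar>x - a\<bar>)"])
    show "integrable lborel (\<lambda>x. indicator {0..1} x * (1 / sqrt \<bar>x - a\<bar>))"
      by (rule integrable_inv_sqrt) simp
    show "AE x in lborel. norm (gauss_wt (real n + 5) x) \<le> indicator {0..1} x * (1 / sqrt \<bar>x - a\<bar>)" for n
      using gauss_wt_le[of "real n + 5"] gauss_wt_nonneg[of "real n + 5"] by (auto intro!: AE_I2)
    show "AE x in lborel. (\<lambda>n. gauss_wt (real n + 5) x) \<longlonglongrightarrow> 0"
    proof (rule AE_I2)
      fix x :: real
      show "(\<lambda>n. gauss_wt (real n + 5) x) \<longlonglongrightarrow> 0"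
      proof (cases "0 < x \<and> x < 1 \<and> x \<noteq> a")
        case True
        define d where "d = phase p q l x b - phase p q l a b"
        have "d > 0" using phase_horizontal_min(2)[of x] True by (simp add: d_def)
        then have "(\<lambda>n. exp (- (real n + 5) * d)) \<longlonglongrightarrow> 0" by real_asymp
        then have "(\<lambda>n. exp (- (real n + 5) * d) * (1 / sqrt \<bar>x - a\<bar>)) \<longlonglongrightarrow> 0"
          by (rule tendsto_mult_left_zero)
        then show ?thesis using True by (simp add: gauss_wt_def d_def)
      next
        \<comment> \<open>At x = a the default value of 1 / sqrt 0 is 0, so the pointwise limit is 0
          there as well.\<close>
        case False
        then show ?thesis by (auto simp: gauss_wt_def)
      qed
    qed
  qed auto
  then show ?thesis by simp
qed

text \<open>Passing from z back to t multiplies the integral by N, which will cancel the 1/N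
  contained in 1/|s-t|.\<close>

lemma gauss_wt_scaled:
  assumes "n \<ge> 1" "m \<ge> 0"
  obtains J where "((\<lambda>x. m * gauss_wt (real n + 5) ((x + 3) / (real n + 5))) has_integral J) {- 1/2..real n - 1/2}"
    "J \<le> m * (real n + 5) * (LINT x|lborel. gauss_wt (real n + 5) x)"
proof -
  let ?N = "real n + 5"
  let ?f = "\<lambda>x. m * gauss_wt ?N ((x + 3) / ?N)"
  have e: "gauss_wt ?N ((x + 3) / ?N) = gauss_wt ?N (3 / ?N + (1 / ?N) * x)" for x by (simp add: add_divide_distrib add.commute)
  have i: "integrable lborel ?f"
    unfolding e by (intro integrable_mult_right lborel_integrable_real_affine gauss_wt_integrable) auto
  have "(LINT x|lborel. gauss_wt ?N x) = \<bar>1 / ?N\<bar> *\<^sub>R (LINT x|lborel. gauss_wt ?N (3 / ?N + (1 / ?N) * x))"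
    by (rule lborel_integral_real_affine) auto
  then have "(LINT x|lborel. gauss_wt ?N ((x + 3) / ?N)) = ?N * (LINT x|lborel. gauss_wt ?N x)"
    by (simp add: e)
  moreover have "(LINT x|lborel. ?f x) = m * (LINT x|lborel. gauss_wt ?N ((x + 3) / ?N))"
    by (rule integral_mult_right_zero)
  ultimately have "(LINT x|lborel. ?f x) = m * ?N * (LINT x|lborel. gauss_wt ?N x)" by simp
  then have 1: "(?f has_integral (m * ?N * (LINT x|lborel. gauss_wt ?N x))) UNIV"
    using has_integral_integral_lborel[OF i] by (simp only:)
  then have 2: "?f integrable_on {- 1/2..real n - 1/2}"
    by (meson has_integral_integrable integrable_on_subinterval subset_UNIV)
  have "integral {- 1/2..real n - 1/2} ?f \<le> integral UNIV ?f"
    using 1 2 gauss_wt_nonneg assms by (intro integral_subset_le) (auto intro!: mult_nonneg_nonneg)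
  also have "\<dots> = m * ?N * (LINT x|lborel. gauss_wt ?N x)" using 1 by (rule integral_unique)
  finally show ?thesis by (rule that[OF integrable_integral[OF 2]])
qed

end

section \<open>The sine factor on the two contours\<close>

lemma norm_sin_bounds:
  fixes z :: complex
  shows "norm (sin z) \<le> exp \<bar>Im z\<bar>"
    and "\<bar>Im z\<bar> \<ge> 1 \<Longrightarrow> exp \<bar>Im z\<bar> / 4 \<le> norm (sin z)"
    and "cos (2 * Re z) = - 1 \<Longrightarrow> exp \<bar>Im z\<bar> / 4 \<le> norm (sin z)"
proof -
  define E where "E = exp \<bar>Im z\<bar>"
  define F where "F = inverse E"
  have E: "E \<ge> 1" and F: "0 < F" "F \<le> 1" by (auto simp: E_def F_def inverse_le_1_iff)
  have "exp (2 * Im z) + inverse (exp (2 * Im z)) = E\<^sup>2 + F\<^sup>2"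
  proof (cases "Im z \<ge> 0")
    case True
    then show ?thesis by (simp add: E_def F_def exp_double power_inverse)
  next
    case False
    then have "E = inverse (exp (Im z))" by (simp add: E_def exp_minus)
    moreover from this have "F = exp (Im z)" by (simp add: F_def)
    ultimately show ?thesis by (simp add: exp_double power_inverse)
  qed
  \<comment> \<open>With E = exp |Im z| and F = 1/E; the three bounds differ only in how the cosine
    is controlled.\<close>
  then have n: "(norm (sin z))\<^sup>2 = (E\<^sup>2 + F\<^sup>2 - 2 * cos (2 * Re z)) / 4"
    by (simp add: norm_sin_squared)
  have F2: "0 \<le> F\<^sup>2" "F\<^sup>2 \<le> 1" using F by (auto simp: power_le_one)
  have E2: "E\<^sup>2 \<ge> 1" using E by simp
  have cb: "cos (2 * Re z) \<le> 1" "cos (2 * Re z) \<ge> - 1" by auto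
  have "E\<^sup>2 + F\<^sup>2 - 2 * cos (2 * Re z) \<le> E\<^sup>2 * 4"
    using F2(2) E2 cb(2) by (smt (verit))
  then have "(norm (sin z))\<^sup>2 \<le> E\<^sup>2" unfolding n by simp
  then show "norm (sin z) \<le> exp \<bar>Im z\<bar>" unfolding E_def by (rule power2_le_imp_le) simp
  show "exp \<bar>Im z\<bar> / 4 \<le> norm (sin z)" if "\<bar>Im z\<bar> \<ge> 1"
  proof -
    have "1 + \<bar>Im z\<bar> \<le> E" unfolding E_def by (rule exp_ge_add_one_self)
    then have "E \<ge> 2" using that by linarith
    then have "E\<^sup>2 \<ge> 2\<^sup>2" by (intro power_mono) auto
    then have "4 \<le> E\<^sup>2" by simp
    moreover have "0 \<le> 3 * e + (f * 4 - 8 * c)" if "4 \<le> e" "0 \<le> f" "c \<le> 1" for c e f :: real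
      using that by linarith
    ultimately have "0 \<le> 3 * E\<^sup>2 + (F\<^sup>2 * 4 - 8 * cos (2 * Re z))" using F2(1) cb(1) by blast
    then have "(E / 4)\<^sup>2 \<le> (norm (sin z))\<^sup>2" unfolding n by (simp add: power_divide)
    then show ?thesis unfolding E_def by (rule power2_le_imp_le) simp
  qed
  show "exp \<bar>Im z\<bar> / 4 \<le> norm (sin z)" if "cos (2 * Re z) = - 1"
  proof -
    have "0 \<le> 3 * E\<^sup>2 + (F\<^sup>2 * 4 + 8)" using F2(1) E2 by (smt (verit))
    then have "(E / 4)\<^sup>2 \<le> (norm (sin z))\<^sup>2" unfolding n that by (simp add: power_divide)
    then show ?thesis unfolding E_def by (rule power2_le_imp_le) simp
  qed
qed

definition sin_wt :: "complex \<Rightarrow> real" where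
  "sin_wt t = norm (sin (of_real pi * t)) * exp (- pi * \<bar>Im t\<bar>)"

lemma sin_wt_le_1: "sin_wt t \<le> 1"
proof -
  have "norm (sin (of_real pi * t)) \<le> exp (pi * \<bar>Im t\<bar>)"
    using norm_sin_bounds(1)[of "of_real pi * t"] by (simp add: abs_mult)
  then have "sin_wt t \<le> exp (pi * \<bar>Im t\<bar>) * exp (- pi * \<bar>Im t\<bar>)"
    unfolding sin_wt_def by (intro mult_right_mono) auto
  then show ?thesis by (simp flip: exp_add)
qed

text \<open>The two alternatives are the parts of the rectangle: the horizontal edges, whose height
  is eventually at least 1, and the sides, where Re t is half-integral and |sin| is as large as its
  height permits.\<close>

lemma sin_wt_ge:
  assumes "\<bar>Im t\<bar> \<ge> 1 \<or> cos (2 * pi * Re t) = - 1"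
  shows "sin_wt t \<ge> 1/4"
proof -
  have "exp (pi * \<bar>Im t\<bar>) / 4 \<le> norm (sin (of_real pi * t))"
    using assms
  proof
    assume "\<bar>Im t\<bar> \<ge> 1"
    then have "1 * 1 \<le> pi * \<bar>Im t\<bar>" using pi_ge_two by (intro mult_mono) auto
    then show ?thesis using norm_sin_bounds(2)[of "of_real pi * t"] by (simp add: abs_mult)
  next
    assume "cos (2 * pi * Re t) = - 1"
    then show ?thesis using norm_sin_bounds(3)[of "of_real pi * t"] by (simp add: abs_mult mult_ac)
  qed
  then have "exp (pi * \<bar>Im t\<bar>) / 4 * exp (- pi * \<bar>Im t\<bar>) \<le> sin_wt t"
    unfolding sin_wt_def by (intro mult_right_mono) auto
  then show ?thesis by (simp flip: exp_add)
qed

abbreviation "amp_model \<alpha> \<beta> p q l r d n t \<equiv> d * wt \<alpha> \<beta> (sx n t) (sy n t)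
  * exp ((real n + 5) * phase p q l (sx n t) (sy n t)) * exp (Re t * (l + r * ln (real n))) * sin_wt t"

text \<open>\<open>comparable\<close> unpacked into its two inequalities, since they are used at
  different points: the upper one at s, the lower one at t.\<close>

lemma amp_bounds:
  fixes M K :: nat and \<nu> \<nu>' :: "nat \<Rightarrow> nat" and l :: real
  obtains \<alpha> \<beta> c C :: real and D :: "nat \<Rightarrow> real"
  where "\<And>n. D n > 0" "c > 0" "C > 0"
    "\<And>n t. (n, t) \<in> strip \<Longrightarrow>
      c * (amp_model \<alpha> \<beta> (real M + 1) (real K + 1) l (real M - real K) (D n) n t) \<le> norm (gamprod M K \<nu> \<nu>' n t * nodepoly n t)"
    "\<And>n t. (n, t) \<in> strip \<Longrightarrow> norm (gamprod M K \<nu> \<nu>' n t * nodepoly n t) \<le>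
      C * (amp_model \<alpha> \<beta> (real M + 1) (real K + 1) l (real M - real K) (D n) n t)"
proof -
  obtain \<alpha> \<beta> :: real and D :: "nat \<Rightarrow> real" where D: "\<And>n. D n > 0"
    and comp: "comparable strip (\<lambda>(n, t). norm (gamprod M K \<nu> \<nu>' n t * nodepoly n t))
    (\<lambda>(n, t). D n * (norm ((t + 3) / complex_of_real (real n + 5)) powr \<alpha> * norm (1 - (t + 3) / complex_of_real (real n + 5)) powr \<beta>)
      * exp ((real n + 5) * phase (real M + 1) (real K + 1) l (sx n t) (sy n t))
      * exp (Re t * l + (real M - real K) * Re t * ln (real n))
      * (norm (sin (of_real pi * t)) * exp (- pi * \<bar>Im t\<bar>)))"
    using amp_comparable[of M K \<nu> \<nu>' l] by blast
  have w: "norm ((t + 3) / complex_of_real (real n + 5)) powr \<alpha> * norm (1 - (t + 3) / complex_of_real (real n + 5)) powr \<beta>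
    = wt \<alpha> \<beta> (sx n t) (sy n t)" for n :: nat and t
  proof -
    define N where "N = real n + 5"
    have e1: "(t + 3) / complex_of_real N = Complex ((Re t + 3) / N) (Im t / N)"
      by (simp add: complex_eq_iff Re_divide_of_real Im_divide_of_real)
    have e2: "1 - (t + 3) / complex_of_real N = Complex (1 - (Re t + 3) / N) (- (Im t / N))"
      by (simp add: e1 complex_eq_iff)
    show ?thesis
      unfolding N_def[symmetric] e2 unfolding e1 by (simp add: wt_def cmod_def)
  qed
  obtain c C where cC: "c > 0" "C > 0" and b: "\<And>x. x \<in> strip \<Longrightarrow> 
    c * (case x of (n, t) \<Rightarrow> amp_model \<alpha> \<beta> (real M + 1) (real K + 1) l (real M - real K) (D n) n t) \<le> (case x of (n, t) \<Rightarrow> norm (gamprod M K \<nu> \<nu>' n t * nodepoly n t)) \<and>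
    (case x of (n, t) \<Rightarrow> norm (gamprod M K \<nu> \<nu>' n t * nodepoly n t)) \<le> C * (case x of (n, t) \<Rightarrow> amp_model \<alpha> \<beta> (real M + 1) (real K + 1) l (real M - real K) (D n) n t)"
  proof -
    have "comparable strip (\<lambda>(n, t). norm (gamprod M K \<nu> \<nu>' n t * nodepoly n t))
      (\<lambda>(n, t). amp_model \<alpha> \<beta> (real M + 1) (real K + 1) l (real M - real K) (D n) n t)"
      using comp
    proof (rule comparable_cong)
      fix x :: "nat \<times> complex"
      obtain n t where x: "x = (n, t)" by fastforce
      have r: "Re t * l + (real M - real K) * Re t * ln (real n) = Re t * (l + (real M - real K) * ln (real n))" by (simp add: algebra_simps)
      show "(case x of (n, t) \<Rightarrow> D n * (norm ((t + 3) / complex_of_real (real n + 5)) powr \<alpha> * norm (1 - (t + 3) / complex_of_real (real n + 5)) powr \<beta>)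
      * exp ((real n + 5) * phase (real M + 1) (real K + 1) l (sx n t) (sy n t))
      * exp (Re t * l + (real M - real K) * Re t * ln (real n))
      * (norm (sin (of_real pi * t)) * exp (- pi * \<bar>Im t\<bar>))) = (case x of (n, t) \<Rightarrow> amp_model \<alpha> \<beta> (real M + 1) (real K + 1) l (real M - real K) (D n) n t)"
        unfolding x prod.case w r sin_wt_def ..
    qed simp
    then show ?thesis using that unfolding comparable_def by blast
  qed
  show ?thesis
    by (rule that[OF D cC]) (drule b, unfold prod.case, erule conjE, assumption)+
qed

definition remainder :: "nat \<Rightarrow> nat \<Rightarrow> (nat \<Rightarrow> nat) \<Rightarrow> (nat \<Rightarrow> nat) \<Rightarrow> nat \<Rightarrow> real \<Rightarrow> real \<Rightarrow> real \<Rightarrow> complex \<Rightarrow> complex" where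
  "remainder M K \<nu> \<nu>' n x y B s = gamprod M K \<nu> \<nu>' n s * nodepoly n s * cpow y (- s - 1) / (2 * pi * \<i>)
       * contour_integral (rect n B) (\<lambda>t. rgamprod M K \<nu> \<nu>' n t * cpow x t / (nodepoly n t * (s - t)))"

lemma norm_ge_sqrt_mult: "norm (Complex x v) \<ge> sqrt \<bar>x\<bar> * sqrt \<bar>v\<bar>"
proof -
  have "2 * (\<bar>x\<bar> * \<bar>v\<bar>) \<le> \<bar>x\<bar>\<^sup>2 + \<bar>v\<bar>\<^sup>2" using sum_squares_bound[of "\<bar>x\<bar>" "\<bar>v\<bar>"] by simp
  then have "\<bar>x\<bar> * \<bar>v\<bar> \<le> x\<^sup>2 + v\<^sup>2" using mult_nonneg_nonneg[OF abs_ge_zero[of x] abs_ge_zero[of v]] unfolding power2_abs by linarith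
  then show ?thesis by (simp add: cmod_def flip: real_sqrt_mult)
qed

lemma path_image_rect:
  assumes "n \<ge> 1" "B > 0"
  shows "path_image (rect n B) = cbox (Complex (- 1/2) (- B)) (Complex (real n - 1/2) B) - box (Complex (- 1/2) (- B)) (Complex (real n - 1/2) B)"
  unfolding rect_def using assms by (intro path_image_rectpath_cbox_minus_box) auto

text \<open>The shape of the t-integrand's bound: the inverted lower bound of the amplitude, with
  the phase measured from the saddle point and everything independent of t put into
  \<open>A0\<close>.\<close>

abbreviation (in saddle) "rect_model \<alpha> \<beta> A0 n u t \<equiv> A0 * inverse (wt \<alpha> \<beta> (sx n t) (sy n t))
  * exp (- (real n + 5) * (phase p q l (sx n t) (sy n t) - phase p q l a b)) * inverse (norm (Complex ((real n + 5) * a - 3) u - t))"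

context saddle
begin

text \<open>The line and the rectangle cross at the saddle points, where $1/|s-t|$ is singular. With $d_1$ and $d_2$ the
  vertical and horizontal distances to the crossing, $\sqrt{d_1^2+d_2^2} \ge \sqrt{d_1}\,\sqrt{d_2}$ separates the variables into
  integrable singularities, so dominated convergence applies to the two integrals one at a time.\<close>

lemma contour_bound:
  fixes \<alpha> \<beta> :: real
  obtains \<eta> :: "nat \<Rightarrow> real" and n0 :: nat where "\<eta> \<longlonglongrightarrow> 0" "n0 \<ge> 1"
    "\<And>n u F A0. n \<ge> n0 \<Longrightarrow> A0 \<ge> 0 \<Longrightarrow> u \<noteq> 0 \<Longrightarrow> \<bar>u\<bar> \<noteq> (real n + 5) * b \<Longrightarrow>
      continuous_on (path_image (rect n ((real n + 5) * b))) F \<Longrightarrow>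
      (\<And>t. (n, t) \<in> strip \<Longrightarrow> \<bar>Im t\<bar> \<ge> 1 \<or> cos (2 * pi * Re t) = - 1 \<Longrightarrow>
         norm (F t) \<le> rect_model \<alpha> \<beta> A0 n u t) \<Longrightarrow>
      norm (contour_integral (rect n ((real n + 5) * b)) F) \<le>
         A0 * \<eta> n * (1 / sqrt \<bar>u / (real n + 5) - b\<bar> + 1 / sqrt \<bar>u / (real n + 5) + b\<bar> + 1)"
proof -
  obtain Ch where Ch: "Ch > 0" "\<And>x. 0 < x \<Longrightarrow> x < 1 \<Longrightarrow> inverse (wt \<alpha> \<beta> x b) \<le> Ch"
    using horizontal_weight[of \<alpha> \<beta>] by blast
  obtain Cl where Cl: "Cl > 0" "\<And>x v. 0 < x \<Longrightarrow> x \<le> 1/2 \<Longrightarrow> \<bar>v\<bar> \<le> b \<Longrightarrow> inverse (wt \<alpha> \<beta> x v) \<le> Cl * x powr (- \<bar>\<alpha>\<bar>)"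
    using side_weight[of \<alpha> \<beta>] by blast
  obtain Cr where Cr: "Cr > 0" "\<And>x v. 0 < x \<Longrightarrow> x \<le> 1/2 \<Longrightarrow> \<bar>v\<bar> \<le> b \<Longrightarrow> inverse (wt \<beta> \<alpha> x v) \<le> Cr * x powr (- \<bar>\<beta>\<bar>)"
    using side_weight[of \<beta> \<alpha>] by blast
  obtain \<delta> e where \<delta>: "\<delta> > 0" "e > 0"
    "\<And>x v. 0 < x \<Longrightarrow> x < e \<Longrightarrow> \<bar>v\<bar> \<le> b \<Longrightarrow> phase p q l x v \<ge> phase p q l a b + \<delta>"
    "\<And>x v. 0 < x \<Longrightarrow> x < e \<Longrightarrow> \<bar>v\<bar> \<le> b \<Longrightarrow> phase p q l (1 - x) v \<ge> phase p q l a b + \<delta>"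
    using phase_sides by blast
  \<comment> \<open>Keeps the sides, which lie within \<open>d0\<close> of 0 and 1 for large n, at
    distance at least \<open>d0\<close> from the line through the saddle points.\<close>
  define d0 where "d0 = min a (1 - a) / 2"
  have d0: "d0 > 0" "2 * d0 \<le> a" "2 * d0 \<le> 1 - a" using a0 a1 by (auto simp: d0_def)
  \<comment> \<open>5/2 = 3 - 1/2 is the shifted abscissa of the left side; as n - 1/2 + 3 = N -
    5/2, the right side has the same distance from 1.\<close>
  define Sd where "Sd n = Cl * ((5/2) / (real n + 5)) powr (- \<bar>\<alpha>\<bar>) + Cr * ((5/2) / (real n + 5)) powr (- \<bar>\<beta>\<bar>)" for n :: nat
  define I where "I n = (LINT x|lborel. gauss_wt (real n + 5) x)" for n :: nat
  \<comment> \<open>The first summand comes from the horizontal edges, the second from the sides,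
    where 4b / d0 is their total length 4 N b divided by the distance N d0 from s.\<close>
  define \<eta> where "\<eta> n = Ch * I n + 4 * b / d0 * (Sd n * exp (- (real n + 5) * \<delta>))" for n
  have pe: "(\<lambda>n. ((5/2) / (real n + 5)) powr (- r) * exp (- (real n + 5) * \<delta>)) \<longlonglongrightarrow> 0" for r
    using \<delta>(1) by real_asymp
  have "(\<lambda>n. Ch * I n + 4 * b / d0 * (Cl * (((5/2) / (real n + 5)) powr (- \<bar>\<alpha>\<bar>) * exp (- (real n + 5) * \<delta>))
      + Cr * (((5/2) / (real n + 5)) powr (- \<bar>\<beta>\<bar>) * exp (- (real n + 5) * \<delta>)))) \<longlonglongrightarrow> Ch * 0 + 4 * b / d0 * (Cl * 0 + Cr * 0)"
    unfolding I_def by (intro tendsto_intros gauss_wt_integral_tendsto pe)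
  then have \<eta>0: "\<eta> \<longlonglongrightarrow> 0" by (simp add: \<eta>_def[abs_def] Sd_def algebra_simps)
  have "\<forall>\<^sub>F n in sequentially. (5/2) / (real n + 5) < min e d0 \<and> (real n + 5) * b \<ge> 1 \<and> n \<ge> 1"
  proof (intro eventually_conj)
    have "(\<lambda>n. (5/2) / (real n + 5)) \<longlonglongrightarrow> 0" by real_asymp
    then show "\<forall>\<^sub>F n in sequentially. (5/2) / (real n + 5) < min e d0" using \<delta>(2) d0(1) by (intro order_tendstoD) auto
    have "filterlim (\<lambda>n. (real n + 5) * b) at_top sequentially" using b0 by real_asymp
    then show "\<forall>\<^sub>F n in sequentially. (real n + 5) * b \<ge> 1" by (simp add: filterlim_at_top)
  qed (rule eventually_ge_at_top)
  then obtain n0 where n0: "\<And>n. n \<ge> n0 \<Longrightarrow> (5/2) / (real n + 5) < min e d0 \<and> (real n + 5) * b \<ge> 1 \<and> n \<ge> 1"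
    unfolding eventually_sequentially by blast
  have "norm (contour_integral (rect n ((real n + 5) * b)) F) \<le>
         A0 * \<eta> n * (1 / sqrt \<bar>u / (real n + 5) - b\<bar> + 1 / sqrt \<bar>u / (real n + 5) + b\<bar> + 1)"
    if n: "n \<ge> n0" and A0: "A0 \<ge> 0" and u: "u \<noteq> 0" "\<bar>u\<bar> \<noteq> (real n + 5) * b"
      and cont: "continuous_on (path_image (rect n ((real n + 5) * b))) F"
      and F: "\<And>t. (n, t) \<in> strip \<Longrightarrow> \<bar>Im t\<bar> \<ge> 1 \<or> cos (2 * pi * Re t) = - 1 \<Longrightarrow>
         norm (F t) \<le> rect_model \<alpha> \<beta> A0 n u t" for n u F A0
  proof -
    define N where "N = real n + 5"
    define v where "v = u / N"
    define s where "s = Complex (N * a - 3) u"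
    define x0 where "x0 = (5/2) / N"
    have N: "N > 0" "N \<ge> 5" by (auto simp: N_def)
    have x0: "0 < x0" "x0 < e" "x0 < d0" "x0 \<le> 1/2" and Nb: "N * b \<ge> 1" and n1: "n \<ge> 1"
      using n0[OF n] N by (auto simp: x0_def N_def)
    have u_eq: "u = N * v" using N by (simp add: v_def)
    have "\<bar>v\<bar> \<noteq> b" using u(2) N unfolding N_def[symmetric] u_eq by (auto simp: abs_mult)
    then have vb: "v \<noteq> b" "v \<noteq> - b" using b0 by auto
    have I0: "I n \<ge> 0" unfolding I_def by (intro integral_nonneg_AE AE_I2 gauss_wt_nonneg)
    have nN: "real n = N - 5" by (simp add: N_def)
    \<comment> \<open>Both horizontal edges at once, \<sigma> being the sign of the height; the
      abscissa of the saddle points is left out.\<close>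
    have top: "norm (F (Complex x (\<sigma> * (N * b)))) \<le> (A0 * Ch / (N * sqrt \<bar>v - \<sigma> * b\<bar>)) * gauss_wt N ((x + 3) / N)"
      if x: "- 1/2 \<le> x" "x \<le> real n - 1/2" "x \<noteq> N * a - 3" and \<sigma>: "\<sigma> = 1 \<or> \<sigma> = - 1" for x \<sigma>
    proof -
      define X where "X = (x + 3) / N"
      define t where "t = Complex x (\<sigma> * (N * b))"
      have X: "0 < X" "X < 1" "X \<noteq> a" using x N by (auto simp: X_def nN field_simps)
      have xX: "x = N * X - 3" using N by (simp add: X_def)
      have im: "Im t / N = \<sigma> * b" "(Re t + 3) / N = X" using N by (auto simp: t_def X_def)
      have tg: "(n, t) \<in> strip" using x n1 by (auto simp: strip_def t_def)
      have it: "\<bar>Im t\<bar> \<ge> 1" using Nb \<sigma> by (auto simp: t_def)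
      have e1: "phase p q l X (\<sigma> * b) = phase p q l X b" "wt \<alpha> \<beta> X (\<sigma> * b) = wt \<alpha> \<beta> X b"
        using \<sigma> phase_abs[of p q l X b] phase_abs[of p q l X "- b"] b0 by auto
      have "norm (s - t) = N * norm (Complex (a - X) (v - \<sigma> * b))"
      proof -
        have "s - t = of_real N * Complex (a - X) (v - \<sigma> * b)"
          by (simp add: complex_eq_iff s_def t_def xX u_eq algebra_simps)
        then show ?thesis using N by (simp add: norm_mult)
      qed
      also have "\<dots> \<ge> N * (sqrt \<bar>X - a\<bar> * sqrt \<bar>v - \<sigma> * b\<bar>)"
        using norm_ge_sqrt_mult[of "a - X" "v - \<sigma> * b"] N by (intro mult_left_mono) (auto simp: abs_minus_commute)
      finally have "inverse (norm (s - t)) \<le> inverse (N * (sqrt \<bar>X - a\<bar> * sqrt \<bar>v - \<sigma> * b\<bar>))"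
        using N X vb \<sigma> by (intro le_imp_inverse_le) (auto intro!: mult_pos_pos)
      moreover have "norm (F t) \<le> A0 * inverse (wt \<alpha> \<beta> X b) * exp (- N * (phase p q l X b - phase p q l a b)) * inverse (norm (s - t))"
        using F[OF tg] it unfolding N_def[symmetric] im e1 s_def by simp
      ultimately have "norm (F t) \<le> A0 * Ch * exp (- N * (phase p q l X b - phase p q l a b)) * inverse (N * (sqrt \<bar>X - a\<bar> * sqrt \<bar>v - \<sigma> * b\<bar>))"
      proof -
        assume i: "inverse (norm (s - t)) \<le> inverse (N * (sqrt \<bar>X - a\<bar> * sqrt \<bar>v - \<sigma> * b\<bar>))"
          and f: "norm (F t) \<le> A0 * inverse (wt \<alpha> \<beta> X b) * exp (- N * (phase p q l X b - phase p q l a b)) * inverse (norm (s - t))"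
        have "A0 * inverse (wt \<alpha> \<beta> X b) * exp (- N * (phase p q l X b - phase p q l a b)) * inverse (norm (s - t)) \<le>
          A0 * Ch * exp (- N * (phase p q l X b - phase p q l a b)) * inverse (N * (sqrt \<bar>X - a\<bar> * sqrt \<bar>v - \<sigma> * b\<bar>))"
          using A0 Ch(1) Ch(2)[OF X(1,2)] i by (intro mult_mono mult_nonneg_nonneg) (auto simp: wt_def)
        then show ?thesis using f by linarith
      qed
      also have "\<dots> = (A0 * Ch / (N * sqrt \<bar>v - \<sigma> * b\<bar>)) * gauss_wt N X"
        using X by (simp add: gauss_wt_def divide_inverse inverse_mult_distrib mult_ac)
      finally show ?thesis by (simp add: X_def t_def)
    qed
    \<comment> \<open>The sides keep away from s, so 1/|s-t| is harmless, and the excess \<delta> of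
      the phase yields the factor exp(-N \<delta>).\<close>
    have side: "norm (F (Complex y w)) \<le> A0 * Sd n * exp (- N * \<delta>) / (N * d0)"
      if y: "y = - 1/2 \<or> y = real n - 1/2" and w: "\<bar>w\<bar> \<le> N * b" for y w
    proof -
      define X where "X = (y + 3) / N"
      define V where "V = w / N"
      define t where "t = Complex y w"
      have V: "\<bar>V\<bar> \<le> b" using w N by (simp add: V_def abs_divide pos_divide_le_eq mult.commute)
      have im: "Im t / N = V" "(Re t + 3) / N = X" by (auto simp: t_def X_def V_def)
      have tg: "(n, t) \<in> strip" using y n1 by (auto simp: strip_def t_def)
      have cs: "cos (2 * pi * Re t) = - 1"
        using y
      proof
        assume "y = - 1/2"
        then show ?thesis by (simp add: t_def)
      next
        assume "y = real n - 1/2"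
        then have "Re t = real n - 1/2" by (simp add: t_def)
        then have "2 * pi * Re t = 2 * real n * pi - pi" by (simp add: right_diff_distrib)
        then show ?thesis by (simp only: cos_diff cos_2npi cos_pi sin_pi)
      qed
      have X: "X = x0 \<or> X = 1 - x0"
        using y
      proof
        assume "y = - 1/2"
        then show ?thesis by (simp add: X_def x0_def)
      next
        assume "y = real n - 1/2"
        then have "y + 3 = N - 5/2" by (simp add: nN)
        then have "X = N / N - x0" by (simp only: X_def x0_def diff_divide_distrib)
        then show ?thesis using N by simp
      qed
      have pa: "0 \<le> Cl * x0 powr (- \<bar>\<alpha>\<bar>)" "0 \<le> Cr * x0 powr (- \<bar>\<beta>\<bar>)" using Cl Cr by auto
      have W: "inverse (wt \<alpha> \<beta> X V) \<le> Sd n"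
        using X
      proof
        assume "X = x0"
        then show ?thesis using Cl(2)[OF x0(1,4) V] pa unfolding Sd_def N_def[symmetric] x0_def[symmetric] by simp
      next
        assume "X = 1 - x0"
        then show ?thesis using Cr(2)[OF x0(1,4) V] pa unfolding Sd_def N_def[symmetric] x0_def[symmetric] by (simp add: wt_swap)
      qed
      have H: "phase p q l X V - phase p q l a b \<ge> \<delta>"
        using X \<delta>(3)[OF x0(1,2) V] \<delta>(4)[OF x0(1,2) V] by auto
      then have H': "exp (- N * (phase p q l X V - phase p q l a b)) \<le> exp (- N * \<delta>)" using N by simp
      have "N * d0 \<le> \<bar>N * a - 3 - y\<bar>"
      proof -
        have "y = N * X - 3" using N by (simp add: X_def)
        then have "N * a - 3 - y = N * (a - X)" by (simp add: algebra_simps)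
        moreover have "d0 \<le> \<bar>a - X\<bar>" using X x0 d0 by auto
        ultimately show ?thesis using N by (simp add: abs_mult)
      qed
      also have "\<dots> \<le> norm (s - t)" using abs_Re_le_cmod[of "s - t"] by (simp add: s_def t_def)
      finally have i: "inverse (norm (s - t)) \<le> inverse (N * d0)" using N d0 by (intro le_imp_inverse_le) auto
      have "norm (F t) \<le> A0 * inverse (wt \<alpha> \<beta> X V) * exp (- N * (phase p q l X V - phase p q l a b)) * inverse (norm (s - t))"
        using F[OF tg] cs unfolding N_def[symmetric] im s_def by simp
      also have "\<dots> \<le> A0 * Sd n * exp (- N * \<delta>) * inverse (N * d0)"
        using A0 W H' i Cl(1) Cr(1) by (intro mult_mono mult_nonneg_nonneg) (auto simp: wt_def Sd_def)
      finally show ?thesis by (simp add: t_def divide_inverse)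
    qed
    let ?m = "\<lambda>\<sigma>. A0 * Ch / (N * sqrt \<bar>v - \<sigma> * b\<bar>)"
    have m0: "?m \<sigma> \<ge> 0" for \<sigma> using A0 Ch N by auto
    obtain J1 where J1: "((\<lambda>x. ?m 1 * gauss_wt N ((x + 3) / N)) has_integral J1) {- 1/2..real n - 1/2}"
      "J1 \<le> ?m 1 * N * I n" using gauss_wt_scaled[OF n1 m0[of 1]] unfolding N_def I_def by blast
    obtain J2 where J2: "((\<lambda>x. ?m (- 1) * gauss_wt N ((x + 3) / N)) has_integral J2) {- 1/2..real n - 1/2}"
      "J2 \<le> ?m (- 1) * N * I n" using gauss_wt_scaled[OF n1 m0[of "- 1"]] unfolding N_def I_def by blast
    define L where "L = A0 * Sd n * exp (- N * \<delta>) / (N * d0)"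
    have L0: "L \<ge> 0" unfolding L_def Sd_def using A0 Cl(1) Cr(1) N d0 by (intro divide_nonneg_nonneg mult_nonneg_nonneg add_nonneg_nonneg) auto
    have "norm (contour_integral (rect n (N * b)) F) \<le> J1 + J2 + 4 * (N * b) * L"
    proof (rule contour_integral_rect_le[OF n1 _ _ J1(1) _ J2(1), where c = "N * a - 3"])
      show "N * b > 0" using N b0 by simp
      show "continuous_on (path_image (rect n (N * b))) F" using cont by (simp add: N_def)
      show "norm (F (Complex x (N * b))) \<le> ?m 1 * gauss_wt N ((x + 3) / N)" if "- 1/2 \<le> x" "x \<le> real n - 1/2" "x \<noteq> N * a - 3" for x
        using top[OF that, of 1] by simp
      show "norm (F (Complex x (- (N * b)))) \<le> ?m (- 1) * gauss_wt N ((x + 3) / N)" if "- 1/2 \<le> x" "x \<le> real n - 1/2" "x \<noteq> N * a - 3" for x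
        using top[OF that, of "- 1"] by simp
      show "0 \<le> L" by (rule L0)
      show "norm (F (Complex (- 1/2) w)) \<le> L" "norm (F (Complex (real n - 1/2) w)) \<le> L" if "\<bar>w\<bar> \<le> N * b" for w
        unfolding L_def by (rule side; use that in simp)+
    qed
    also have "\<dots> \<le> ?m 1 * N * I n + ?m (- 1) * N * I n + 4 * (N * b) * L" using J1(2) J2(2) by simp
    also have "\<dots> = A0 * (Ch * I n) * (1 / sqrt \<bar>v - b\<bar>) + A0 * (Ch * I n) * (1 / sqrt \<bar>v + b\<bar>) + A0 * (4 * b / d0 * (Sd n * exp (- N * \<delta>)))"
      using N d0 by (simp add: L_def mult_ac)
    also have "\<dots> \<le> A0 * \<eta> n * (1 / sqrt \<bar>v - b\<bar>) + A0 * \<eta> n * (1 / sqrt \<bar>v + b\<bar>) + A0 * \<eta> n"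
    proof (intro add_mono mult_right_mono mult_left_mono)
      have "0 \<le> 4 * b / d0 * (Sd n * exp (- N * \<delta>))"
        unfolding Sd_def using b0 d0 Cl(1) Cr(1) by (intro mult_nonneg_nonneg divide_nonneg_nonneg add_nonneg_nonneg) auto
      then show "Ch * I n \<le> \<eta> n" "Ch * I n \<le> \<eta> n" by (auto simp: \<eta>_def N_def)
      show "4 * b / d0 * (Sd n * exp (- N * \<delta>)) \<le> \<eta> n" using Ch(1) I0 by (simp add: \<eta>_def N_def)
    qed (use A0 in auto)
    finally show ?thesis by (simp add: N_def v_def algebra_simps)
  qed
  moreover have "n0 \<le> max n0 1" by simp
  ultimately show ?thesis using \<eta>0 by (intro that[of \<eta> "max n0 1"]) auto
qed

end

section \<open>The remaining double integral is small\<close>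

context saddle
begin

text \<open>The upper bound at s and the inverted lower bound at t share the factors
  \<open>D n\<close> and exp(N h0), which cancel. The factors exp(Re s \<Lambda>) and exp(-Re t
  \<Lambda>) offset y^(-s) and x^t up to e^R each, leaving 1/y. What survives is the quadratic decay
  on the line times the contour bound.\<close>

lemma error_bound:
  fixes M K :: nat and \<nu> \<nu>' :: "nat \<Rightarrow> nat" and R :: real
  assumes pq: "p = real M + 1" "q = real K + 1" and R: "R \<ge> 0"
  obtains \<epsilon> :: "nat \<Rightarrow> real" and n0 :: nat where "\<epsilon> \<longlonglongrightarrow> 0" "n0 \<ge> 1"
    "\<And>n. n \<ge> n0 \<Longrightarrow> - 1/2 < (real n + 5) * a - 3 \<and> (real n + 5) * a - 3 < real n - 1/2"
    "\<And>n x y u. n \<ge> n0 \<Longrightarrow> \<bar>ln x - (l + (real M - real K) * ln (real n))\<bar> \<le> R / real n \<Longrightarrow>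
      \<bar>ln y - (l + (real M - real K) * ln (real n))\<bar> \<le> R / real n \<Longrightarrow> y > 0 \<Longrightarrow> u \<noteq> 0 \<Longrightarrow> \<bar>u\<bar> \<noteq> (real n + 5) * b \<Longrightarrow>
      norm (remainder M K \<nu> \<nu>' n x y ((real n + 5) * b) (Complex ((real n + 5) * a - 3) u)) \<le> 1 / y * (\<epsilon> n * sing_wt b (u / (real n + 5)))"
proof -
  obtain \<alpha> \<beta> c C :: real and D :: "nat \<Rightarrow> real" where D: "\<And>n. D n > 0" and cC: "c > 0" "C > 0"
    and lower: "\<And>n t. (n, t) \<in> strip \<Longrightarrow>
      c * (amp_model \<alpha> \<beta> p q l (real M - real K) (D n) n t) \<le> norm (gamprod M K \<nu> \<nu>' n t * nodepoly n t)"
    and upper: "\<And>n t. (n, t) \<in> strip \<Longrightarrow> norm (gamprod M K \<nu> \<nu>' n t * nodepoly n t) \<le>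
      C * (amp_model \<alpha> \<beta> p q l (real M - real K) (D n) n t)"
    using amp_bounds[of M K l \<nu> \<nu>'] unfolding pq by metis
  obtain Cv N0 where Cv: "Cv > 0" "N0 > 0"
    "\<And>N v. N \<ge> N0 \<Longrightarrow> wt \<alpha> \<beta> a v * exp (N * (phase p q l a v - phase p q l a b)) \<le> Cv / (1 + v\<^sup>2)"
    using vertical_bound[of \<alpha> \<beta>] by blast
  obtain \<eta> :: "nat \<Rightarrow> real" and n1 :: nat where \<eta>: "\<eta> \<longlonglongrightarrow> 0" "n1 \<ge> 1"
    and cb: "\<And>n u F A0. n \<ge> n1 \<Longrightarrow> A0 \<ge> 0 \<Longrightarrow> u \<noteq> 0 \<Longrightarrow> \<bar>u\<bar> \<noteq> (real n + 5) * b \<Longrightarrow>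
      continuous_on (path_image (rect n ((real n + 5) * b))) F \<Longrightarrow>
      (\<And>t. (n, t) \<in> strip \<Longrightarrow> \<bar>Im t\<bar> \<ge> 1 \<or> cos (2 * pi * Re t) = - 1 \<Longrightarrow>
         norm (F t) \<le> rect_model \<alpha> \<beta> A0 n u t) \<Longrightarrow>
      norm (contour_integral (rect n ((real n + 5) * b)) F) \<le>
         A0 * \<eta> n * (1 / sqrt \<bar>u / (real n + 5) - b\<bar> + 1 / sqrt \<bar>u / (real n + 5) + b\<bar> + 1)"
    using contour_bound[of \<alpha> \<beta>] by blast
  \<comment> \<open>One e^R stems from y^(-s) and one from x^t, the 4 from the lower bound 1/4 for
    the sine; the prefactor 1/(2 pi) is simply bounded by 1.\<close>
  define \<epsilon> where "\<epsilon> n = (exp R * C * Cv * (4 * exp R / c)) * \<bar>\<eta> n\<bar>" for n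
  have \<epsilon>0: "\<epsilon> \<longlonglongrightarrow> 0" unfolding \<epsilon>_def[abs_def] by (intro tendsto_mult_right_zero tendsto_rabs_zero \<eta>)
  have "\<forall>\<^sub>F n in sequentially. - 1/2 < (real n + 5) * a - 3 \<and> (real n + 5) * a - 3 < real n - 1/2 \<and> real n + 5 \<ge> N0 \<and> n \<ge> n1"
  proof (intro eventually_conj)
    have "filterlim (\<lambda>n. (real n + 5) * a - 3) at_top sequentially" using a0 by real_asymp
    then show "\<forall>\<^sub>F n in sequentially. - 1/2 < (real n + 5) * a - 3" by (simp add: filterlim_at_top_dense)
    have "filterlim (\<lambda>n. (real n + 5) * (1 - a)) at_top sequentially" using a1 by real_asymp
    then have "\<forall>\<^sub>F n in sequentially. 5/2 < (real n + 5) * (1 - a)" unfolding filterlim_at_top_dense by blast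
    then show "\<forall>\<^sub>F n in sequentially. (real n + 5) * a - 3 < real n - 1/2" by eventually_elim (simp add: algebra_simps)
    have "filterlim (\<lambda>n. real n + 5) at_top sequentially" by real_asymp
    then show "\<forall>\<^sub>F n in sequentially. real n + 5 \<ge> N0" by (simp add: filterlim_at_top)
  qed (rule eventually_ge_at_top)
  then obtain n0 where n0: "\<And>n. n \<ge> n0 \<Longrightarrow> - 1/2 < (real n + 5) * a - 3 \<and> (real n + 5) * a - 3 < real n - 1/2 \<and> real n + 5 \<ge> N0 \<and> n \<ge> n1"
    unfolding eventually_sequentially by blast
  have "norm (remainder M K \<nu> \<nu>' n x y ((real n + 5) * b) (Complex ((real n + 5) * a - 3) u)) \<le> 1 / y * (\<epsilon> n * sing_wt b (u / (real n + 5)))"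
    if n: "n \<ge> n0" and x: "\<bar>ln x - (l + (real M - real K) * ln (real n))\<bar> \<le> R / real n"
      and y: "\<bar>ln y - (l + (real M - real K) * ln (real n))\<bar> \<le> R / real n" "y > 0" and u: "u \<noteq> 0" "\<bar>u\<bar> \<noteq> (real n + 5) * b" for n x y u
  proof -
    define N where "N = real n + 5"
    define \<Lambda> where "\<Lambda> = l + (real M - real K) * ln (real n)"
    define s where "s = Complex (N * a - 3) u"
    define v where "v = u / N"
    define h0 where "h0 = phase p q l a b"
    have N: "N > 0" "N \<ge> N0" and n1: "n \<ge> n1" "n \<ge> 1" using n0[OF n] \<eta>(2) by (auto simp: N_def)
    have sg: "(n, s) \<in> strip" using n0[OF n] n1 by (auto simp: strip_def s_def N_def)
    \<comment> \<open>The reason why an error R/n in ln x is affordable: it is multiplied by a real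
      part of size at most n.\<close>
    have expR: "exp (r * (z - \<Lambda>)) \<le> exp R" if "\<bar>r\<bar> \<le> real n" "\<bar>z - \<Lambda>\<bar> \<le> R / real n" for r z
    proof -
      have "r * (z - \<Lambda>) \<le> \<bar>r\<bar> * \<bar>z - \<Lambda>\<bar>" by (metis abs_ge_self abs_mult)
      also have "\<dots> \<le> real n * (R / real n)" using that by (intro mult_mono) auto
      also have "\<dots> = R" using n1 by simp
      finally show ?thesis by simp
    qed
    have reb: "\<bar>Re t\<bar> \<le> real n" if "(n, t) \<in> strip" for t using that by (auto simp: strip_def)
    have sx: "(Re s + 3) / N = a" "Im s / N = v" using N by (auto simp: s_def v_def)
    have A: "norm (gamprod M K \<nu> \<nu>' n s * nodepoly n s) \<le> C * (D n * exp (N * h0) * (Cv / (1 + v\<^sup>2)) * exp (Re s * \<Lambda>))"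
    proof -
      have "norm (gamprod M K \<nu> \<nu>' n s * nodepoly n s) \<le> C * (D n * wt \<alpha> \<beta> a v * exp (N * phase p q l a v) * exp (Re s * \<Lambda>) * sin_wt s)"
        using upper[OF sg] unfolding N_def[symmetric] sx \<Lambda>_def by simp
      also have "\<dots> \<le> C * (D n * wt \<alpha> \<beta> a v * exp (N * phase p q l a v) * exp (Re s * \<Lambda>) * 1)"
        using cC D[of n] sin_wt_le_1[of s] by (intro mult_left_mono mult_nonneg_nonneg) (auto simp: wt_def)
      also have "\<dots> = C * (D n * exp (N * h0) * (wt \<alpha> \<beta> a v * exp (N * (phase p q l a v - h0))) * exp (Re s * \<Lambda>))"
      proof -
        have "exp (N * phase p q l a v) = exp (N * h0) * exp (N * (phase p q l a v - h0))"
          by (simp add: algebra_simps flip: exp_add)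
        then show ?thesis by simp
      qed
      also have "\<dots> \<le> C * (D n * exp (N * h0) * (Cv / (1 + v\<^sup>2)) * exp (Re s * \<Lambda>))"
        using cC D[of n] Cv(3)[OF N(2), of v] unfolding h0_def
        by (intro mult_left_mono mult_right_mono mult_nonneg_nonneg) auto
      finally show ?thesis .
    qed
    have Py: "norm (cpow y (- s - 1)) * exp (Re s * \<Lambda>) \<le> 1 / y * exp R"
    proof -
      have "norm (cpow y (- s - 1)) * exp (Re s * \<Lambda>) = exp (- ln y) * exp (- Re s * (ln y - \<Lambda>))"
        by (simp add: norm_cpow algebra_simps flip: exp_add)
      also have "\<dots> \<le> exp (- ln y) * exp R"
        using reb[OF sg] y(1) unfolding \<Lambda>_def[symmetric] by (intro mult_left_mono expR) auto
      also have "exp (- ln y) = 1 / y" using y(2) by (simp add: exp_minus inverse_eq_divide)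
      finally show ?thesis .
    qed
    define A0 where "A0 = 4 * exp R / c * inverse (D n) * exp (- N * h0)"
    have A0: "A0 \<ge> 0" using cC D[of n] by (simp add: A0_def)
    define F where "F t = rgamprod M K \<nu> \<nu>' n t * cpow x t / (nodepoly n t * (s - t))" for t
    have CF: "norm (contour_integral (rect n (N * b)) F) \<le> A0 * \<eta> n * (1 / sqrt \<bar>u / N - b\<bar> + 1 / sqrt \<bar>u / N + b\<bar> + 1)"
      unfolding N_def
    proof (rule cb[OF n1(1) A0 u])
      have B: "(real n + 5) * b > 0" using b0 by simp
      have "F holomorphic_on - (insert s (of_nat ` {..<n}))"
        unfolding F_def by (intro holomorphic_intros holomorphic_rgamprod holomorphic_nodepoly) (auto simp: nodepoly_eq_0_iff)
      \<comment> \<open>The nodes lie strictly inside. The abscissa of s is strictly between the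
        sides, so s could meet the rectangle only at height N b in modulus.\<close>
      moreover have "path_image (rect n ((real n + 5) * b)) \<subseteq> - (insert s (of_nat ` {..<n}))"
        unfolding path_image_rect[OF n1(2) B] using sg u n0[OF n] B
        by (auto simp: in_cbox_complex_iff in_box_complex_iff strip_def s_def N_def)
      ultimately show "continuous_on (path_image (rect n ((real n + 5) * b))) F"
        by (meson continuous_on_subset holomorphic_on_imp_continuous_on)
      fix t assume t: "(n, t) \<in> strip" "\<bar>Im t\<bar> \<ge> 1 \<or> cos (2 * pi * Re t) = - 1"
      define X V where "X = (Re t + 3) / N" and "V = Im t / N"
      define G where "G = norm (gamprod M K \<nu> \<nu>' n t * nodepoly n t)"
      define W where "W = wt \<alpha> \<beta> X V"
      have X: "0 < X" "X < 1" using t(1) N by (auto simp: X_def strip_def N_def field_simps)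
      have W: "W > 0" unfolding W_def wt_def using X by (auto simp: complex_eq_iff intro!: mult_pos_pos)
      define T where "T = c * (D n * W * exp (N * phase p q l X V) * exp (Re t * \<Lambda>) * (1/4))"
      have T: "T > 0" unfolding T_def using cC D[of n] W by (intro mult_pos_pos) auto
      have "T \<le> c * (D n * W * exp (N * phase p q l X V) * exp (Re t * \<Lambda>) * sin_wt t)"
        unfolding T_def using sin_wt_ge[OF t(2)] cC D[of n] W by (intro mult_left_mono mult_nonneg_nonneg) auto
      also have "\<dots> \<le> G" using lower[OF t(1)] unfolding G_def N_def[symmetric] X_def[symmetric] V_def[symmetric] W_def \<Lambda>_def by simp
      finally have TG: "T \<le> G" .
      have "norm (F t) = exp (Re t * ln x) * inverse G * inverse (norm (s - t))"
        by (simp add: F_def G_def rgamprod_eq_inverse norm_mult norm_divide norm_inverse norm_cpow divide_inverse inverse_mult_distrib mult_ac)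
      also have "\<dots> \<le> exp (Re t * ln x) * inverse T * inverse (norm (s - t))"
        using TG T by (intro mult_right_mono mult_left_mono le_imp_inverse_le) auto
      also have "\<dots> = (exp (Re t * (ln x - \<Lambda>))) * (4 / c * inverse (D n) * inverse W * exp (- N * phase p q l X V) * inverse (norm (s - t)))"
      proof -
        have "Re t * ln x = Re t * (ln x - \<Lambda>) + Re t * \<Lambda>" by (simp add: right_diff_distrib)
        then have e1: "exp (Re t * ln x) = exp (Re t * (ln x - \<Lambda>)) * exp (Re t * \<Lambda>)" by (simp only: exp_add)
        have e2: "inverse T = (4 / c * inverse (D n) * inverse W * exp (- N * phase p q l X V)) * exp (- (Re t * \<Lambda>))"
        proof -
          have "inverse (c' * (d * w * g * h * (1/4))) = 4 / c' * inverse d * inverse w * inverse g * inverse h" for c' d w g h :: real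
            by (simp only: divide_inverse inverse_mult_distrib inverse_inverse_eq mult_1_left mult_ac)
          moreover have "exp (- N * phase p q l X V) = inverse (exp (N * phase p q l X V))" by (simp add: exp_minus)
          ultimately show ?thesis unfolding T_def exp_minus by (simp only:)
        qed
        have e3: "exp (Re t * \<Lambda>) * exp (- (Re t * \<Lambda>)) = 1" by (simp flip: exp_add)
        have "exp (Re t * ln x) * inverse T * inverse (norm (s - t)) = (exp (Re t * \<Lambda>) * exp (- (Re t * \<Lambda>))) *
          ((exp (Re t * (ln x - \<Lambda>))) * (4 / c * inverse (D n) * inverse W * exp (- N * phase p q l X V) * inverse (norm (s - t))))"
          unfolding e1 e2 by (simp only: mult_ac)
        then show ?thesis unfolding e3 by simp
      qed
      also have "\<dots> \<le> exp R * (4 / c * inverse (D n) * inverse W * exp (- N * phase p q l X V) * inverse (norm (s - t)))"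
        using reb[OF t(1)] x cC D[of n] W unfolding \<Lambda>_def[symmetric] by (intro mult_right_mono expR) auto
      also have "\<dots> = A0 * inverse W * exp (- N * (phase p q l X V - h0)) * inverse (norm (s - t))"
      proof -
        have "- N * phase p q l X V = - N * h0 + - N * (phase p q l X V - h0)" by (simp add: algebra_simps)
        then have e1: "exp (- N * phase p q l X V) = exp (- N * h0) * exp (- N * (phase p q l X V - h0))" by (simp only: exp_add)
        have "4 * exp R / c = exp R * (4 / c)" by simp
        then show ?thesis unfolding A0_def e1 by (simp only: mult_ac)
      qed
      finally show "norm (F t) \<le> rect_model \<alpha> \<beta> A0 n u t"
        by (simp only: W_def X_def V_def N_def h0_def s_def)
    qed
    define Q where "Q = 1 / sqrt \<bar>v - b\<bar> + 1 / sqrt \<bar>v + b\<bar> + 1"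
    have Q: "Q \<ge> 0" by (auto simp: Q_def intro!: add_nonneg_nonneg)
    have "norm (remainder M K \<nu> \<nu>' n x y (N * b) s) = (norm (gamprod M K \<nu> \<nu>' n s * nodepoly n s) * norm (cpow y (- s - 1))) * (1 / (2 * pi)) * norm (contour_integral (rect n (N * b)) F)"
      by (simp add: remainder_def F_def[abs_def] norm_mult norm_divide)
    also have "\<dots> \<le> (norm (gamprod M K \<nu> \<nu>' n s * nodepoly n s) * norm (cpow y (- s - 1))) * 1 * norm (contour_integral (rect n (N * b)) F)"
      using pi_ge_two by (intro mult_right_mono mult_left_mono) auto
    also have "\<dots> \<le> ((C * (D n * exp (N * h0) * (Cv / (1 + v\<^sup>2)) * exp (Re s * \<Lambda>))) * norm (cpow y (- s - 1))) * 1 * (A0 * \<bar>\<eta> n\<bar> * Q)"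
    proof (intro mult_mono mult_nonneg_nonneg A order_refl)
      have "A0 * \<eta> n * Q \<le> A0 * \<bar>\<eta> n\<bar> * Q" using A0 Q by (intro mult_right_mono mult_left_mono) auto
      then show "norm (contour_integral (rect n (N * b)) F) \<le> A0 * \<bar>\<eta> n\<bar> * Q" using CF by (simp add: Q_def v_def)
    qed (use cC D[of n] Cv in auto)
    also have "\<dots> = (C * D n * exp (N * h0) * (Cv / (1 + v\<^sup>2)) * (A0 * \<bar>\<eta> n\<bar> * Q)) * (norm (cpow y (- s - 1)) * exp (Re s * \<Lambda>))"
      by (simp add: mult_ac)
    also have "\<dots> \<le> (C * D n * exp (N * h0) * (Cv / (1 + v\<^sup>2)) * (A0 * \<bar>\<eta> n\<bar> * Q)) * (1 / y * exp R)"
      using cC D[of n] Cv A0 Q by (intro mult_left_mono Py) (auto intro!: mult_nonneg_nonneg)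
    also have "\<dots> = 1 / y * (\<epsilon> n * sing_wt b v)"
    proof -
      have e1: "exp (N * h0) * exp (- N * h0) = 1" by (simp flip: exp_add)
      have e2: "D n * inverse (D n) = 1" using D[of n] by simp
      have "C * D n * exp (N * h0) * (Cv / (1 + v\<^sup>2)) * (A0 * \<bar>\<eta> n\<bar> * Q) =
        (exp (N * h0) * exp (- N * h0)) * (D n * inverse (D n)) * ((C * Cv * (4 * exp R / c)) * \<bar>\<eta> n\<bar> * (1 / (1 + v\<^sup>2) * Q))"
        unfolding A0_def divide_inverse mult_1_left by (simp only: mult_ac)
      also have "\<dots> = (C * Cv * (4 * exp R / c)) * \<bar>\<eta> n\<bar> * (1 / (1 + v\<^sup>2) * Q)"
        unfolding e1 e2 by (simp only: mult_1_left)
      finally have e3: "C * D n * exp (N * h0) * (Cv / (1 + v\<^sup>2)) * (A0 * \<bar>\<eta> n\<bar> * Q) =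
        (C * Cv * (4 * exp R / c)) * \<bar>\<eta> n\<bar> * (1 / (1 + v\<^sup>2) * Q)" .
      show ?thesis
        unfolding e3 \<epsilon>_def sing_wt_def Q_def[symmetric] by (simp only: mult_ac)
    qed
    finally show ?thesis by (simp add: N_def s_def v_def)
  qed
  moreover have "max n0 1 \<ge> 1" by simp
  ultimately show ?thesis using \<epsilon>0 n0 by (intro that[of \<epsilon> "max n0 1"]) auto
qed

end

section \<open>The bulk scaling limit\<close>

lemma bulk_saddle:
  fixes M K :: nat and \<phi> :: real
  assumes M: "M \<ge> 1" and K: "K \<ge> 1" and phi: "0 < \<phi>" "\<phi> < pi / (real M + 1)"
  defines "b \<equiv> pi * bulk_point M K \<phi> * bulk_density M K \<phi>"
  shows "saddle (real M + 1) (real K + 1) (ln (bulk_point M K \<phi>)) (b * cot \<phi>) b"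
    and "bulk_point M K \<phi> > 0" and "bulk_density M K \<phi> > 0"
proof -
  \<comment> \<open>the triangle with vertices $0$, $1$ and the saddle point has the angles \<open>\<phi>\<close> at $0$ and \<open>\<theta>\<close> at $1$\<close>
  define p q where "p = real M + 1" and "q = real K + 1"
  define \<theta> where "\<theta> = (pi - p * \<phi>) / q"
  define S where "S = sin (\<theta> + \<phi>)"
  have pq: "p \<ge> 2" "q \<ge> 2" using M K by (auto simp: p_def q_def)
  have pphi: "p * \<phi> < pi" using phi pq by (simp add: p_def field_simps)
  \<comment> \<open>p, q >= 2 make both angles acute, so that \<open>arctan\<close> recovers them
    from their tangents.\<close>
  have "2 * \<phi> \<le> p * \<phi>" using pq phi by (intro mult_right_mono) auto
  then have phi2: "\<phi> < pi / 2" using pphi by simp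
  have th0: "\<theta> > 0" using pphi pq by (simp add: \<theta>_def)
  have pphi0: "p * \<phi> > 0" using pq phi by simp
  have "\<theta> * 2 \<le> \<theta> * q" using pq th0 by (intro mult_left_mono) auto
  also have "\<theta> * q = pi - p * \<phi>" using pq by (simp add: \<theta>_def)
  finally have th2: "\<theta> < pi / 2" using pphi0 by simp
  have sp: "sin \<phi> > 0" "sin \<theta> > 0" "cos \<phi> > 0" "cos \<theta> > 0" "S > 0"
    using phi phi2 th0 th2 by (auto simp: S_def intro!: sin_gt_zero cos_gt_zero_pi)
  have KM: "real K = q - 1" "real M = p - 1" by (simp_all add: p_def q_def)
  have arg1: "(real M + 1) / (real K + 1) * \<phi> + real K / (real K + 1) * pi = pi - \<theta>"
    using pq unfolding \<theta>_def p_def[symmetric] q_def[symmetric] KM by (simp add: field_simps)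
  have arg2: "(real M - real K) / (real K + 1) * \<phi> + real K / (real K + 1) * pi = pi - (\<theta> + \<phi>)"
    using pq unfolding \<theta>_def p_def[symmetric] q_def[symmetric] KM by (simp add: field_simps)
  \<comment> \<open>Regrouped, this is (sin \<theta> / S)^(M+1) / (sin \<phi> / S)^(K+1), the
    quotient of powers of |z0| and |1 - z0|; its logarithm is \<open>mod_eq\<close>.\<close>
  have bp: "bulk_point M K \<phi> = sin \<theta> ^ (M + 1) / (sin \<phi> ^ (K + 1) * S powi (int M - int K))"
    unfolding bulk_point_def arg1 arg2 by (simp add: S_def)
  show bp0: "bulk_point M K \<phi> > 0" unfolding bp using sp by (intro divide_pos_pos mult_pos_pos zero_less_power zero_less_power_int) auto
  have bd: "bulk_density M K \<phi> = 1 / (pi * bulk_point M K \<phi>) * (sin \<theta> / S) * sin \<phi>"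
    unfolding bulk_density_def arg1 arg2 by (simp add: S_def)
  then show "bulk_density M K \<phi> > 0" using sp bp0 by simp
  \<comment> \<open>The altitude of the triangle over the side from 0 to 1; its foot is a = b cot
    \<phi>.\<close>
  have b: "b = sin \<theta> * sin \<phi> / S" unfolding b_def bd using bp0 by simp
  have a: "b * cot \<phi> = sin \<theta> * cos \<phi> / S" unfolding b using sp by (simp add: cot_def)
  have Ssum: "S = sin \<theta> * cos \<phi> + cos \<theta> * sin \<phi>" by (simp add: S_def sin_add)
  have a': "1 - b * cot \<phi> = cos \<theta> * sin \<phi> / S"
  proof -
    have "1 - b * cot \<phi> = (S - sin \<theta> * cos \<phi>) / S" unfolding a using sp by (simp add: diff_divide_distrib)
    then show ?thesis by (simp add: Ssum)
  qed
  have "b / (b * cot \<phi>) = tan \<phi>" using sp unfolding a unfolding b by (simp add: tan_def cot_def)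
  then have at1: "arctan (b / (b * cot \<phi>)) = \<phi>" using phi phi2 by (simp add: arctan_tan)
  have "b / (1 - b * cot \<phi>) = tan \<theta>" using sp unfolding a' unfolding b by (simp add: tan_def)
  then have at2: "arctan (b / (1 - b * cot \<phi>)) = \<theta>" using th0 th2 by (simp add: arctan_tan)
  \<comment> \<open>The law of sines: the side from 0 to the saddle point has length sin \<theta> /
    S, and below the one from 1 has length sin \<phi> / S.\<close>
  have m1: "(b * cot \<phi>)\<^sup>2 + b\<^sup>2 = (sin \<theta> / S)\<^sup>2"
  proof -
    have "(b * cot \<phi>)\<^sup>2 + b\<^sup>2 = (sin \<theta> / S)\<^sup>2 * ((cos \<phi>)\<^sup>2 + (sin \<phi>)\<^sup>2)"
      unfolding a unfolding b by (simp only: power_divide power_mult_distrib distrib_left times_divide_eq_left times_divide_eq_right mult_ac)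
    then show ?thesis by simp
  qed
  have m2: "(1 - b * cot \<phi>)\<^sup>2 + b\<^sup>2 = (sin \<phi> / S)\<^sup>2"
  proof -
    have "(1 - b * cot \<phi>)\<^sup>2 + b\<^sup>2 = (sin \<phi> / S)\<^sup>2 * ((cos \<theta>)\<^sup>2 + (sin \<theta>)\<^sup>2)"
      unfolding a' unfolding b by (simp only: power_divide power_mult_distrib distrib_left times_divide_eq_left times_divide_eq_right mult_ac)
    then show ?thesis by simp
  qed
  have lnsq: "ln ((x / S)\<^sup>2) = 2 * (ln x - ln S)" if "x > 0" for x
    using that sp by (simp add: ln_realpow ln_div)
  have lnpowi: "ln (S powi k) = real_of_int k * ln S" for k
    using sp by (simp add: powr_real_of_int'[symmetric] ln_powr)
  have lnb: "ln (bulk_point M K \<phi>) = p * ln (sin \<theta>) - q * ln (sin \<phi>) - (p - q) * ln S"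
  proof -
    have "ln (bulk_point M K \<phi>) = ln (sin \<theta> ^ (M + 1)) - (ln (sin \<phi> ^ (K + 1)) + ln (S powi (int M - int K)))"
      unfolding bp using sp by (subst ln_div) (auto simp: ln_mult zero_less_power_int)
    also have "\<dots> = p * ln (sin \<theta>) - q * ln (sin \<phi>) - (p - q) * ln S"
      using sp unfolding lnpowi by (subst (1 2) ln_realpow) (auto simp: p_def q_def algebra_simps)
    finally show ?thesis .
  qed
  show "saddle (real M + 1) (real K + 1) (ln (bulk_point M K \<phi>)) (b * cot \<phi>) b"
    unfolding p_def[symmetric] q_def[symmetric]
  proof
    show "b > 0" unfolding b using sp by simp
    show "0 < b * cot \<phi>" unfolding a using sp by simp
    have "1 - b * cot \<phi> > 0" unfolding a' using sp by simp
    then show "b * cot \<phi> < 1" by simp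
    show "p * arctan (b / (b * cot \<phi>)) + q * arctan (b / (1 - b * cot \<phi>)) = pi"
      unfolding at1 at2 using pq by (simp add: \<theta>_def)
    show "ln (bulk_point M K \<phi>) = p * ln ((b * cot \<phi>)\<^sup>2 + b\<^sup>2) / 2 - q * ln ((1 - b * cot \<phi>)\<^sup>2 + b\<^sup>2) / 2"
      unfolding m1 m2 lnsq[OF sp(1)] lnsq[OF sp(2)] lnb by (simp add: field_simps)
  qed (use pq in auto)
qed

text \<open>Choosing a violating point at every index where one exists reduces uniformity to
  convergence along arbitrary sequences in S. The limit can then be computed for sequences of \<xi>
  and \<eta> that are merely bounded.\<close>

lemma uniform_limit_sequentiallyI:
  fixes f :: "nat \<Rightarrow> 'a \<Rightarrow> 'b :: real_normed_vector"
  assumes "\<And>z. (\<And>n. z n \<in> S) \<Longrightarrow> (\<lambda>n. f n (z n) - g (z n)) \<longlonglongrightarrow> 0"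
  shows "uniform_limit S f g sequentially"
proof (cases "S = {}")
  case True
  then show ?thesis by (simp add: uniform_limit_iff)
next
  case False
  then obtain w where w: "w \<in> S" by blast
  show ?thesis
    unfolding uniform_limit_iff
  proof (intro allI impI)
    fix e :: real assume e: "e > 0"
    define z where "z n = (if \<exists>x\<in>S. \<not> dist (f n x) (g x) < e then SOME x. x \<in> S \<and> \<not> dist (f n x) (g x) < e else w)" for n
    have z: "z n \<in> S \<and> ((\<exists>x\<in>S. \<not> dist (f n x) (g x) < e) \<longrightarrow> \<not> dist (f n (z n)) (g (z n)) < e)" for n
    proof (cases "\<exists>x\<in>S. \<not> dist (f n x) (g x) < e")
      case True
      then have "z n \<in> S \<and> \<not> dist (f n (z n)) (g (z n)) < e"
        unfolding z_def using someI_ex[of "\<lambda>x. x \<in> S \<and> \<not> dist (f n x) (g x) < e"] by auto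
      then show ?thesis by blast
    qed (use w in \<open>auto simp: z_def\<close>)
    then have "(\<lambda>n. f n (z n) - g (z n)) \<longlonglongrightarrow> 0" by (intro assms) blast
    then have "\<forall>\<^sub>F n in sequentially. dist (f n (z n) - g (z n)) 0 < e" using e by (rule tendstoD)
    then show "\<forall>\<^sub>F n in sequentially. \<forall>x\<in>S. dist (f n x) (g x) < e"
      by eventually_elim (use z in \<open>auto simp: dist_norm\<close>)
  qed
qed

section \<open>The residue term and its limit\<close>

lemma integral_exp_line:
  fixes \<mu> B :: real
  assumes "B > 0"
  shows "(LINT u|lborel. indicator {- B..B} u *\<^sub>R exp (\<i> * of_real (u * \<mu>))) = of_real (2 * B * sinc (B * \<mu>))"
proof -
  let ?f = "\<lambda>u. exp (\<i> * of_real (u * \<mu>))"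
  have "continuous_on {- B..B} ?f" by (intro continuous_intros)
  then have "set_integrable lborel {- B..B} ?f"
    unfolding set_integrable_def by (intro borel_integrable_compact) auto
  then have 1: "(LINT u|lborel. indicator {- B..B} u *\<^sub>R ?f u) = integral {- B..B} ?f"
    using set_borel_integral_eq_integral(2) by (auto simp: set_lebesgue_integral_def)
  have "(?f has_integral of_real (2 * B * sinc (B * \<mu>))) {- B..B}"
  proof (cases "\<mu> = 0")
    case True
    then show ?thesis using has_integral_const_real[of "1::complex" "- B" B] assms by (simp add: scaleR_conv_of_real)
  next
    case False
    have ii: "\<i> * (w * \<i>) = - w" for w :: complex by (simp add: complex_eq_iff)
    have "((\<lambda>u. ?f u / (\<i> * of_real \<mu>)) has_vector_derivative ?f u) (at u within {- B..B})" for u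
    proof -
      have "((\<lambda>z. exp (\<i> * (z * of_real \<mu>)) / (\<i> * of_real \<mu>)) has_field_derivative exp (\<i> * (of_real u * of_real \<mu>))) (at (of_real u))"
        using False ii by (auto intro!: derivative_eq_intros)
      then have "((\<lambda>z. exp (\<i> * (of_real z * of_real \<mu>)) / (\<i> * of_real \<mu>)) has_vector_derivative exp (\<i> * (of_real u * of_real \<mu>))) (at u)"
        by (rule has_vector_derivative_real_field)
      then show ?thesis by (simp add: has_vector_derivative_at_within)
    qed
    then have "(?f has_integral ?f B / (\<i> * of_real \<mu>) - ?f (- B) / (\<i> * of_real \<mu>)) {- B..B}"
      using assms by (intro fundamental_theorem_of_calculus) auto
    moreover have "?f B / (\<i> * of_real \<mu>) - ?f (- B) / (\<i> * of_real \<mu>) = of_real (2 * B * sinc (B * \<mu>))"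
    proof -
      have "?f B - ?f (- B) = 2 * \<i> * of_real (sin (B * \<mu>))"
        by (simp add: complex_eq_iff Re_exp Im_exp)
      then have "?f B / (\<i> * of_real \<mu>) - ?f (- B) / (\<i> * of_real \<mu>) = 2 * of_real (sin (B * \<mu>)) / of_real \<mu>"
        by (simp flip: diff_divide_distrib)
      also have "\<dots> = of_real (2 * B * (sin (B * \<mu>) / (B * \<mu>)))" using assms by simp
      finally show ?thesis using False assms by simp
    qed
    ultimately show ?thesis by simp
  qed
  then show ?thesis using 1 by (simp add: integral_unique)
qed

lemma sine_kernel_eq_sinc: "sine_kernel x y = sinc (pi * (x - y))"
  by (simp add: sine_kernel_def)

lemma abs_sinc_le_1: "\<bar>sinc t\<bar> \<le> 1"
proof (cases "t = 0")
  case False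
  then have "\<bar>sin t\<bar> / \<bar>t\<bar> \<le> 1" using abs_sin_x_le_abs_x[of t] by simp
  then show ?thesis using False by (simp add: abs_divide)
qed simp

text \<open>Neither sequence has to converge, so uniform continuity on a compact interval containing
  both replaces continuity at a limit.\<close>

lemma sinc_diff_tendsto:
  assumes "(\<lambda>n. s n - t n) \<longlonglongrightarrow> 0" "\<And>n. \<bar>t n\<bar> \<le> T"
  shows "(\<lambda>n. sinc (s n) - sinc (t n)) \<longlonglongrightarrow> 0"
proof -
  have "Bseq (\<lambda>n. s n - t n)" using assms(1) by (intro convergent_imp_Bseq convergentI)
  then obtain L where "\<forall>n. norm (s n - t n) \<le> L" unfolding Bseq_def by blast
  then have L: "\<bar>s n - t n\<bar> \<le> L" for n by simp
  let ?S = "{- (T + L)..T + L}"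
  have "uniformly_continuous_on ?S sinc"
    by (intro compact_uniformly_continuous continuous_on_sinc[OF continuous_on_id]) auto
  moreover have "s n \<in> ?S" "t n \<in> ?S" for n using L[of n] assms(2)[of n] by (auto simp: abs_le_iff)
  moreover have "(\<lambda>n. dist (s n) (t n)) \<longlonglongrightarrow> 0" using assms(1) by (simp add: dist_real_def tendsto_rabs_zero_iff)
  ultimately have "(\<lambda>n. dist (sinc (s n)) (sinc (t n))) \<longlonglongrightarrow> 0"
    unfolding uniformly_continuous_on_sequentially by blast
  then show ?thesis by (simp only: dist_real_def tendsto_rabs_zero_iff)
qed

text \<open>From |ln(1+z) - z| <= 2 z^2 for |z| <= 1/2. The first conclusion gives the limit of the
  residue term, the third the admissible error R/n with R = 2B/r.\<close>

lemma ln_perturb_tendsto: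
  fixes \<xi> :: "nat \<Rightarrow> real"
  assumes r: "r > 0" and bd: "\<And>n. \<bar>\<xi> n\<bar> \<le> B"
  shows "(\<lambda>n. real n * ln (1 + \<xi> n / (real n * r)) - \<xi> n / r) \<longlonglongrightarrow> 0"
    and "\<forall>\<^sub>F n in sequentially. \<bar>\<xi> n / (real n * r)\<bar> \<le> 1/2"
    and "\<forall>\<^sub>F n in sequentially. \<bar>ln (1 + \<xi> n / (real n * r))\<bar> \<le> (2 * B / r) / real n"
proof -
  have B: "B \<ge> 0" using bd[of 0] by simp
  have w: "\<bar>\<xi> n / (real n * r)\<bar> \<le> (B / r) / real n" for n
  proof -
    have "\<bar>\<xi> n / (real n * r)\<bar> = \<bar>\<xi> n\<bar> / (real n * r)" using r by (simp add: abs_divide abs_mult)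
    also have "\<dots> \<le> B / (real n * r)" using bd[of n] r by (intro divide_right_mono) auto
    finally show ?thesis by (simp add: mult.commute)
  qed
  have "(\<lambda>n. (B / r) / real n) \<longlonglongrightarrow> 0" by real_asymp
  then have "\<forall>\<^sub>F n in sequentially. (B / r) / real n < 1/2" by (rule order_tendstoD) simp
  then show small: "\<forall>\<^sub>F n in sequentially. \<bar>\<xi> n / (real n * r)\<bar> \<le> 1/2"
    by eventually_elim (use w in \<open>meson less_imp_le order_trans\<close>)
  show "\<forall>\<^sub>F n in sequentially. \<bar>ln (1 + \<xi> n / (real n * r))\<bar> \<le> (2 * B / r) / real n"
    using small
  proof eventually_elim
    case (elim n)
    define z where "z = \<xi> n / (real n * r)"
    have "\<bar>ln (1 + z) - z\<bar> \<le> 2 * z\<^sup>2" using elim unfolding z_def by (rule abs_ln_one_plus_x_minus_x_bound)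
    moreover have "2 * z\<^sup>2 \<le> \<bar>z\<bar>"
    proof -
      have "2 * \<bar>z\<bar> * \<bar>z\<bar> \<le> 1 * \<bar>z\<bar>" using elim unfolding z_def[symmetric] by (intro mult_right_mono) auto
      then show ?thesis by (simp add: power2_eq_square abs_mult_self_eq mult.assoc)
    qed
    ultimately have "\<bar>ln (1 + z)\<bar> \<le> 2 * \<bar>z\<bar>" by linarith
    then show ?case using w[of n] by (simp add: z_def)
  qed
  have "\<forall>\<^sub>F n in sequentially. norm (real n * ln (1 + \<xi> n / (real n * r)) - \<xi> n / r) \<le> 2 * (B / r)\<^sup>2 / real n"
    using small eventually_gt_at_top[of 0]
  proof eventually_elim
    case (elim n)
    define z where "z = \<xi> n / (real n * r)"
    have n: "real n > 0" using elim by simp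
    have "real n * ln (1 + z) - \<xi> n / r = real n * (ln (1 + z) - z)"
      using n r by (simp add: z_def right_diff_distrib)
    then have "norm (real n * ln (1 + z) - \<xi> n / r) = real n * \<bar>ln (1 + z) - z\<bar>"
      using n by (simp add: abs_mult)
    also have "\<dots> \<le> real n * (2 * z\<^sup>2)"
      using elim n unfolding z_def by (intro mult_left_mono abs_ln_one_plus_x_minus_x_bound) auto
    also have "\<dots> \<le> real n * (2 * ((B / r) / real n)\<^sup>2)"
    proof -
      have "\<bar>z\<bar>\<^sup>2 \<le> ((B / r) / real n)\<^sup>2" using w[of n] unfolding z_def by (intro power_mono) auto
      then show ?thesis using n by (intro mult_left_mono) auto
    qed
    also have "\<dots> = 2 * (B / r)\<^sup>2 / real n" using n by (simp add: power2_eq_square)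
    finally show ?case unfolding z_def .
  qed
  moreover have "(\<lambda>n. 2 * (B / r)\<^sup>2 / real n) \<longlonglongrightarrow> 0" by real_asymp
  ultimately show "(\<lambda>n. real n * ln (1 + \<xi> n / (real n * r)) - \<xi> n / r) \<longlonglongrightarrow> 0"
    by (rule Lim_null_comparison)
qed

lemma integral_sing_wt_scaled:
  assumes "N > 0"
  shows "integrable lborel (\<lambda>u. sing_wt b (u / N))" "(LINT u|lborel. sing_wt b (u / N)) = N * (LINT v|lborel. sing_wt b v)"
proof -
  have e: "sing_wt b (u / N) = sing_wt b (0 + (1 / N) * u)" for u by simp
  show "integrable lborel (\<lambda>u. sing_wt b (u / N))"
    unfolding e using assms by (intro lborel_integrable_real_affine integrable_sing_wt) auto
  have "(LINT v|lborel. sing_wt b v) = \<bar>1 / N\<bar> *\<^sub>R (LINT u|lborel. sing_wt b (0 + (1 / N) * u))"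
    by (rule lborel_integral_real_affine) (use assms in auto)
  then show "(LINT u|lborel. sing_wt b (u / N)) = N * (LINT v|lborel. sing_wt b v)"
    using assms by simp
qed

theorem theorem4p1:
  fixes M K :: nat and \<nu> \<nu>' :: "nat \<Rightarrow> nat" and \<gamma> :: "nat \<Rightarrow> real \<Rightarrow> complex"
    and x\<^sub>0 \<phi> \<rho> :: real and C :: "real set"
  assumes "M \<ge> 1" and "K \<ge> 1"
    and "\<nu> 0 = 0" and "\<nu>' 0 = 0" and "\<nu>' K = 0"
    and "\<And>n. n \<ge> 1 \<Longrightarrow> encircling_contour n (\<gamma> n)"
    and "x\<^sub>0 > 0" and "0 < \<phi>" and "\<phi> < pi / (real M + 1)"
    and "x\<^sub>0 = bulk_point M K \<phi>"
    and "\<rho> = bulk_density M K \<phi>"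
    and "compact C"
  shows "uniform_limit (C \<times> C)
     (\<lambda>n (\<xi>, \<eta>).
        of_real (exp (- pi * \<xi> * cot \<phi>) / exp (- pi * \<eta> * cot \<phi>)
                 * (real n powi (int M - int K - 1) / \<rho>))
        * correlation_kernel M K \<nu> \<nu>' n (\<gamma> n)
            (real n powi (int M - int K) * (x\<^sub>0 + \<xi> / (real n * \<rho>)))
            (real n powi (int M - int K) * (x\<^sub>0 + \<eta> / (real n * \<rho>))))
     (\<lambda>(\<xi>, \<eta>). of_real (sine_kernel \<xi> \<eta>))
     sequentially"
proof (rule uniform_limit_sequentiallyI)
  fix z :: "nat \<Rightarrow> real \<times> real" assume z: "\<And>n. z n \<in> C \<times> C"
  define \<xi> \<eta> where "\<xi> n = fst (z n)" and "\<eta> n = snd (z n)" for n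
  have z_eq: "z n = (\<xi> n, \<eta> n)" for n by (simp add: \<xi>_def \<eta>_def)
  obtain Bd where Bd: "\<And>x. x \<in> C \<Longrightarrow> \<bar>x\<bar> \<le> Bd"
    using compact_imp_bounded[OF assms(12)] by (auto simp: bounded_iff)
  have \<xi>B: "\<bar>\<xi> n\<bar> \<le> Bd" and \<eta>B: "\<bar>\<eta> n\<bar> \<le> Bd" for n
    using z[of n] by (auto simp: z_eq intro: Bd)
  have Bd0: "Bd \<ge> 0" using \<xi>B[of 0] by simp
  define b where "b = pi * x\<^sub>0 * \<rho>"
  define a where "a = b * cot \<phi>"
  define l where "l = ln x\<^sub>0"
  define p q where "p = real M + 1" and "q = real K + 1"
  \<comment> \<open>Makes the perturbation multiplicative, x0 + \<xi> / (n \<rho>) = x0 (1 + \<xi> /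
    (n r)), and satisfies b = pi r.\<close>
  define r where "r = \<rho> * x\<^sub>0"
  have \<rho>: "\<rho> > 0" using bulk_saddle(3)[OF assms(1,2,8,9)] assms(11) by simp
  have r: "r > 0" using \<rho> assms(7) by (simp add: r_def)
  have br: "b = pi * r" by (simp add: b_def r_def)
  interpret saddle p q l a b
    using bulk_saddle(1)[OF assms(1,2,8,9)] unfolding assms(10,11)[symmetric] b_def[symmetric]
    by (simp add: a_def l_def p_def q_def)
  define R where "R = 2 * Bd / r"
  have R: "R \<ge> 0" using Bd0 r by (simp add: R_def)
  obtain \<epsilon> :: "nat \<Rightarrow> real" and n0 :: nat where \<epsilon>: "\<epsilon> \<longlonglongrightarrow> 0" and n0: "n0 \<ge> 1"
    and c_in: "\<And>n. n \<ge> n0 \<Longrightarrow> - 1/2 < (real n + 5) * a - 3 \<and> (real n + 5) * a - 3 < real n - 1/2"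
    and eb: "\<And>n x y u. n \<ge> n0 \<Longrightarrow> \<bar>ln x - (l + (real M - real K) * ln (real n))\<bar> \<le> R / real n \<Longrightarrow>
      \<bar>ln y - (l + (real M - real K) * ln (real n))\<bar> \<le> R / real n \<Longrightarrow> y > 0 \<Longrightarrow> u \<noteq> 0 \<Longrightarrow> \<bar>u\<bar> \<noteq> (real n + 5) * b \<Longrightarrow>
      norm (remainder M K \<nu> \<nu>' n x y ((real n + 5) * b) (Complex ((real n + 5) * a - 3) u)) \<le> 1 / y * (\<epsilon> n * sing_wt b (u / (real n + 5)))"
    using error_bound[OF p_def q_def R, of \<nu> \<nu>'] by blast
  define X Y where "X n = 1 + \<xi> n / (real n * r)" and "Y n = 1 + \<eta> n / (real n * r)" for n
  define m where "m n = real n powi (int M - int K)" for n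
  define \<mu> where "\<mu> n = ln (X n) - ln (Y n)" for n
  define N where "N n = real n + 5" for n
  define I0 where "I0 = (LINT v|lborel. sing_wt b v)"
  define E0 where "E0 n = exp (- pi * \<xi> n * cot \<phi>) / exp (- pi * \<eta> n * cot \<phi>)" for n
  \<comment> \<open>The exact residue contribution with all prefactors, on the line with abscissa N
    a - 3 and for heights up to N b.\<close>
  define main where "main n = E0 n * exp ((N n * a - 3) * \<mu> n) * (N n / (real n * Y n)) * sinc (N n * b * \<mu> n)" for n
  define d where "d n = \<xi> n - \<eta> n" for n
  have xX: "x\<^sub>0 + \<xi> n / (real n * \<rho>) = x\<^sub>0 * X n" and yY: "x\<^sub>0 + \<eta> n / (real n * \<rho>) = x\<^sub>0 * Y n" for n
    using assms(7) \<rho> by (simp_all add: X_def Y_def r_def field_simps)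
  note Xlim = ln_perturb_tendsto[where \<xi> = \<xi> and B = Bd, OF r \<xi>B, folded X_def R_def]
  note Ylim = ln_perturb_tendsto[where \<xi> = \<eta> and B = Bd, OF r \<eta>B, folded Y_def R_def]
  have main_lim: "(\<lambda>n. main n - sinc (pi * d n)) \<longlonglongrightarrow> 0"
  proof -
    \<comment> \<open>The defect in n ln(x/y) ~ (\<xi> - \<eta>) / r.\<close>
    define e where "e n = real n * \<mu> n - d n / r" for n
    have e0: "e \<longlonglongrightarrow> 0"
    proof -
      have "(\<lambda>n. (real n * ln (X n) - \<xi> n / r) - (real n * ln (Y n) - \<eta> n / r)) \<longlonglongrightarrow> 0 - 0"
        using tendsto_diff[OF Xlim(1) Ylim(1)] .
      then show ?thesis by (simp add: e_def[abs_def] \<mu>_def d_def algebra_simps diff_divide_distrib)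
    qed
    have nz: "(\<lambda>n. c / real n) \<longlonglongrightarrow> 0" for c :: real by real_asymp
    have lim0: "(\<lambda>n. f n) \<longlonglongrightarrow> 0" if "\<forall>\<^sub>F n in sequentially. \<bar>f n\<bar> \<le> R / real n" for f :: "nat \<Rightarrow> real"
      by (rule Lim_null_comparison[OF _ nz[of R]]) (use that in simp)
    have \<mu>0: "\<mu> \<longlonglongrightarrow> 0"
      using tendsto_diff[OF lim0[OF Xlim(3)] lim0[OF Ylim(3)]] by (simp add: \<mu>_def[abs_def])
    have Y1: "Y \<longlonglongrightarrow> 1"
    proof -
      have "(\<lambda>n. exp (ln (Y n))) \<longlonglongrightarrow> exp 0" by (intro tendsto_exp lim0[OF Ylim(3)])
      moreover have "\<forall>\<^sub>F n in sequentially. exp (ln (Y n)) = Y n"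
        using Ylim(2)
      proof eventually_elim
        case (elim n)
        then have "Y n > 0" unfolding Y_def by linarith
        then show ?case by simp
      qed
      ultimately have "Y \<longlonglongrightarrow> exp 0" by (rule Lim_transform_eventually)
      then show ?thesis by simp
    qed
    have "a / r = pi * cot \<phi>" using r by (simp add: a_def br)
    then have ar: "pi * cot \<phi> = a / r" by simp
    \<comment> \<open>The role of the conjugating exponentials: on the shifted line x^s y^(-s) grows
      like exp(n a \<mu>), which is about exp((\<xi> - \<eta>) a / r), and a / r = pi cot \<phi>.
      Only a null sequence stays in the exponent.\<close>
    have z1: "E0 n * exp ((N n * a - 3) * \<mu> n) = exp (a * e n + (5 * a - 3) * \<mu> n)" for n
    proof -
      have "E0 n = exp (- (pi * cot \<phi>) * d n)" by (simp add: E0_def d_def exp_diff[symmetric] algebra_simps)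
      moreover have "- (pi * cot \<phi>) * d n + (N n * a - 3) * \<mu> n = a * e n + (5 * a - 3) * \<mu> n"
        unfolding ar by (simp add: e_def N_def algebra_simps)
      ultimately show ?thesis by (metis exp_add)
    qed
    have "(\<lambda>n. exp (a * e n + (5 * a - 3) * \<mu> n)) \<longlonglongrightarrow> exp (a * 0 + (5 * a - 3) * 0)"
      by (intro tendsto_intros e0 \<mu>0)
    then have P1: "(\<lambda>n. exp (a * e n + (5 * a - 3) * \<mu> n)) \<longlonglongrightarrow> 1" by simp
    have "(\<lambda>n. N n / real n) \<longlonglongrightarrow> 1" unfolding N_def by real_asymp
    from tendsto_divide[OF this Y1] have P2: "(\<lambda>n. N n / (real n * Y n)) \<longlonglongrightarrow> 1" by simp
    have P: "(\<lambda>n. exp (a * e n + (5 * a - 3) * \<mu> n) * (N n / (real n * Y n)) - 1) \<longlonglongrightarrow> 0"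
      using tendsto_diff[OF tendsto_mult[OF P1 P2] tendsto_const[of 1]] by simp
    \<comment> \<open>The frequency is right because b / r = pi.\<close>
    have S: "(\<lambda>n. sinc (N n * b * \<mu> n) - sinc (pi * d n)) \<longlonglongrightarrow> 0"
    proof (rule sinc_diff_tendsto)
      have "(\<lambda>n. b * e n + 5 * b * \<mu> n) \<longlonglongrightarrow> b * 0 + 5 * b * 0" by (intro tendsto_intros e0 \<mu>0)
      moreover have "b * e n + 5 * b * \<mu> n = N n * b * \<mu> n - pi * d n" for n
        using r by (simp add: e_def N_def br algebra_simps)
      ultimately show "(\<lambda>n. N n * b * \<mu> n - pi * d n) \<longlonglongrightarrow> 0" by simp
      show "\<bar>pi * d n\<bar> \<le> pi * (2 * Bd)" for n
        using \<xi>B[of n] \<eta>B[of n] by (simp add: abs_mult d_def)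
    qed
    have "(\<lambda>n. (exp (a * e n + (5 * a - 3) * \<mu> n) * (N n / (real n * Y n)) - 1) * sinc (N n * b * \<mu> n)) \<longlonglongrightarrow> 0"
    proof (rule Lim_null_comparison[OF _ tendsto_rabs_zero[OF P]], rule always_eventually, rule allI)
      fix n
      show "norm ((exp (a * e n + (5 * a - 3) * \<mu> n) * (N n / (real n * Y n)) - 1) * sinc (N n * b * \<mu> n))
        \<le> \<bar>exp (a * e n + (5 * a - 3) * \<mu> n) * (N n / (real n * Y n)) - 1\<bar>"
        using abs_sinc_le_1[of "N n * b * \<mu> n"] by (simp only: real_norm_def abs_mult) (intro mult_left_le, auto)
    qed
    from tendsto_add[OF this S] show ?thesis
      unfolding main_def z1 by (simp only: algebra_simps) simp
  qed
  have err_lim: "(\<lambda>n. exp (2 * pi * \<bar>cot \<phi>\<bar> * Bd) / (\<rho> * x\<^sub>0) * (\<epsilon> n * (2 * (N n / real n) * I0))) \<longlonglongrightarrow> 0"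
  proof -
    have "(\<lambda>n. N n / real n) \<longlonglongrightarrow> 1" unfolding N_def by real_asymp
    then have "(\<lambda>n. exp (2 * pi * \<bar>cot \<phi>\<bar> * Bd) / (\<rho> * x\<^sub>0) * (\<epsilon> n * (2 * (N n / real n) * I0))) \<longlonglongrightarrow>
        exp (2 * pi * \<bar>cot \<phi>\<bar> * Bd) / (\<rho> * x\<^sub>0) * (0 * (2 * 1 * I0))"
      using \<rho> assms(7) by (intro tendsto_intros \<epsilon>) auto
    then show ?thesis by simp
  qed
  let ?ker = "\<lambda>n. correlation_kernel M K \<nu> \<nu>' n (\<gamma> n) (m n * (x\<^sub>0 * X n)) (m n * (x\<^sub>0 * Y n))"
  let ?A = "\<lambda>n. E0 n * (real n powi (int M - int K - 1) / \<rho>)"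
  have bound: "\<forall>\<^sub>F n in sequentially. norm (of_real (?A n) * ?ker n - of_real (main n)) \<le>
      exp (2 * pi * \<bar>cot \<phi>\<bar> * Bd) / (\<rho> * x\<^sub>0) * (\<epsilon> n * (2 * (N n / real n) * I0))"
    using eventually_ge_at_top[of n0] Xlim(2,3) Ylim(2,3)
  proof eventually_elim
    case (elim n)
    have n: "n \<ge> 1" "real n > 0" using elim(1) n0 by auto
    have XY: "X n > 0" "Y n \<ge> 1/2" using elim(2,4) unfolding X_def Y_def by linarith+
    define x y B c where "x = m n * (x\<^sub>0 * X n)" and "y = m n * (x\<^sub>0 * Y n)" and "B = N n * b" and "c = N n * a - 3"
    have mpos: "m n > 0" using n by (simp add: m_def zero_less_power_int)
    have lnm: "ln (m n) = (real M - real K) * ln (real n)"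
      using n by (simp add: m_def powr_real_of_int'[symmetric] ln_powr)
    have xy: "x > 0" "y > 0" using mpos assms(7) XY by (auto simp: x_def y_def)
    have lnx: "ln x - (l + (real M - real K) * ln (real n)) = ln (X n)" "ln y - (l + (real M - real K) * ln (real n)) = ln (Y n)"
      using mpos assms(7) XY by (simp_all add: x_def y_def ln_mult lnm l_def)
    have B0: "B > 0" using b0 by (simp add: B_def N_def)
    have Nn: "N n > 0" by (simp add: N_def)
    have cc: "- 1/2 < c" "c < real n - 1/2" using c_in[OF elim(1)] by (auto simp: c_def N_def)
    obtain E where E: "integrable lborel E" and ker: "correlation_kernel M K \<nu> \<nu>' n (\<gamma> n) x y = 1 / (2 * of_real pi) *
       ((LINT u|lborel. indicator {- B..B} u *\<^sub>R (cpow x (Complex c u) * cpow y (- Complex c u - 1))) + (LINT u|lborel. E u))"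
      and Eerr: "\<And>u. u \<noteq> 0 \<Longrightarrow> \<bar>u\<bar> \<noteq> B \<Longrightarrow> E u = remainder M K \<nu> \<nu>' n x y B (Complex c u)"
      unfolding remainder_def using kernel_split[where \<nu> = \<nu> and \<nu>' = \<nu>' and K = K and \<gamma> = "\<gamma> n", OF assms(1) n(1) assms(3) xy assms(6)[OF n(1)] cc B0] by blast
    have pwxy: "cpow x (Complex c u) * cpow y (- Complex c u - 1) = of_real (exp (c * \<mu> n) / y) * exp (\<i> * of_real (u * \<mu> n))" for u
    proof -
      have lam: "\<mu> n = ln x - ln y" using lnx by (simp add: \<mu>_def)
      have "cpow x (Complex c u) * cpow y (- Complex c u - 1) = exp (Complex c u * of_real (\<mu> n) - of_real (ln y))"
        by (simp add: cpow_def lam algebra_simps flip: exp_add)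
      also have "Complex c u * of_real (\<mu> n) - of_real (ln y) = of_real (c * \<mu> n - ln y) + \<i> * of_real (u * \<mu> n)"
        by (simp add: complex_eq_iff)
      also have "exp (of_real (c * \<mu> n - ln y) + \<i> * of_real (u * \<mu> n)) = of_real (exp (c * \<mu> n - ln y)) * exp (\<i> * of_real (u * \<mu> n))"
        by (simp only: exp_add exp_of_real)
      also have "exp (c * \<mu> n - ln y) = exp (c * \<mu> n) / y" using xy by (simp add: exp_diff)
      finally show ?thesis .
    qed
    have "(LINT u|lborel. indicator {- B..B} u *\<^sub>R (cpow x (Complex c u) * cpow y (- Complex c u - 1)))
      = (LINT u|lborel. of_real (exp (c * \<mu> n) / y) * (indicator {- B..B} u *\<^sub>R exp (\<i> * of_real (u * \<mu> n))))"
      unfolding pwxy by (intro Bochner_Integration.integral_cong refl) (simp add: scaleR_conv_of_real mult_ac)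
    also have "\<dots> = of_real (exp (c * \<mu> n) / y) * of_real (2 * B * sinc (B * \<mu> n))"
      by (subst integral_mult_right_zero) (simp only: integral_exp_line[OF B0])
    finally have Lmain: "(LINT u|lborel. indicator {- B..B} u *\<^sub>R (cpow x (Complex c u) * cpow y (- Complex c u - 1)))
      = of_real (exp (c * \<mu> n) / y * (2 * B * sinc (B * \<mu> n)))" by simp
    have powm: "real n powi (int M - int K - 1) = m n / real n"
      using n by (simp add: m_def power_int_diff)
    have yinv: "real n powi (int M - int K - 1) / \<rho> / y = 1 / (real n * Y n * (\<rho> * x\<^sub>0))"
      unfolding powm y_def using mpos by (simp add: field_simps)
    \<comment> \<open>The powers of n cancel down to 1/n, and B / pi = N \<rho> x0 removes the
      density, so the factor N / (n Y) remains.\<close>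
    have mainA: "?A n * (1 / (2 * pi)) * (exp (c * \<mu> n) / y * (2 * B * sinc (B * \<mu> n))) = main n"
    proof -
      have "?A n * (1 / (2 * pi)) * (exp (c * \<mu> n) / y * (2 * B * sinc (B * \<mu> n)))
        = E0 n * exp (c * \<mu> n) * (real n powi (int M - int K - 1) / \<rho> / y) * (B / pi) * sinc (B * \<mu> n)"
        by (simp only: divide_inverse inverse_mult_distrib) (simp add: mult_ac)
      also have "\<dots> = E0 n * exp (c * \<mu> n) * (N n / (real n * Y n)) * sinc (B * \<mu> n)"
      proof -
        have "1 / (real n * Y n * (\<rho> * x\<^sub>0)) * (B / pi) = N n / (real n * Y n)"
          using r unfolding B_def br r_def[symmetric] by simp
        then show ?thesis unfolding yinv by (metis mult.assoc)
      qed
      finally show ?thesis by (simp only: main_def c_def B_def)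
    qed
    have diff: "of_real (?A n) * ?ker n - of_real (main n) = of_real (?A n * (1 / (2 * pi))) * (LINT u|lborel. E u)"
      unfolding x_def[symmetric] y_def[symmetric] ker Lmain mainA[symmetric]
      by (simp add: distrib_left)
    have Ebd: "norm (LINT u|lborel. E u) \<le> 1 / y * (\<epsilon> n * (N n * I0))"
    proof -
      have "norm (LINT u|lborel. E u) \<le> (LINT u|lborel. norm (E u))" by (rule integral_norm_bound)
      also have "\<dots> \<le> (LINT u|lborel. 1 / y * (\<epsilon> n * sing_wt b (u / N n)))"
      proof (rule integral_mono_AE)
        show "integrable lborel (\<lambda>u. norm (E u))" using E by simp
        show "integrable lborel (\<lambda>u. 1 / y * (\<epsilon> n * sing_wt b (u / N n)))"
          by (intro integrable_mult_right integral_sing_wt_scaled Nn)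
        \<comment> \<open>The heights at which \<open>E\<close> is not identified form a null
          set.\<close>
        have "AE u in lborel. u \<noteq> 0 \<and> u \<noteq> B \<and> u \<noteq> - B"
          by (intro AE_conjI AE_lborel_singleton)
        then show "AE u in lborel. norm (E u) \<le> 1 / y * (\<epsilon> n * sing_wt b (u / N n))"
        proof eventually_elim
          case (elim u)
          then have u: "u \<noteq> 0" "\<bar>u\<bar> \<noteq> B" by auto
          have "norm (remainder M K \<nu> \<nu>' n x y B (Complex c u)) \<le> 1 / y * (\<epsilon> n * sing_wt b (u / N n))"
            unfolding B_def c_def N_def
          proof (rule eb)
            show "\<bar>ln x - (l + (real M - real K) * ln (real n))\<bar> \<le> R / real n" unfolding lnx using \<open>\<bar>ln (X n)\<bar> \<le> R / real n\<close> .
            show "\<bar>ln y - (l + (real M - real K) * ln (real n))\<bar> \<le> R / real n" unfolding lnx using \<open>\<bar>ln (Y n)\<bar> \<le> R / real n\<close> .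
          qed (use u xy \<open>n0 \<le> n\<close> in \<open>auto simp: B_def N_def\<close>)
          then show ?case using Eerr[OF u] by simp
        qed
      qed
      also have "\<dots> = 1 / y * (\<epsilon> n * (N n * I0))"
        by (simp add: integral_sing_wt_scaled(2)[OF Nn] I0_def)
      finally show ?thesis .
    qed
    have I00: "I0 \<ge> 0" unfolding I0_def by (intro integral_nonneg_AE AE_I2 sing_wt_nonneg)
    \<comment> \<open>The sign of \<open>\<epsilon> n\<close> is not part of
      \<open>error_bound\<close>; nonnegativity of the product follows because it bounds a
      norm.\<close>
    have eN: "0 \<le> 1 / y * (\<epsilon> n * (N n * I0))" using Ebd norm_ge_zero by (rule order_trans[rotated])
    then have eN': "0 \<le> \<epsilon> n * (N n * I0)" using xy by (simp add: zero_le_divide_iff)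
    have E0b: "\<bar>E0 n\<bar> \<le> exp (2 * pi * \<bar>cot \<phi>\<bar> * Bd)"
    proof -
      have e: "E0 n = exp (- (pi * cot \<phi>) * d n)" by (simp add: E0_def d_def exp_diff[symmetric] algebra_simps)
      have "- (pi * cot \<phi>) * d n \<le> \<bar>- (pi * cot \<phi>) * d n\<bar>" by (rule abs_ge_self)
      also have "\<dots> = pi * \<bar>cot \<phi>\<bar> * \<bar>d n\<bar>" by (simp add: abs_mult)
      also have "\<dots> \<le> pi * \<bar>cot \<phi>\<bar> * (2 * Bd)"
        using \<xi>B[of n] \<eta>B[of n] by (intro mult_left_mono) (auto simp: d_def)
      also have "\<dots> = 2 * pi * \<bar>cot \<phi>\<bar> * Bd" by (simp only: mult_ac)
      finally have "exp (- (pi * cot \<phi>) * d n) \<le> exp (2 * pi * \<bar>cot \<phi>\<bar> * Bd)" by (simp only: exp_le_cancel_iff)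
      then show ?thesis unfolding e abs_exp_cancel .
    qed
    have A0: "real n powi (int M - int K - 1) / \<rho> \<ge> 0" using n \<rho> by (simp add: zero_le_power_int)
    have "norm (of_real (?A n) * ?ker n - of_real (main n)) = \<bar>E0 n\<bar> * (real n powi (int M - int K - 1) / \<rho>) * (1 / (2 * pi)) * norm (LINT u|lborel. E u)"
      unfolding diff norm_mult norm_of_real using A0 \<rho> by (simp add: abs_mult)
    also have "\<dots> \<le> exp (2 * pi * \<bar>cot \<phi>\<bar> * Bd) * (real n powi (int M - int K - 1) / \<rho>) * 1 * (1 / y * (\<epsilon> n * (N n * I0)))"
      using A0 pi_ge_two by (intro mult_mono E0b Ebd mult_nonneg_nonneg) auto
    also have "\<dots> = exp (2 * pi * \<bar>cot \<phi>\<bar> * Bd) * (real n powi (int M - int K - 1) / \<rho> / y) * (\<epsilon> n * (N n * I0))"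
      by simp
    also have "\<dots> \<le> exp (2 * pi * \<bar>cot \<phi>\<bar> * Bd) * (2 / (real n * (\<rho> * x\<^sub>0))) * (\<epsilon> n * (N n * I0))"
    proof (intro mult_right_mono mult_left_mono eN')
      \<comment> \<open>The source of the factor 2 in the bound: Y >= 1/2 for large n.\<close>
      have "1 / Y n \<le> 2" using XY by (simp add: divide_le_eq)
      then have "1 / Y n * (1 / (real n * (\<rho> * x\<^sub>0))) \<le> 2 * (1 / (real n * (\<rho> * x\<^sub>0)))"
        using n \<rho> assms(7) by (intro mult_right_mono) auto
      then show "real n powi (int M - int K - 1) / \<rho> / y \<le> 2 / (real n * (\<rho> * x\<^sub>0))"
        unfolding yinv by (simp add: mult_ac)
    qed auto
    also have "\<dots> = exp (2 * pi * \<bar>cot \<phi>\<bar> * Bd) / (\<rho> * x\<^sub>0) * (\<epsilon> n * (2 * (N n / real n) * I0))"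
      by (simp add: mult_ac)
    finally show ?case .
  qed
  have "(\<lambda>n. of_real (?A n) * ?ker n - of_real (main n)) \<longlonglongrightarrow> 0"
    by (rule Lim_null_comparison[OF bound err_lim])
  moreover have "(\<lambda>n. complex_of_real (main n - sinc (pi * d n))) \<longlonglongrightarrow> of_real 0"
    by (intro tendsto_of_real main_lim)
  ultimately have "(\<lambda>n. (of_real (?A n) * ?ker n - of_real (main n)) + complex_of_real (main n - sinc (pi * d n))) \<longlonglongrightarrow> 0 + of_real 0"
    by (rule tendsto_add)
  then show "(\<lambda>n. (case z n of (\<xi>, \<eta>) \<Rightarrow>
        of_real (exp (- pi * \<xi> * cot \<phi>) / exp (- pi * \<eta> * cot \<phi>)
                 * (real n powi (int M - int K - 1) / \<rho>))
        * correlation_kernel M K \<nu> \<nu>' n (\<gamma> n)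
            (real n powi (int M - int K) * (x\<^sub>0 + \<xi> / (real n * \<rho>)))
            (real n powi (int M - int K) * (x\<^sub>0 + \<eta> / (real n * \<rho>))))
      - (case z n of (\<xi>, \<eta>) \<Rightarrow> complex_of_real (sine_kernel \<xi> \<eta>))) \<longlonglongrightarrow> 0"
    unfolding z_eq prod.case sine_kernel_eq_sinc xX yY m_def[symmetric] E0_def[symmetric] d_def[symmetric]
    by simp
qed

end
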